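(* There is a polynomial-time algorithm that takes as input an $n$-vertex graph $G$, positive integers $k$ and $q$, and a rooted tree decomposition $(T,\beta)$ of $G$ such that every adhesion of $(T,\beta)$ has size at most $k$ and every bag of $(T,\beta)$ is $(q,k)$-edge-unbreakable in $G$, and outputs a compact rooted tree decomposition $(T',\beta')$ of $G$ such that (1) every adhesion of $(T',\beta')$ has size at most $8k$, (2) every bag of $(T',\beta')$ is $(q+8k,k)$-edge-unbreakable in $G$, and (3) $T'$ has depth at most $2\lceil\log_2 n\rceil$.
   Context: A tree decomposition of $G$ is a pair $(T,\beta)$ with $T$ a tree and $\beta:V(T)\to 2^{V(G)}$ such that every vertex of $G$ lies in some bag $\beta(t)$, every edge of $G$ has both endpoints in some bag, and for each $v\in V(G)$ the nodes whose bags contain $v$ induce a connected subtree of $T$; it is rooted if $T$ is rooted. The depth of a rooted tree is the maximum length of a root-to-leaf path. For a non-root node $t$ with parent $p$, the adhesion of $t$ is $\sigma(t)=\beta(t)\cap\beta(p)$ (and $\sigma(\text{root})=\emptyset$); adhesions are the sets $\beta(t)\cap\beta(t')$ for edges $tt'$ of $T$. Let $\gamma(t)$ be the union of the bags of all descendants of $t$ (including $t$) and $\alpha(t)=\gamma(t)\setminus\sigma(t)$. The decomposition is compact if for every node $t$ with $\alpha(t)\ne\emptyset$, $G[\alpha(t)]$ is connected and $N_G(\alpha(t))=\sigma(t)$. An edge cut is a partition $(A,B)$ of $V(G)$ (i.e., $A\cup B=V(G)$, $A\cap B=\emptyset$), of order equal to the number of edges between $A$ and $B$. A set $X\subseteq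 V(G)$ is $(q,s)$-edge-unbreakable if every edge cut $(A,B)$ of order at most $s$ satisfies $|A\cap X|\le q$ or $|B\cap X|\le q$.
   Formalization: As defined, compactness at the root forces G to be connected, so the claim fails for non-empty disconnected G; here compactness at every node is claimed when G is connected, and for every G it is claimed at all non-root nodes; all other conclusions hold for every G. *)

theory Defs
  imports Complex_Main "HOL-Computational_Algebra.Polynomial" "Graph_Theory.Graph_Theory"
begin

section \<open>Algorithms and their running time\<close>

text \<open>
  The machine model is the classical language of WHILE programs over binary trees
  (Jones, \<^emph>\<open>Computability and Complexity from a Programming Perspective\<close>).  In contrast to the
  usual unit-cost measure, copying a variable is charged with the size of its value.  The size of
  the store is therefore bounded by its initial size plus the time used, and a Turing machine
  can simulate the programs with polynomial overhead (and vice versa).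
\<close>

datatype data = Leaf | Branch data data

fun dsize :: "data \<Rightarrow> nat" where
  "dsize Leaf = 1"
| "dsize (Branch a b) = dsize a + dsize b + 1"

fun left :: "data \<Rightarrow> data" where
  "left Leaf = Leaf"
| "left (Branch a b) = a"

fun right :: "data \<Rightarrow> data" where
  "right Leaf = Leaf"
| "right (Branch a b) = b"

text \<open>\<^term>\<open>Leaf\<close> is the truth value false; every other tree counts as true.\<close>

datatype expr = Var nat | LeafE | BranchE expr expr | LeftE expr | RightE expr | EqE expr expr

type_synonym store = "nat \<Rightarrow> data"

fun eval_expr :: "expr \<Rightarrow> store \<Rightarrow> data" where
  "eval_expr (Var x) s = s x"
| "eval_expr LeafE s = Leaf"
| "eval_expr (BranchE a b) s = Branch (eval_expr a s) (eval_expr b s)"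
| "eval_expr (LeftE a) s = left (eval_expr a s)"
| "eval_expr (RightE a) s = right (eval_expr a s)"
| "eval_expr (EqE a b) s = (if eval_expr a s = eval_expr b s then Branch Leaf Leaf else Leaf)"

fun expr_cost :: "expr \<Rightarrow> store \<Rightarrow> nat" where
  "expr_cost (Var x) s = dsize (s x)"
| "expr_cost LeafE s = 1"
| "expr_cost (BranchE a b) s = expr_cost a s + expr_cost b s + 1"
| "expr_cost (LeftE a) s = expr_cost a s + 1"
| "expr_cost (RightE a) s = expr_cost a s + 1"
| "expr_cost (EqE a b) s = expr_cost a s + expr_cost b s + 1"

lemma dsize_pos: "1 \<le> dsize d"
  by (cases d) auto

lemma dsize_eval_expr_le_cost: "dsize (eval_expr e s) \<le> expr_cost e s"
proof (induction e)
  case (LeftE e)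
  then show ?case by (cases "eval_expr e s") auto
next
  case (RightE e)
  then show ?case by (cases "eval_expr e s") auto
next
  case (EqE a b)
  then show ?case
    using dsize_pos[of "eval_expr a s"] dsize_pos[of "eval_expr b s"] by auto
qed auto

datatype com = Skip | Assign nat expr | Seq com com | Cond expr com com | While expr com

text \<open>\<open>exec c s t s'\<close>: started in \<open>s\<close>, the program \<open>c\<close> halts after time \<open>t\<close> in \<open>s'\<close>.\<close>

inductive exec :: "com \<Rightarrow> store \<Rightarrow> nat \<Rightarrow> store \<Rightarrow> bool" where
  Skip: "exec Skip s 1 s"
| Assign: "exec (Assign x e) s (1 + expr_cost e s) (s(x := eval_expr e s))"
| Seq: "exec c1 s t1 s1 \<Longrightarrow> exec c2 s1 t2 s2 \<Longrightarrow> exec (Seq c1 c2) s (t1 + t2) s2"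
| CondTrue: "eval_expr b s \<noteq> Leaf \<Longrightarrow> exec c1 s t s1 \<Longrightarrow>
    exec (Cond b c1 c2) s (1 + expr_cost b s + t) s1"
| CondFalse: "eval_expr b s = Leaf \<Longrightarrow> exec c2 s t s1 \<Longrightarrow>
    exec (Cond b c1 c2) s (1 + expr_cost b s + t) s1"
| WhileTrue: "eval_expr b s \<noteq> Leaf \<Longrightarrow> exec c s t1 s1 \<Longrightarrow> exec (While b c) s1 t2 s2 \<Longrightarrow>
    exec (While b c) s (1 + expr_cost b s + t1 + t2) s2"
| WhileFalse: "eval_expr b s = Leaf \<Longrightarrow> exec (While b c) s (1 + expr_cost b s) s"

lemma exec_deterministic:
  "exec c s t s1 \<Longrightarrow> exec c s t' s1' \<Longrightarrow> t = t' \<and> s1 = s1'"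
proof (induction arbitrary: t' s1' rule: exec.induct)
  case (Seq c1 s t1 s1 c2 t2 s2)
  from Seq.prems show ?case by cases (use Seq.IH in blast)
next
  case (WhileTrue b s c t1 s1 t2 s2)
  from WhileTrue.prems show ?case
    by cases (use WhileTrue.hyps WhileTrue.IH in blast)+
next
  case (CondTrue b s c1 t s1 c2)
  from CondTrue.prems show ?case by cases (use CondTrue.hyps CondTrue.IH in blast)+
next
  case (CondFalse b s c2 t s1 c1)
  from CondFalse.prems show ?case by cases (use CondFalse.hyps CondFalse.IH in blast)+
qed (erule exec.cases; simp)+

text \<open>
  A problem is given by a promise \<open>pre\<close> on the inputs and a relation \<open>post\<close> between inputs and
  admissible outputs.  An object may have several codes (a finite set is coded by any enumeration
  of it); the program has to work for all codes of the input and may produce any code of an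
  admissible output.  Input and output are passed in variable 0.  The time bound is a polynomial
  in the size of the code of the input.
\<close>

definition poly_time_solves ::
  "com \<Rightarrow> ('i \<Rightarrow> data set) \<Rightarrow> ('o \<Rightarrow> data set) \<Rightarrow> ('i \<Rightarrow> bool) \<Rightarrow> ('i \<Rightarrow> 'o \<Rightarrow> bool) \<Rightarrow> bool" where
  "poly_time_solves c in_codes out_codes pre post \<longleftrightarrow>
     (\<exists>p :: nat poly. \<forall>x d. pre x \<and> d \<in> in_codes x \<longrightarrow>
        (\<exists>t s y. exec c ((\<lambda>_. Leaf)(0 := d)) t s \<and> t \<le> poly p (dsize d) \<and>
           s 0 \<in> out_codes y \<and> post x y))"

section \<open>Graphs, cuts and rooted trees\<close>

text \<open>
  Finite simple graphs are rendered by \<^locale>\<open>pair_graph\<close>: an undirected edge is a pair of opposite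
  arcs.  Hence each edge between disjoint \<open>A\<close> and \<open>B\<close> contributes exactly one arc
  from \<open>A\<close> to \<open>B\<close>.
\<close>

definition neighbourhood :: "'a pair_pre_digraph \<Rightarrow> 'a set \<Rightarrow> 'a set" where
  "neighbourhood G X = {v \<in> pverts G - X. \<exists>u\<in>X. (u, v) \<in> parcs G}"

definition edge_cut :: "'a pair_pre_digraph \<Rightarrow> 'a set \<Rightarrow> 'a set \<Rightarrow> bool" where
  "edge_cut G A B \<longleftrightarrow> A \<union> B = pverts G \<and> A \<inter> B = {}"

definition cut_order :: "'a pair_pre_digraph \<Rightarrow> 'a set \<Rightarrow> 'a set \<Rightarrow> nat" where
  "cut_order G A B = card {e \<in> parcs G. fst e \<in> A \<and> snd e \<in> B}"

definition edge_unbreakable :: "'a pair_pre_digraph \<Rightarrow> nat \<Rightarrow> nat \<Rightarrow> 'a set \<Rightarrow> bool" where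
  "edge_unbreakable G q s X \<longleftrightarrow>
     (\<forall>A B. edge_cut G A B \<and> cut_order G A B \<le> s \<longrightarrow> card (A \<inter> X) \<le> q \<or> card (B \<inter> X) \<le> q)"

text \<open>
  A rooted tree is an out-tree: its arcs are the tree edges, oriented from parent to child.
  Uniqueness of the walk from the root excludes cycles of the underlying undirected graph.
\<close>

definition rooted_tree :: "'t pair_pre_digraph \<Rightarrow> 't \<Rightarrow> bool" where
  "rooted_tree T r \<longleftrightarrow> pair_fin_digraph T \<and> r \<in> pverts T \<and>
     (\<forall>t\<in>pverts T. \<exists>!p. pre_digraph.awalk (with_proj T) r p t)"

definition leaves :: "'t pair_pre_digraph \<Rightarrow> 't set" where
  "leaves T = {t \<in> pverts T. \<forall>c. (t, c) \<notin> parcs T}"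

definition tree_depth :: "'t pair_pre_digraph \<Rightarrow> 't \<Rightarrow> nat" where
  "tree_depth T r = Max {length p | p l. l \<in> leaves T \<and> pre_digraph.awalk (with_proj T) r p l}"

section \<open>Tree decompositions\<close>

text \<open>
  \<^const>\<open>Digraph_Component.connected\<close> is connectedness of the underlying undirected graph
  (and includes non-emptiness).
\<close>

definition rooted_tree_decomposition ::
  "'a pair_pre_digraph \<Rightarrow> 't pair_pre_digraph \<Rightarrow> 't \<Rightarrow> ('t \<Rightarrow> 'a set) \<Rightarrow> bool" where
  "rooted_tree_decomposition G T r \<beta> \<longleftrightarrow>
     rooted_tree T r \<and>
     (\<forall>t\<in>pverts T. \<beta> t \<subseteq> pverts G) \<and>
     (\<forall>v\<in>pverts G. \<exists>t\<in>pverts T. v \<in> \<beta> t) \<and>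
     (\<forall>(u, v)\<in>parcs G. \<exists>t\<in>pverts T. u \<in> \<beta> t \<and> v \<in> \<beta> t) \<and>
     (\<forall>v\<in>pverts G. Digraph_Component.connected (with_proj T \<restriction> {t \<in> pverts T. v \<in> \<beta> t}))"

definition adhesions_le :: "'t pair_pre_digraph \<Rightarrow> ('t \<Rightarrow> 'a set) \<Rightarrow> nat \<Rightarrow> bool" where
  "adhesions_le T \<beta> k \<longleftrightarrow> (\<forall>(p, t)\<in>parcs T. card (\<beta> t \<inter> \<beta> p) \<le> k)"

text \<open>In a rooted tree the union has exactly one member, for the parent of \<open>t\<close>, and none at the root.\<close>

definition adhesion :: "'t pair_pre_digraph \<Rightarrow> ('t \<Rightarrow> 'a set) \<Rightarrow> 't \<Rightarrow> 'a set" where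
  "adhesion T \<beta> t = (\<Union>p\<in>{p. (p, t) \<in> parcs T}. \<beta> t \<inter> \<beta> p)"

definition subtree_verts :: "'t pair_pre_digraph \<Rightarrow> ('t \<Rightarrow> 'a set) \<Rightarrow> 't \<Rightarrow> 'a set" where
  "subtree_verts T \<beta> t = (\<Union>s\<in>{s. t \<rightarrow>\<^sup>*\<^bsub>with_proj T\<^esub> s}. \<beta> s)"

definition proper_verts :: "'t pair_pre_digraph \<Rightarrow> ('t \<Rightarrow> 'a set) \<Rightarrow> 't \<Rightarrow> 'a set" where
  "proper_verts T \<beta> t = subtree_verts T \<beta> t - adhesion T \<beta> t"

definition compact_at ::
  "'a pair_pre_digraph \<Rightarrow> 't pair_pre_digraph \<Rightarrow> ('t \<Rightarrow> 'a set) \<Rightarrow> 't \<Rightarrow> bool" where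
  "compact_at G T \<beta> t \<longleftrightarrow>
     (proper_verts T \<beta> t \<noteq> {} \<longrightarrow>
        Digraph_Component.connected (with_proj G \<restriction> proper_verts T \<beta> t) \<and>
        neighbourhood G (proper_verts T \<beta> t) = adhesion T \<beta> t)"

definition compact_decomposition ::
  "'a pair_pre_digraph \<Rightarrow> 't pair_pre_digraph \<Rightarrow> ('t \<Rightarrow> 'a set) \<Rightarrow> bool" where
  "compact_decomposition G T \<beta> \<longleftrightarrow> (\<forall>t\<in>pverts T. compact_at G T \<beta> t)"

text \<open>
  At the root \<open>r\<close> the set \<^term>\<open>proper_verts T \<beta> r\<close> is the whole vertex set, so a non-empty
  disconnected graph has no compact decomposition whatsoever.  For such graphs
  the condition is only meaningful at the other nodes.
\<close>

definition compact_below_root ::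
  "'a pair_pre_digraph \<Rightarrow> 't pair_pre_digraph \<Rightarrow> 't \<Rightarrow> ('t \<Rightarrow> 'a set) \<Rightarrow> bool" where
  "compact_below_root G T r \<beta> \<longleftrightarrow> (\<forall>t\<in>pverts T - {r}. compact_at G T \<beta> t)"

section \<open>Codes\<close>

text \<open>Numbers are coded in binary, least significant bit first.\<close>

fun enc_nat :: "nat \<Rightarrow> data" where
  "enc_nat n = (if n = 0 then Leaf
     else Branch (if even n then Leaf else Branch Leaf Leaf) (enc_nat (n div 2)))"

declare enc_nat.simps [simp del]

fun enc_list :: "('a \<Rightarrow> data) \<Rightarrow> 'a list \<Rightarrow> data" where
  "enc_list f [] = Leaf"
| "enc_list f (x # xs) = Branch (f x) (enc_list f xs)"

definition set_codes :: "('a \<Rightarrow> data) \<Rightarrow> 'a set \<Rightarrow> data set" where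
  "set_codes f A = {enc_list f xs | xs. distinct xs \<and> set xs = A}"

definition enc_arc :: "nat \<times> nat \<Rightarrow> data" where
  "enc_arc e = Branch (enc_nat (fst e)) (enc_nat (snd e))"

definition graph_codes :: "nat pair_pre_digraph \<Rightarrow> data set" where
  "graph_codes G =
     {Branch dv da | dv da. dv \<in> set_codes enc_nat (pverts G) \<and> da \<in> set_codes enc_arc (parcs G)}"

text \<open>
  A code of the bag function lists every node together with a code of its bag; values of
  \<open>\<beta>\<close> outside the node set are not represented.
\<close>

definition bag_codes :: "nat pair_pre_digraph \<Rightarrow> (nat \<Rightarrow> nat set) \<Rightarrow> data set" where
  "bag_codes T \<beta> =
     {enc_list (\<lambda>t. Branch (enc_nat t) (b t)) ts | b ts.
        distinct ts \<and> set ts = pverts T \<and> (\<forall>t\<in>pverts T. b t \<in> set_codes enc_nat (\<beta> t))}"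

type_synonym decomposition = "nat pair_pre_digraph \<times> nat \<times> (nat \<Rightarrow> nat set)"

fun decomposition_codes :: "decomposition \<Rightarrow> data set" where
  "decomposition_codes (T, r, \<beta>) =
     {Branch dT (Branch (enc_nat r) db) | dT db. dT \<in> graph_codes T \<and> db \<in> bag_codes T \<beta>}"

fun instance_codes :: "nat pair_pre_digraph \<times> nat \<times> nat \<times> decomposition \<Rightarrow> data set" where
  "instance_codes (G, k, q, D) =
     {Branch dG (Branch (enc_nat k) (Branch (enc_nat q) dD)) | dG dD.
        dG \<in> graph_codes G \<and> dD \<in> decomposition_codes D}"

end

theory Submission
  imports Defs
begin

text \<open>
  A node of the new tree is a pair of a depth and a vertex set \<open>C\<close> (initially all vertices). It
  receives the bag \<open>(C \<inter> B) \<union> N(C)\<close> for a suitable input bag \<open>B\<close>, and its children are the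
  components of \<open>C - B\<close>; then \<open>\<alpha> = C\<close> and \<open>\<sigma> = N(C)\<close> at this node, which makes the decomposition
  compact. Let \<open>K\<close> be the largest adhesion of the input.  For every weight on the vertices some
  input bag leaves at most half of the weight on each of its sides, and the neighbourhood of a component
  \<open>A\<close> of \<open>C - B\<close> consists of at most \<open>K\<close> vertices of \<open>B\<close> and the vertices of \<open>N(C)\<close> on the side of \<open>A\<close>.
  If \<open>|N(C)| \<le> 3K\<close>, halving \<open>C\<close> gives \<open>|N(A)| \<le> 4K\<close>; otherwise halving \<open>N(C)\<close> brings
  \<open>|N(A)|\<close> down from \<open>4K\<close> to \<open>3K\<close>. So every second step halves the vertex set, and the depth
  is at most twice the logarithm of the number of vertices.

  The tree structure of the input matters only for the existence of \<open>B\<close>: the algorithm tries all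
  bags. It is written as a function on lists, and polynomial-time computability is propagated through
  the list combinators it is built from.
\<close>

section \<open>Polynomial-time functions on encoded values\<close>

text \<open>Neither kind of halving would do alone. Halving \<open>C\<close> at every step lets
  \<open>|N(C)|\<close> grow by \<open>K\<close> each time; halving \<open>N(C)\<close> at every
  step keeps it small but gives no progress in \<open>C\<close>. The threshold \<open>3 * K\<close>
  is the largest value that survives one more \<open>K\<close> within the bound
  \<open>4 * K\<close>, and it is the value to which a halving returns: half of \<open>4 * K\<close>
  plus \<open>K\<close>. The bound \<open>4 * K\<close> sustains itself: it is required for choosing
  \<open>B\<close> and holds again for every component. Unbreakability survives because a new bag
  consists of part of an input bag and at most \<open>4 * K\<close> further vertices, where
  \<open>K \<le> k\<close>. On the computational side the obstacle is size: composing programs needs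
  polynomial bounds on all intermediate values, and the list of all sets at one depth is short
  because these sets are disjoint, which is known for promised inputs. Therefore polynomial time is
  relative to a domain, and a bound proved together with correctness is fed back into the time
  analysis.\<close>

class encodable =
  fixes code :: "'a \<Rightarrow> data"
  assumes code_eq_iff [simp]: "code x = code y \<longleftrightarrow> x = y"

lemma enc_nat_inj: "enc_nat m = enc_nat n \<Longrightarrow> m = n"
proof (induction m arbitrary: n rule: less_induct)
  case (less m)
  show ?case
  proof (cases "m = 0 \<or> n = 0")
    case True
    then show ?thesis using less.prems by (auto simp: enc_nat.simps[of m] enc_nat.simps[of n] split: if_splits)
  next
    case False
    then have "even m = even n" "enc_nat (m div 2) = enc_nat (n div 2)"
      using less.prems by (auto simp: enc_nat.simps[of m] enc_nat.simps[of n] split: if_splits)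
    moreover from this(2) False have "m div 2 = n div 2" by (intro less.IH) auto
    ultimately show ?thesis by (metis div_mult_mod_eq parity_cases)
  qed
qed

instantiation nat :: encodable
begin
definition code_nat_eq: "code (n :: nat) = enc_nat n"
instance by standard (auto simp: code_nat_eq dest: enc_nat_inj)
end

instantiation bool :: encodable
begin
definition code_bool_eq: "code b = (if b then Branch Leaf Leaf else Leaf)"
instance by standard (auto simp: code_bool_eq)
end

instantiation prod :: (encodable, encodable) encodable
begin
definition code_prod_eq: "code p = Branch (code (fst p)) (code (snd p))"
instance by standard (auto simp: code_prod_eq prod_eq_iff)
end

lemma enc_list_inj: "inj f \<Longrightarrow> enc_list f xs = enc_list f ys \<Longrightarrow> xs = ys"
proof (induction xs arbitrary: ys)
  case Nil then show ?case by (cases ys) auto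
next
  case (Cons x xs) then show ?case by (cases ys) (auto dest: injD)
qed

instantiation list :: (encodable) encodable
begin
definition code_list_eq: "code xs = enc_list code xs"
instance
proof
  fix xs ys :: "'a list"
  show "code xs = code ys \<longleftrightarrow> xs = ys"
    using enc_list_inj[of code xs ys] by (auto simp: code_list_eq inj_def)
qed
end

lemma code_Nil [simp]: "code [] = Leaf" and
  code_Cons [simp]: "code (x # xs) = Branch (code x) (code xs)"
  by (simp_all add: code_list_eq)

lemma code_Pair [simp]: "code (a, b) = Branch (code a) (code b)"
  by (simp add: code_prod_eq)

section \<open>Polynomial bounds in the size of the code\<close>

abbreviation sz :: "'a::encodable \<Rightarrow> nat" where "sz x \<equiv> dsize (code x)"

lemma sz_pos [simp]: "0 < sz x"
  using dsize_pos[of "code x"] by simp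

text \<open>One power is general enough: the base is at least 2, so a larger exponent absorbs
  constants and sums, and only an exponent has to be tracked.\<close>

definition pbd :: "'a::encodable set \<Rightarrow> ('a \<Rightarrow> nat) \<Rightarrow> bool" where
  "pbd D h \<longleftrightarrow> (\<exists>k. \<forall>x\<in>D. h x \<le> (sz x + 1) ^ k)"

lemma pbd_mono: "pbd D g \<Longrightarrow> (\<And>x. x \<in> D \<Longrightarrow> h x \<le> g x) \<Longrightarrow> pbd D h"
  unfolding pbd_def by (meson order_trans)

lemma pbd_subset: "pbd E h \<Longrightarrow> D \<subseteq> E \<Longrightarrow> pbd D h"
  unfolding pbd_def by blast

lemma pbd_const [intro, simp]: "pbd D (\<lambda>_. c)"
proof -
  have "c \<le> (sz x + 1) ^ c" for x :: 'a
    using less_exp[of c] power_mono[of 2 "sz x + 1" c] sz_pos[of x] by linarith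
  then show ?thesis unfolding pbd_def by blast
qed

lemma pbd_add [intro]:
  assumes "pbd D f" "pbd D g" shows "pbd D (\<lambda>x. f x + g x)"
proof -
  obtain a b where a: "\<forall>x\<in>D. f x \<le> (sz x + 1) ^ a" and b: "\<forall>x\<in>D. g x \<le> (sz x + 1) ^ b"
    using assms unfolding pbd_def by blast
  have "f x + g x \<le> (sz x + 1) ^ (a + b + 1)" if "x \<in> D" for x
  proof -
    let ?M = "sz x + 1"
    have "f x \<le> ?M ^ (a + b)" "g x \<le> ?M ^ (a + b)"
      using a b that power_increasing[of a "a+b" ?M] power_increasing[of b "a+b" ?M]
      by (meson le_add1 le_add2 order_trans)+
    then have "f x + g x \<le> 2 * ?M ^ (a + b)" by simp
    also have "\<dots> \<le> ?M * ?M ^ (a + b)" using sz_pos[of x] by (intro mult_right_mono) linarith+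
    finally show ?thesis by simp
  qed
  then show ?thesis unfolding pbd_def by blast
qed

lemma pbd_mult [intro]:
  assumes "pbd D f" "pbd D g" shows "pbd D (\<lambda>x. f x * g x)"
proof -
  obtain a b where "\<forall>x\<in>D. f x \<le> (sz x + 1) ^ a" "\<forall>x\<in>D. g x \<le> (sz x + 1) ^ b"
    using assms unfolding pbd_def by blast
  then have "\<forall>x\<in>D. f x * g x \<le> (sz x + 1) ^ (a + b)" by (simp add: mult_mono power_add)
  then show ?thesis unfolding pbd_def by blast
qed

lemma pbd_power [intro]: "pbd D f \<Longrightarrow> pbd D (\<lambda>x. f x ^ n)"
  by (induction n) auto

lemma pbd_sz [intro, simp]: "pbd D (\<lambda>x. sz x)"
  unfolding pbd_def by (rule exI[of _ 1]) simp

lemma pbd_comp: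
  assumes "pbd E h" "f ` D \<subseteq> E" "pbd D (\<lambda>x. sz (f x))"
  shows "pbd D (\<lambda>x. h (f x))"
proof -
  obtain k where "\<forall>x\<in>E. h x \<le> (sz x + 1) ^ k" using assms unfolding pbd_def by blast
  then have "\<And>x. x \<in> D \<Longrightarrow> h (f x) \<le> (sz (f x) + 1) ^ k" using assms(2) by blast
  moreover have "pbd D (\<lambda>x. (sz (f x) + 1) ^ k)" by (intro pbd_power pbd_add pbd_const assms(3))
  ultimately show ?thesis by (rule pbd_mono[rotated])
qed

section \<open>Upper bounds on running times\<close>

definition exec_within :: "com \<Rightarrow> store \<Rightarrow> nat \<Rightarrow> store \<Rightarrow> bool" where
  "exec_within c s b s' \<longleftrightarrow> (\<exists>t\<le>b. exec c s t s')"

lemma exec_within_mono: "exec_within c s b s' \<Longrightarrow> b \<le> b' \<Longrightarrow> exec_within c s b' s'"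
  unfolding exec_within_def by (meson order_trans)

lemma exec_within_Assign:
  "s' = s(x := eval_expr e s) \<Longrightarrow> 1 + expr_cost e s \<le> b \<Longrightarrow> exec_within (Assign x e) s b s'"
  unfolding exec_within_def using exec.Assign by blast

lemma exec_within_Seq:
  "exec_within c1 s b1 s1 \<Longrightarrow> exec_within c2 s1 b2 s2 \<Longrightarrow> exec_within (Seq c1 c2) s (b1 + b2) s2"
  unfolding exec_within_def by (meson add_mono exec.Seq)

lemma exec_within_CondTrue:
  "eval_expr e s \<noteq> Leaf \<Longrightarrow> exec_within c1 s b s' \<Longrightarrow>
    exec_within (Cond e c1 c2) s (1 + expr_cost e s + b) s'"
  unfolding exec_within_def using exec.CondTrue add_left_mono by blast

lemma exec_within_CondFalse:
  "eval_expr e s = Leaf \<Longrightarrow> exec_within c2 s b s' \<Longrightarrow>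
    exec_within (Cond e c1 c2) s (1 + expr_cost e s + b) s'"
  unfolding exec_within_def using exec.CondFalse add_left_mono by blast

lemma exec_within_WhileTrue:
  assumes "eval_expr e s \<noteq> Leaf" "exec_within c s b1 s1" "exec_within (While e c) s1 b2 s2"
  shows "exec_within (While e c) s (1 + expr_cost e s + b1 + b2) s2"
proof -
  obtain t1 t2 where "t1 \<le> b1" "t2 \<le> b2" "exec c s t1 s1" "exec (While e c) s1 t2 s2"
    using assms unfolding exec_within_def by blast
  then have "exec (While e c) s (1 + expr_cost e s + t1 + t2) s2"
    using exec.WhileTrue assms(1) by blast
  moreover have "1 + expr_cost e s + t1 + t2 \<le> 1 + expr_cost e s + b1 + b2"
    using \<open>t1 \<le> b1\<close> \<open>t2 \<le> b2\<close> by simp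
  ultimately show ?thesis unfolding exec_within_def by blast
qed

lemma exec_within_WhileFalse:
  "eval_expr e s = Leaf \<Longrightarrow> exec_within (While e c) s (1 + expr_cost e s) s"
  unfolding exec_within_def using exec.WhileFalse by blast

text \<open>
  Variables from \<open>N\<close> on are preserved, so that a caller can keep its own values there.  The initial
  contents of the other variables are arbitrary.
\<close>

definition runs :: "com \<Rightarrow> nat \<Rightarrow> 'a::encodable set \<Rightarrow> ('a \<Rightarrow> 'b::encodable) \<Rightarrow> ('a \<Rightarrow> nat) \<Rightarrow> bool" where
  "runs c N D f T \<longleftrightarrow> (\<forall>x\<in>D. \<forall>s. s 0 = code x \<longrightarrow>
     (\<exists>s'. exec_within c s (T x) s' \<and> s' 0 = code (f x) \<and> (\<forall>v\<ge>N. s' v = s v)))"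

lemma runsE:
  assumes "runs c N D f T" "x \<in> D" "s 0 = code x"
  obtains s' where "exec_within c s (T x) s'" "s' 0 = code (f x)" "\<And>v. v \<ge> N \<Longrightarrow> s' v = s v"
  using assms unfolding runs_def by blast

text \<open>The size of the result is bounded explicitly because a program run afterwards takes time
  polynomial in that size.\<close>

definition ptime :: "'a::encodable set \<Rightarrow> ('a \<Rightarrow> 'b::encodable) \<Rightarrow> bool" where
  "ptime D f \<longleftrightarrow> (\<exists>c N T. runs c N D f T \<and> pbd D T \<and> pbd D (\<lambda>x. sz (f x)))"

lemma ptimeI: "runs c N D f T \<Longrightarrow> pbd D T \<Longrightarrow> pbd D (\<lambda>x. sz (f x)) \<Longrightarrow> ptime D f"
  unfolding ptime_def by blast

lemma ptime_sz: "ptime D f \<Longrightarrow> pbd D (\<lambda>x. sz (f x))"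
  unfolding ptime_def by blast

lemma ptimeE:
  assumes "ptime D f"
  obtains c N T where "runs c N D f T" "pbd D T"
  using assms unfolding ptime_def by blast

lemma ptime_subset:
  assumes "ptime E f" "D \<subseteq> E" shows "ptime D f"
proof -
  obtain c N T where c: "runs c N E f T" "pbd E T" using assms(1) by (rule ptimeE)
  have "runs c N D f T" using c(1) assms(2) unfolding runs_def by blast
  then show ?thesis
    using pbd_subset[OF c(2) assms(2)] pbd_subset[OF ptime_sz[OF assms(1)] assms(2)] by (rule ptimeI)
qed

lemma ptime_cong: "ptime D f \<Longrightarrow> (\<And>x. x \<in> D \<Longrightarrow> f x = g x) \<Longrightarrow> ptime D g"
  unfolding ptime_def runs_def pbd_def by simp

lemma ptime_expr:
  assumes "\<And>x s. x \<in> D \<Longrightarrow> s 0 = code x \<Longrightarrow> eval_expr e s = code (f x)"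
    and "\<And>s. expr_cost e s \<le> m + m * dsize (s 0)"
  shows "ptime D f"
proof (rule ptimeI)
  show "runs (Assign 0 e) 1 D f (\<lambda>x. 1 + (m + m * sz x))"
    unfolding runs_def
  proof (intro ballI allI impI exI conjI)
    fix x and s :: store assume x: "x \<in> D" "s 0 = code x"
    show "exec_within (Assign 0 e) s (1 + (m + m * sz x)) (s(0 := eval_expr e s))"
      by (rule exec_within_Assign) (use assms(2)[of s] x in auto)
    show "(s(0 := eval_expr e s)) 0 = code (f x)" using assms(1)[of x s] x by simp
  qed auto
  show "pbd D (\<lambda>x. 1 + (m + m * sz x))" by (intro pbd_add pbd_mult pbd_const pbd_sz)
  have "sz (f x) \<le> m + m * sz x" if "x \<in> D" for x
  proof -
    \<comment> \<open>Evaluation never produces more than it charges for, so the cost in any store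
      holding the input bounds the size of the result.\<close>
    let ?s = "(\<lambda>_. code x) :: store"
    have "dsize (eval_expr e ?s) \<le> m + m * dsize (?s 0)"
      using dsize_eval_expr_le_cost assms(2) order_trans by blast
    then show ?thesis using assms(1)[of x ?s] that by simp
  qed
  moreover have "pbd D (\<lambda>x. m + m * sz x)" by (intro pbd_add pbd_mult pbd_const pbd_sz)
  ultimately show "pbd D (\<lambda>x. sz (f x))" by (rule pbd_mono[rotated])
qed

section \<open>Closure properties of polynomial time\<close>

named_theorems pt

lemma ptime_comp:
  assumes "ptime E g" "ptime D f" "f ` D \<subseteq> E"
  shows "ptime D (\<lambda>x. g (f x))"
proof -
  obtain c N T where c: "runs c N D f T" "pbd D T" using assms(2) by (rule ptimeE)
  obtain c' N' T' where c': "runs c' N' E g T'" "pbd E T'" using assms(1) by (rule ptimeE)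
  show ?thesis
  proof (rule ptimeI)
    show "runs (Seq c c') (max N N') D (\<lambda>x. g (f x)) (\<lambda>x. T x + T' (f x))"
      unfolding runs_def
    proof (intro ballI allI impI)
      fix x and s :: store assume x: "x \<in> D" "s 0 = code x"
      obtain s1 where s1: "exec_within c s (T x) s1" "s1 0 = code (f x)" "\<And>v. v \<ge> N \<Longrightarrow> s1 v = s v"
        using runsE[OF c(1), of x s] x by blast
      obtain s2 where s2: "exec_within c' s1 (T' (f x)) s2" "s2 0 = code (g (f x))" "\<And>v. v \<ge> N' \<Longrightarrow> s2 v = s1 v"
        using runsE[OF c'(1), of "f x" s1] s1(2) x assms(3) by blast
      show "\<exists>s'. exec_within (Seq c c') s (T x + T' (f x)) s' \<and> s' 0 = code (g (f x)) \<and>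
          (\<forall>v\<ge>max N N'. s' v = s v)"
        using exec_within_Seq[OF s1(1) s2(1)] s1 s2 by auto
    qed
    show "pbd D (\<lambda>x. T x + T' (f x))"
      using c(2) pbd_comp[OF c'(2) assms(3) ptime_sz[OF assms(2)]] by auto
    show "pbd D (\<lambda>x. sz (g (f x)))"
      using pbd_comp[OF ptime_sz[OF assms(1)] assms(3) ptime_sz[OF assms(2)]] .
  qed
qed

lemma ptime_id [pt]: "ptime D (\<lambda>x. x)"
  by (rule ptime_expr[of _ "Var 0" _ 1]) auto

fun expr_of :: "data \<Rightarrow> expr" where
  "expr_of Leaf = LeafE"
| "expr_of (Branch a b) = BranchE (expr_of a) (expr_of b)"

lemma eval_expr_of [simp]: "eval_expr (expr_of d) s = d"
  by (induction d) auto

lemma cost_expr_of [simp]: "expr_cost (expr_of d) s = dsize d"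
  by (induction d) auto

lemma ptime_const [pt]: "ptime D (\<lambda>_. c)"
  by (rule ptime_expr[of _ "expr_of (code c)" _ "sz c"]) auto

lemma ptime_fst [pt]: "ptime D f \<Longrightarrow> ptime D (\<lambda>x. fst (f x))"
  by (rule ptime_comp[where E = UNIV, rotated], assumption, simp)
    (rule ptime_expr[of _ "LeftE (Var 0)" _ 1]; auto simp: code_prod_eq)

lemma ptime_snd [pt]: "ptime D f \<Longrightarrow> ptime D (\<lambda>x. snd (f x))"
  by (rule ptime_comp[where E = UNIV, rotated], assumption, simp)
    (rule ptime_expr[of _ "RightE (Var 0)" _ 1]; auto simp: code_prod_eq)

lemma ptime_Pair [pt]:
  assumes "ptime D f" "ptime D g"
  shows "ptime D (\<lambda>x. (f x, g x))"
proof -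
  obtain c K T where c: "runs c K D f T" "pbd D T" using assms(1) by (rule ptimeE)
  obtain c' K' T' where c': "runs c' K' D g T'" "pbd D T'" using assms(2) by (rule ptimeE)
  \<comment> \<open>Both \<open>N\<close> and \<open>N + 1\<close> are out of reach of the two
    programs and, thanks to the added 1, different from the input variable 0.\<close>
  define N where "N = max K K' + 1"
  let ?p = "Seq (Assign N (Var 0)) (Seq c (Seq (Assign (N + 1) (Var 0)) (Seq (Assign 0 (Var N))
    (Seq c' (Assign 0 (BranchE (Var (N + 1)) (Var 0)))))))"
  let ?T = "\<lambda>x. (1 + sz x) + (T x + ((1 + sz (f x)) + ((1 + sz x) + (T' x + (2 + sz (f x) + sz (g x))))))"
  show ?thesis
  proof (rule ptimeI)
    show "runs ?p (N + 2) D (\<lambda>x. (f x, g x)) ?T"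
      unfolding runs_def
    proof (intro ballI allI impI)
      fix x and s :: store assume x: "x \<in> D" "s 0 = code x"
      define s0 where "s0 = s(N := code x)"
      have "s0 0 = code x" using x by (simp add: s0_def)
      then obtain s1 where s1: "exec_within c s0 (T x) s1" "s1 0 = code (f x)" "\<And>v. v \<ge> K \<Longrightarrow> s1 v = s0 v"
        using runsE[OF c(1), of x s0] x by blast
      define s2 where "s2 = s1(N + 1 := code (f x), 0 := code x)"
      have "s2 0 = code x" by (simp add: s2_def)
      then obtain s3 where s3: "exec_within c' s2 (T' x) s3" "s3 0 = code (g x)" "\<And>v. v \<ge> K' \<Longrightarrow> s3 v = s2 v"
        using runsE[OF c'(1), of x s2] x by blast
      define s4 where "s4 = s3(0 := code (f x, g x))"
      have s1N: "s1 N = code x" using s1(3)[of N] by (simp add: N_def s0_def)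
      have s3N: "s3 (N + 1) = code (f x)" using s3(3)[of "N + 1"] by (simp add: N_def s2_def)
      have "exec_within (Assign N (Var 0)) s (1 + sz x) s0"
        by (rule exec_within_Assign) (simp_all add: s0_def x)
      moreover note s1(1)
      moreover have "exec_within (Assign (N + 1) (Var 0)) s1 (1 + sz (f x)) (s1(N + 1 := code (f x)))"
        by (rule exec_within_Assign) (simp_all add: s1)
      moreover have "exec_within (Assign 0 (Var N)) (s1(N + 1 := code (f x))) (1 + sz x) s2"
        by (rule exec_within_Assign) (simp_all add: s1N s2_def)
      moreover note s3(1)
      moreover have "exec_within (Assign 0 (BranchE (Var (N + 1)) (Var 0))) s3 (2 + sz (f x) + sz (g x)) s4"
        by (rule exec_within_Assign) (use s3N s3(2) in \<open>simp_all add: s4_def\<close>)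
      ultimately have "exec_within ?p s (?T x) s4"
        by (intro exec_within_Seq)
      moreover have "s4 0 = code (f x, g x)" by (simp add: s4_def)
      moreover have "s4 v = s v" if "v \<ge> N + 2" for v
        using that s1(3)[of v] s3(3)[of v] by (auto simp: s4_def s2_def s0_def N_def)
      ultimately show "\<exists>s'. exec_within ?p s (?T x) s' \<and> s' 0 = code (f x, g x) \<and> (\<forall>v\<ge>N + 2. s' v = s v)"
        by blast
    qed
    show "pbd D ?T"
      using ptime_sz[OF assms(1)] ptime_sz[OF assms(2)] c(2) c'(2) by (intro pbd_add pbd_const pbd_sz)
    show "pbd D (\<lambda>x. sz (f x, g x))"
      using ptime_sz[OF assms(1)] ptime_sz[OF assms(2)] 
      by (simp only: code_Pair dsize.simps) (intro pbd_add pbd_const)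
  qed
qed

text \<open>Each branch has to be fast only where it is taken, so a test can guard a partial
  function such as \<open>hd\<close>.\<close>

lemma ptime_if [pt]:
  assumes "ptime D b" "ptime {x \<in> D. b x} f" "ptime {x \<in> D. \<not> b x} g"
  shows "ptime D (\<lambda>x. if b x then f x else g x)"
proof -
  obtain cb Kb Tb where cb: "runs cb Kb D b Tb" "pbd D Tb" using assms(1) by (rule ptimeE)
  obtain c K T where c: "runs c K {x \<in> D. b x} f T" "pbd {x \<in> D. b x} T" using assms(2) by (rule ptimeE)
  obtain c' K' T' where c': "runs c' K' {x \<in> D. \<not> b x} g T'" "pbd {x \<in> D. \<not> b x} T'" using assms(3) by (rule ptimeE)
  have pbd_if: "pbd D (\<lambda>x. if b x then h x else h' x)" if h: "pbd {x \<in> D. b x} h" "pbd {x \<in> D. \<not> b x} h'" for h h'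
  proof -
    obtain a a' where "\<forall>x\<in>{x \<in> D. b x}. h x \<le> (sz x + 1) ^ a" "\<forall>x\<in>{x \<in> D. \<not> b x}. h' x \<le> (sz x + 1) ^ a'"
      using h unfolding pbd_def by blast
    then have "(if b x then h x else h' x) \<le> (sz x + 1) ^ a + (sz x + 1) ^ a'" if "x \<in> D" for x
      using that by (auto intro: trans_le_add1 trans_le_add2)
    moreover have "pbd D (\<lambda>x. (sz x + 1) ^ a + (sz x + 1) ^ a')" by (intro pbd_add pbd_power pbd_const pbd_sz)
    ultimately show ?thesis by (rule pbd_mono[rotated])
  qed
  define N where "N = max Kb (max K K') + 1"
  let ?p = "Seq (Assign N (Var 0)) (Seq cb (Seq (Assign (N + 1) (Var 0)) (Seq (Assign 0 (Var N))
    (Cond (Var (N + 1)) c c'))))"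
  let ?T = "\<lambda>x. (1 + sz x) + (Tb x + ((1 + sz (b x)) + ((1 + sz x) + (1 + sz (b x) + (if b x then T x else T' x)))))"
  show ?thesis
  proof (rule ptimeI)
    show "runs ?p (N + 2) D (\<lambda>x. if b x then f x else g x) ?T"
      unfolding runs_def
    proof (intro ballI allI impI)
      fix x and s :: store assume x: "x \<in> D" "s 0 = code x"
      define s0 where "s0 = s(N := code x)"
      have "s0 0 = code x" using x by (simp add: s0_def)
      then obtain s1 where s1: "exec_within cb s0 (Tb x) s1" "s1 0 = code (b x)" "\<And>v. v \<ge> Kb \<Longrightarrow> s1 v = s0 v"
        using runsE[OF cb(1), of x s0] x by blast
      define s2 where "s2 = s1(N + 1 := code (b x), 0 := code x)"
      have s2: "s2 0 = code x" "s2 (N + 1) = code (b x)" by (simp_all add: s2_def)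
      obtain s3 where s3: "exec_within (Cond (Var (N + 1)) c c') s2 (1 + sz (b x) + (if b x then T x else T' x)) s3"
         "s3 0 = code (if b x then f x else g x)" "\<And>v. v \<ge> max K K' \<Longrightarrow> s3 v = s2 v"
      proof (cases "b x")
        case True
        then obtain s3 where "exec_within c s2 (T x) s3" "s3 0 = code (f x)" "\<And>v. v \<ge> K \<Longrightarrow> s3 v = s2 v"
          using runsE[OF c(1), of x s2] s2(1) x by blast
        then show ?thesis using that[of s3] exec_within_CondTrue[of "Var (N + 1)" s2 c "T x" s3] True s2
          by (auto simp: code_bool_eq)
      next
        case False
        then obtain s3 where "exec_within c' s2 (T' x) s3" "s3 0 = code (g x)" "\<And>v. v \<ge> K' \<Longrightarrow> s3 v = s2 v"
          using runsE[OF c'(1), of x s2] s2(1) x by blast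
        then show ?thesis using that[of s3] exec_within_CondFalse[of "Var (N + 1)" s2 c' "T' x" s3] False s2
          by (auto simp: code_bool_eq)
      qed
      have s1N: "s1 N = code x" using s1(3)[of N] by (simp add: N_def s0_def)
      have "exec_within (Assign N (Var 0)) s (1 + sz x) s0"
        by (rule exec_within_Assign) (simp_all add: s0_def x)
      moreover note s1(1)
      moreover have "exec_within (Assign (N + 1) (Var 0)) s1 (1 + sz (b x)) (s1(N + 1 := code (b x)))"
        by (rule exec_within_Assign) (simp_all add: s1)
      moreover have "exec_within (Assign 0 (Var N)) (s1(N + 1 := code (b x))) (1 + sz x) s2"
        by (rule exec_within_Assign) (simp_all add: s1N s2_def)
      moreover note s3(1)
      ultimately have "exec_within ?p s (?T x) s3"
        by (intro exec_within_Seq)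
      moreover have "s3 v = s v" if "v \<ge> N + 2" for v
      proof -
        have "Kb \<le> v" "max K K' \<le> v" "v \<noteq> N" "v \<noteq> N + 1" "v \<noteq> 0"
          using that by (auto simp: N_def)
        then show ?thesis using s1(3)[of v] s3(3)[of v] by (simp add: s2_def s0_def)
      qed
      ultimately show "\<exists>s'. exec_within ?p s (?T x) s' \<and> s' 0 = code (if b x then f x else g x) \<and> (\<forall>v\<ge>N + 2. s' v = s v)"
        using s3(2) by blast
    qed
    show "pbd D ?T"
      using ptime_sz[OF assms(1)] cb(2) pbd_if[OF c(2) c'(2)] by (intro pbd_add pbd_const pbd_sz)
    show "pbd D (\<lambda>x. sz (if b x then f x else g x))"
      using pbd_if[OF ptime_sz[OF assms(2)] ptime_sz[OF assms(3)]] by (rule pbd_mono) auto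
  qed
qed

text \<open>Reduces a function of several arguments to one on pairs, whose arguments are projections
  that the rules in \<open>pt\<close> can handle.\<close>

lemma ptime_comp2:
  assumes "ptime UNIV (\<lambda>z. F (fst z) (snd z))" "ptime D f" "ptime D g"
  shows "ptime D (\<lambda>x. F (f x) (g x))"
  using ptime_comp[OF assms(1) ptime_Pair[OF assms(2,3)]] by simp

lemma ptime_comp3:
  assumes "ptime UNIV (\<lambda>z. F (fst z) (fst (snd z)) (snd (snd z)))" "ptime D f" "ptime D g" "ptime D h"
  shows "ptime D (\<lambda>x. F (f x) (g x) (h x))"
  using ptime_comp[OF assms(1) ptime_Pair[OF assms(2) ptime_Pair[OF assms(3,4)]]] by simp

text \<open>Codes are injective, so comparing trees decides equality of values.\<close>

lemma ptime_eq [pt]: "ptime D f \<Longrightarrow> ptime D g \<Longrightarrow> ptime D (\<lambda>x. f x = g x)"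
  by (rule ptime_comp2[where F = "(=)"])
    (rule ptime_expr[of _ "EqE (LeftE (Var 0)) (RightE (Var 0))" _ 10];
      auto simp: code_prod_eq code_bool_eq)

lemma ptime_Not [pt]: "ptime D f \<Longrightarrow> ptime D (\<lambda>x. \<not> f x)"
  by (rule ptime_cong[of D "\<lambda>x. f x = False"]) (intro ptime_eq ptime_const, auto)

lemma ptime_conj [pt]: "ptime D f \<Longrightarrow> ptime D g \<Longrightarrow> ptime D (\<lambda>x. f x \<and> g x)"
proof -
  assume a: "ptime D f" "ptime D g"
  have "ptime D (\<lambda>x. if f x then g x else False)"
    by (intro ptime_if ptime_const a(1) ptime_subset[OF a(2)]) auto
  then show ?thesis by (rule ptime_cong) auto
qed

lemma ptime_disj [pt]: "ptime D f \<Longrightarrow> ptime D g \<Longrightarrow> ptime D (\<lambda>x. f x \<or> g x)"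
  by (rule ptime_cong[of D "\<lambda>x. \<not> (\<not> f x \<and> \<not> g x)"]) (intro ptime_Not ptime_conj, auto)

text \<open>A list cell has the same code as the pair of its head and tail, so consing is the
  identity program on a pair.\<close>

lemma ptime_Cons [pt]: "ptime D f \<Longrightarrow> ptime D g \<Longrightarrow> ptime D (\<lambda>x. f x # g x)"
  by (rule ptime_comp2[where F = "(#)"])
    (rule ptime_expr[of _ "Var 0" _ 10]; auto simp: code_prod_eq)

lemma ptime_tl [pt]: "ptime D f \<Longrightarrow> ptime D (\<lambda>x. tl (f x))"
proof (rule ptime_comp[where E = UNIV and g = tl])
  show "ptime UNIV (tl :: 'b list \<Rightarrow> 'b list)"
  proof (rule ptime_expr[of _ "RightE (Var 0)" _ 10])
    fix xs :: "'b list" and s :: store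
    assume "s 0 = code xs"
    \<comment> \<open>The empty list is no exception: \<open>right Leaf = Leaf\<close> matches
      \<open>tl [] = []\<close>.\<close>
    then show "eval_expr (RightE (Var 0)) s = code (tl xs)" by (cases xs) auto
  qed auto
qed auto

text \<open>For the empty list the program would return \<open>Leaf\<close>, which need not be the
  code of \<open>hd []\<close>.\<close>

lemma ptime_hd:
  assumes "ptime D f" "\<And>x. x \<in> D \<Longrightarrow> f x \<noteq> []"
  shows "ptime D (\<lambda>x. hd (f x))"
proof (rule ptime_comp[where E = "{xs. xs \<noteq> []}" and g = hd])
  show "ptime {xs. xs \<noteq> []} (hd :: 'b list \<Rightarrow> 'b)"
  proof (rule ptime_expr[of _ "LeftE (Var 0)" _ 10])
    fix xs :: "'b list" and s :: store
    assume "xs \<in> {xs. xs \<noteq> []}" "s 0 = code xs"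
    then show "eval_expr (LeftE (Var 0)) s = code (hd xs)" by (cases xs) auto
  qed auto
qed (use assms in auto)

definition hd_or :: "'a \<Rightarrow> 'a list \<Rightarrow> 'a" where
  "hd_or d xs = (if xs = [] then d else hd xs)"

lemma hd_or_simps [simp]: "hd_or d [] = d" "hd_or d (x # xs) = x"
  by (simp_all add: hd_or_def)

lemma ptime_hd_or [pt]:
  assumes "ptime D d" "ptime D f"
  shows "ptime D (\<lambda>x. hd_or (d x) (f x))"
  unfolding hd_or_def
  by (intro ptime_if ptime_eq ptime_const assms ptime_hd ptime_subset[OF assms(1)] ptime_subset[OF assms(2)]) auto

text \<open>Prepends a zero bit; for 0, whose code has no bits, this would give a different
  tree.\<close>

lemma code_double: "0 < n \<Longrightarrow> code (2 * n :: nat) = Branch Leaf (code n)"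
  by (simp add: code_nat_eq enc_nat.simps[of "2 * n"])

lemma code_Suc_double: "code (2 * n + 1 :: nat) = Branch (Branch Leaf Leaf) (code n)"
  by (simp add: code_nat_eq enc_nat.simps[of "Suc (2 * n)"])

lemma sz_double: "sz (2 * n :: nat) \<le> sz n + 2"
  by (cases "n = 0") (auto simp: code_double)

lemma ptime_double [pt]: 
  assumes "ptime D f" shows "ptime D (\<lambda>x. 2 * f x :: nat)"
proof (rule ptime_comp[OF _ assms, of UNIV])
  have "ptime {x. x > 0} (\<lambda>x::nat. 2 * x)"
    by (rule ptime_expr[of _ "BranchE LeafE (Var 0)" _ 10]) (auto simp: code_double)
  then have "ptime UNIV (\<lambda>x::nat. if x = 0 then 0 else 2 * x)"
    by (intro ptime_if ptime_eq ptime_id ptime_const) (simp add: Collect_conj_eq)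
  then show "ptime UNIV (\<lambda>x::nat. 2 * x)" by (rule ptime_cong) auto
qed auto

lemma ptime_Suc_double [pt]: 
  assumes "ptime D f" shows "ptime D (\<lambda>x. 2 * f x + 1 :: nat)"
proof (rule ptime_comp[OF _ assms, of UNIV])
  show "ptime UNIV (\<lambda>x::nat. 2 * x + 1)"
    by (rule ptime_expr[of _ "BranchE (BranchE LeafE LeafE) (Var 0)" _ 10]) (auto simp: code_Suc_double[simplified])
qed auto

section \<open>Folds over lists as loops\<close>

lemma runs_mono: "runs c K E f T \<Longrightarrow> K \<le> N \<Longrightarrow> runs c N E f T"
  unfolding runs_def by (meson le_trans)

text \<open>
  The loop body keeps the environment \<open>x\<close> in variable \<open>N\<close> and the remaining list in \<open>N + 1\<close>, out of
  reach of \<open>c\<close>.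
\<close>

lemma exec_within_fold:
  fixes f :: "'y::encodable \<Rightarrow> 'b::encodable \<Rightarrow> 'b"
  assumes c: "runs c N E (\<lambda>z. g (fst z) (fst (snd z)) (snd (snd z))) T" and f: "f = g x"
    and s: "s N = code (x::'a::encodable)" "s (N + 1) = code ys" "s 0 = code a" and N: "0 < N"
    and E: "\<And>i. i < length ys \<Longrightarrow> (x, ys ! i, fold f (take i ys) a) \<in> E"
    and T: "\<And>i. i < length ys \<Longrightarrow> T (x, ys ! i, fold f (take i ys) a) \<le> B"
    and S: "\<And>i. i < length ys \<Longrightarrow> sz (fold f (take i ys) a) \<le> S" and Y: "sz x + sz ys \<le> Y"
  shows "\<exists>s'. exec_within (While (Var (N + 1)) (Seq (Assign 0 (BranchE (Var N) (BranchE (LeftE (Var (N + 1))) (Var 0))))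
      (Seq c (Assign (N + 1) (RightE (Var (N + 1))))))) s (length ys * (B + S + 3 * Y + 20) + Y + 1) s'
    \<and> s' 0 = code (fold f ys a) \<and> (\<forall>v\<ge>N + 2. s' v = s v)"
    (is "\<exists>s'. exec_within (While _ ?body) _ _ _ \<and> _")
  using s E T S Y
proof (induction ys arbitrary: s a)
  case Nil
  have "exec_within (While (Var (N + 1)) ?body) s (1 + expr_cost (Var (N + 1)) s) s"
    by (rule exec_within_WhileFalse) (use Nil(1-3,7) in simp)
  then have "exec_within (While (Var (N + 1)) ?body) s (Y + 1) s"
    by (rule exec_within_mono) (use Nil(1-3,7) in simp)
  then show ?case using Nil(1-3) by auto
next
  case (Cons y ys)
  define s0 where "s0 = s(0 := code (x, y, a))"
  have "(x, y, a) \<in> E" using Cons.prems(4)[of 0] by simp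
  then obtain s1 where s1: "exec_within c s0 (T (x, y, a)) s1" "s1 0 = code (f y a)" "\<And>v. v \<ge> N \<Longrightarrow> s1 v = s0 v"
    using runsE[OF c, of "(x, y, a)" s0] f by (auto simp: s0_def)
  define s2 where "s2 = s1(N + 1 := code ys)"
  have s1N: "s1 N = code x" "s1 (N + 1) = code (y # ys)"
    using s1(3) Cons.prems(1-3) N by (auto simp: s0_def)
  have sa: "sz a \<le> S" using Cons.prems(6)[of 0] by simp
  have E0: "exec_within (Assign 0 (BranchE (Var N) (BranchE (LeftE (Var (N + 1))) (Var 0)))) s (S + Y + 6) s0"
    by (rule exec_within_Assign) (use Cons.prems(1-3,7) N sa in \<open>auto simp: s0_def\<close>)
  have "exec_within c s0 B s1"
    using s1(1) by (rule exec_within_mono) (use Cons.prems(5)[of 0] in simp)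
  moreover have "exec_within (Assign (N + 1) (RightE (Var (N + 1)))) s1 (Y + 4) s2"
    by (rule exec_within_Assign) (use Cons.prems(7) s1N sz_pos[of x] in \<open>simp_all add: s2_def del: sz_pos\<close>)
  ultimately have body: "exec_within ?body s ((S + Y + 6) + (B + (Y + 4))) s2"
    using E0 by (intro exec_within_Seq)
  have "\<exists>s'. exec_within (While (Var (N + 1)) ?body) s2 (length ys * (B + S + 3 * Y + 20) + Y + 1) s'
      \<and> s' 0 = code (fold f ys (f y a)) \<and> (\<forall>v\<ge>N + 2. s' v = s2 v)"
  proof (rule Cons.IH)
    show "s2 N = code x" "s2 (N + 1) = code ys" "s2 0 = code (f y a)"
      using s1N s1(2) N by (auto simp: s2_def)
    show "\<And>i. i < length ys \<Longrightarrow> (x, ys ! i, fold f (take i ys) (f y a)) \<in> E"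
      using Cons.prems(4)[of "Suc i" for i] by auto
    show "\<And>i. i < length ys \<Longrightarrow> T (x, ys ! i, fold f (take i ys) (f y a)) \<le> B"
      using Cons.prems(5)[of "Suc i" for i] by auto
    show "\<And>i. i < length ys \<Longrightarrow> sz (fold f (take i ys) (f y a)) \<le> S"
      using Cons.prems(6)[of "Suc i" for i] by auto
    show "sz x + sz ys \<le> Y" using Cons.prems(7) by simp
  qed
  then obtain s' where s': "exec_within (While (Var (N + 1)) ?body) s2 (length ys * (B + S + 3 * Y + 20) + Y + 1) s'"
      "s' 0 = code (fold f ys (f y a))" "\<forall>v\<ge>N + 2. s' v = s2 v" by blast
  have "exec_within (While (Var (N + 1)) ?body) s
     (1 + expr_cost (Var (N + 1)) s + ((S + Y + 6) + (B + (Y + 4))) + (length ys * (B + S + 3 * Y + 20) + Y + 1)) s'"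
    by (rule exec_within_WhileTrue[OF _ body s'(1)]) (use Cons.prems(1-3,7) in simp)
  \<comment> \<open>One round costs at most \<open>B + S + 3 * Y + 11\<close>: the test takes
    \<open>Y + 1\<close> and the body \<open>B + S + 2 * Y + 10\<close>.\<close>
  then have "exec_within (While (Var (N + 1)) ?body) s (length (y # ys) * (B + S + 3 * Y + 20) + Y + 1) s'"
    by (rule exec_within_mono) (use Cons.prems(1-3,7) in simp)
  moreover have "\<forall>v\<ge>N + 2. s' v = s v"
    using s'(3) s1(3) by (auto simp: s2_def s0_def)
  ultimately show ?case using s'(2) by auto
qed

lemma sz_nth_le: "i < length ys \<Longrightarrow> sz (ys ! i) \<le> sz ys"
  by (induction ys arbitrary: i) (auto simp: nth_Cons split: nat.split intro: le_SucI trans_le_add2)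

lemma sz_mem_le: "y \<in> set ys \<Longrightarrow> sz y \<le> sz ys"
  by (metis in_set_conv_nth sz_nth_le)

lemma length_le_sz: "length ys \<le> sz ys"
  by (induction ys) auto

text \<open>
  The hypothesis on \<open>S\<close> cannot be dropped: an accumulator that doubles in every round grows
  exponentially.
\<close>

lemma ptime_fold:
  fixes g :: "'a::encodable \<Rightarrow> 'y::encodable \<Rightarrow> 'b::encodable \<Rightarrow> 'b"
  assumes g: "ptime {(x, y, b). x \<in> D \<and> (\<exists>i<length (ys x). y = ys x ! i \<and> b = fold (g x) (take i (ys x)) (a x))}
      (\<lambda>z. g (fst z) (fst (snd z)) (snd (snd z)))" (is "ptime ?E _")
    and ys: "ptime D ys" and a: "ptime D a" and "pbd D S"
    and S: "\<And>x i. x \<in> D \<Longrightarrow> i \<le> length (ys x) \<Longrightarrow> sz (fold (g x) (take i (ys x)) (a x)) \<le> S x"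
  shows "ptime D (\<lambda>x. fold (g x) (ys x) (a x))"
proof -
  obtain cy Ky Ty where cy: "runs cy Ky D (\<lambda>x. (x, ys x, a x)) Ty" "pbd D Ty"
    using ptime_Pair[OF ptime_id ptime_Pair[OF ys a]] by (rule ptimeE)
  obtain c K T where c: "runs c K ?E (\<lambda>z. g (fst z) (fst (snd z)) (snd (snd z))) T" "pbd ?E T"
    using g by (rule ptimeE)
  obtain k where k: "\<And>z. z \<in> ?E \<Longrightarrow> T z \<le> (sz z + 1) ^ k" using c(2) unfolding pbd_def by blast
  define N where "N = max K Ky + 1"
  have cN: "runs c N ?E (\<lambda>z. g (fst z) (fst (snd z)) (snd (snd z))) T"
    using c(1) by (rule runs_mono) (simp add: N_def)
  let ?body = "Seq (Assign 0 (BranchE (Var N) (BranchE (LeftE (Var (N + 1))) (Var 0))))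
      (Seq c (Assign (N + 1) (RightE (Var (N + 1)))))"
  let ?p = "Seq cy (Seq (Assign N (LeftE (Var 0))) (Seq (Assign (N + 1) (LeftE (RightE (Var 0))))
     (Seq (Assign 0 (RightE (RightE (Var 0)))) (While (Var (N + 1)) ?body))))"
  let ?Y = "\<lambda>x. sz (x, ys x, a x)"
  \<comment> \<open>The body runs on triples of size at most
    \<open>sz x + sz (ys x) + S x + 2\<close>, the 2 stemming from the pair nodes, and
    \<open>k\<close> is the exponent of its time bound.\<close>
  let ?B = "\<lambda>x. (sz x + sz (ys x) + S x + 3) ^ k"
  let ?T = "\<lambda>x. Ty x + ((?Y x + 10) + ((?Y x + 10) + ((?Y x + 10) +
     (length (ys x) * (?B x + S x + 3 * ?Y x + 20) + ?Y x + 1))))"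
  show ?thesis
  proof (rule ptimeI)
    show "runs ?p (N + 2) D (\<lambda>x. fold (g x) (ys x) (a x)) ?T"
      unfolding runs_def
    proof (intro ballI allI impI)
      fix x and s :: store assume x: "x \<in> D" "s 0 = code x"
      obtain s1 where s1: "exec_within cy s (Ty x) s1" "s1 0 = code (x, ys x, a x)" "\<And>v. v \<ge> Ky \<Longrightarrow> s1 v = s v"
        using runsE[OF cy(1), of x s] x by blast
      define s2 where "s2 = s1(N := code x, N + 1 := code (ys x), 0 := code (a x))"
      have "\<exists>s'. exec_within (While (Var (N + 1)) ?body) s2
          (length (ys x) * (?B x + S x + 3 * ?Y x + 20) + ?Y x + 1) s'
        \<and> s' 0 = code (fold (g x) (ys x) (a x)) \<and> (\<forall>v\<ge>N + 2. s' v = s2 v)"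
      proof (rule exec_within_fold[OF cN refl])
        show "s2 N = code x" "s2 (N + 1) = code (ys x)" "s2 0 = code (a x)" "0 < N"
          by (auto simp: s2_def N_def)
        fix i assume i: "i < length (ys x)"
        show E: "(x, ys x ! i, fold (g x) (take i (ys x)) (a x)) \<in> ?E" using x i by auto
        show Si: "sz (fold (g x) (take i (ys x)) (a x)) \<le> S x" using S x i by simp
        have "T (x, ys x ! i, fold (g x) (take i (ys x)) (a x))
          \<le> (sz (x, ys x ! i, fold (g x) (take i (ys x)) (a x)) + 1) ^ k" by (rule k[OF E])
        also have "\<dots> \<le> ?B x"
          using Si sz_nth_le[OF i] by (intro power_mono) auto
        finally show "T (x, ys x ! i, fold (g x) (take i (ys x)) (a x)) \<le> ?B x" .
      qed auto
      then obtain s' where s': "exec_within (While (Var (N + 1)) ?body) s2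
          (length (ys x) * (?B x + S x + 3 * ?Y x + 20) + ?Y x + 1) s'"
        "s' 0 = code (fold (g x) (ys x) (a x))" "\<forall>v\<ge>N + 2. s' v = s2 v" by blast
      note s1(1)
      moreover have "exec_within (Assign N (LeftE (Var 0))) s1 (?Y x + 10) (s1(N := code x))"
        by (rule exec_within_Assign) (use s1 in auto)
      moreover have "exec_within (Assign (N + 1) (LeftE (RightE (Var 0)))) (s1(N := code x)) (?Y x + 10)
          (s1(N := code x, N + 1 := code (ys x)))"
        by (rule exec_within_Assign) (use s1 in \<open>auto simp: N_def\<close>)
      moreover have "exec_within (Assign 0 (RightE (RightE (Var 0)))) (s1(N := code x, N + 1 := code (ys x))) (?Y x + 10) s2"
        by (rule exec_within_Assign) (use s1 in \<open>auto simp: N_def s2_def\<close>)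
      moreover note s'(1)
      ultimately have "exec_within ?p s (?T x) s'" by (intro exec_within_Seq)
      moreover have "\<forall>v\<ge>N + 2. s' v = s v" using s'(3) s1(3) by (auto simp: s2_def N_def)
      ultimately show "\<exists>s'. exec_within ?p s (?T x) s' \<and> s' 0 = code (fold (g x) (ys x) (a x)) \<and> (\<forall>v\<ge>N + 2. s' v = s v)"
        using s'(2) by blast
    qed
    have "pbd D (\<lambda>x. length (ys x))" using ptime_sz[OF ys] length_le_sz by (rule pbd_mono)
    then show "pbd D ?T"
      using ptime_sz[OF ptime_Pair[OF ptime_id ptime_Pair[OF ys a]]] cy(2) \<open>pbd D S\<close> ptime_sz[OF ys]
      by (intro pbd_add pbd_mult pbd_power pbd_const pbd_sz)
    show "pbd D (\<lambda>x. sz (fold (g x) (ys x) (a x)))"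
      using \<open>pbd D S\<close> by (rule pbd_mono) (use S in force)
  qed
qed

section \<open>Functions on lists\<close>

lemma sz_append: "sz (xs @ ys) + 1 = sz xs + sz ys"
  by (induction xs) auto

lemma sz_rev [simp]: "sz (rev xs) = sz xs"
proof (induction xs)
  case (Cons x xs) then show ?case using sz_append[of "rev xs" "[x]"] by simp
qed simp

lemma sz_take_le: "sz (take i xs) \<le> sz xs"
  using sz_append[of "take i xs" "drop i xs"] sz_pos[of "drop i xs"] by (simp del: sz_pos)

lemma sz_filter_le: "sz (filter P xs) \<le> sz xs"
  by (induction xs) auto

lemma sz_list_le:
  assumes "\<And>y. y \<in> set ys \<Longrightarrow> sz y \<le> B" "length ys \<le> n"
  shows "sz ys \<le> n * (B + 1) + 1"
proof -
  have "sz ys \<le> length ys * (B + 1) + 1"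
    using assms(1)
  proof (induction ys)
    case (Cons y ys)
    have "sz y \<le> B" by (rule Cons.prems) simp
    moreover have "sz ys \<le> length ys * (B + 1) + 1" by (rule Cons.IH, rule Cons.prems) simp
    ultimately show ?case by simp
  qed simp
  also have "\<dots> \<le> n * (B + 1) + 1" using assms(2) by (intro add_right_mono mult_right_mono) auto
  finally show ?thesis .
qed

lemma ptime_length_pbd: "ptime D f \<Longrightarrow> pbd D (\<lambda>x. length (f x))"
  by (rule pbd_mono[OF ptime_sz], assumption, rule length_le_sz)

lemma fold_Cons_rev: "fold (\<lambda>y a. f y # a) xs ys = rev (map f xs) @ ys"
  by (induction xs arbitrary: ys) auto

lemma ptime_rev [pt]: 
  assumes "ptime D f" shows "ptime D (\<lambda>x. rev (f x))"
proof (rule ptime_comp[OF _ assms, of UNIV])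
  have "ptime UNIV (\<lambda>xs :: 'b list. fold (\<lambda>y a. y # a) xs [])"
    by (rule ptime_fold[where S = sz]; (intro pt)?)
       (auto simp: fold_Cons_rev[of "\<lambda>x. x", simplified] sz_take_le)
  then show "ptime UNIV (rev :: 'b list \<Rightarrow> 'b list)"
    by (simp add: fold_Cons_rev[of "\<lambda>x. x", simplified])
qed auto

lemma ptime_append [pt]: 
  assumes "ptime D f" "ptime D g" shows "ptime D (\<lambda>x. f x @ g x)"
proof (rule ptime_comp2[OF _ assms, where F = "(@)"])
  have "ptime UNIV (\<lambda>p :: 'b list \<times> 'b list. fold (\<lambda>y a. y # a) (rev (fst p)) (snd p))"
  proof (rule ptime_fold[where S = "\<lambda>p. 2 * sz p"]; (intro pt)?)
    fix p :: "'b list \<times> 'b list" and i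
    have "fold (\<lambda>y a. y # a) (take i (rev (fst p))) (snd p) = rev (take i (rev (fst p))) @ snd p"
      by (simp add: fold_Cons_rev[of "\<lambda>x. x", simplified])
    moreover have "sz (rev (take i (rev (fst p))) @ snd p) \<le> sz p"
      using sz_append[of "rev (take i (rev (fst p)))" "snd p"] sz_take_le[of i "rev (fst p)"]
      by (auto simp: code_prod_eq)
    ultimately show "sz (fold (\<lambda>y a. y # a) (take i (rev (fst p))) (snd p)) \<le> 2 * sz p" by simp
  qed (auto intro!: pbd_mult)
  then show "ptime UNIV (\<lambda>z :: 'b list \<times> 'b list. fst z @ snd z)"
    by (simp add: fold_Cons_rev[of "\<lambda>x. x", simplified])
qed

text \<open>A member of \<open>ys x\<close> is no larger than the list itself, so a bound polynomial
  in the pair \<open>(x, y)\<close> turns into one that depends on \<open>x\<close> alone.\<close>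

lemma pbd_env:
  fixes g :: "'a::encodable \<Rightarrow> 'y::encodable \<Rightarrow> nat"
  assumes "pbd {(x, y). x \<in> D \<and> y \<in> set (ys x)} (\<lambda>z. g (fst z) (snd z))" "ptime D ys"
  obtains S where "pbd D S" "\<And>x y. x \<in> D \<Longrightarrow> y \<in> set (ys x) \<Longrightarrow> g x y \<le> S x"
proof -
  obtain k where k: "\<And>x y. x \<in> D \<Longrightarrow> y \<in> set (ys x) \<Longrightarrow> g x y \<le> (sz (x, y) + 1) ^ k"
    using assms(1) unfolding pbd_def by fastforce
  show ?thesis
  proof (rule that[of "\<lambda>x. (sz x + sz (ys x) + 2) ^ k"])
    show "pbd D (\<lambda>x. (sz x + sz (ys x) + 2) ^ k)"
      by (intro pbd_add pbd_power pbd_const pbd_sz ptime_sz assms(2))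
    fix x y assume xy: "x \<in> D" "y \<in> set (ys x)"
    have "(sz (x, y) + 1) ^ k \<le> (sz x + sz (ys x) + 2) ^ k"
      using sz_mem_le[OF xy(2)] by (intro power_mono) auto
    then show "g x y \<le> (sz x + sz (ys x) + 2) ^ k" using k[OF xy] by linarith
  qed
qed

text \<open>The mapped function may use the surrounding input \<open>x\<close>, so that nested list
  expressions can be analysed along their syntax. The loop collects the results in reverse.\<close>

lemma ptime_map:
  assumes g: "ptime {(x, y). x \<in> D \<and> y \<in> set (ys x)} (\<lambda>z. g (fst z) (snd z))"
    and ys: "ptime D ys"
  shows "ptime D (\<lambda>x. map (g x) (ys x))"
proof -
  obtain S where S: "pbd D S" "\<And>x y. x \<in> D \<Longrightarrow> y \<in> set (ys x) \<Longrightarrow> sz (g x y) \<le> S x"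
    using pbd_env[OF ptime_sz[OF g] ys] by blast
  have "ptime D (\<lambda>x. fold (\<lambda>y a. g x y # a) (ys x) [])"
  proof (rule ptime_fold[where S = "\<lambda>x. length (ys x) * (S x + 1) + 1"])
    let ?E = "{(x, y, b). x \<in> D \<and> (\<exists>i<length (ys x). y = ys x ! i \<and> b = fold (\<lambda>y a. g x y # a) (take i (ys x)) [])}"
    have "ptime ?E (\<lambda>z. (fst z, fst (snd z)))" by (intro pt)
    then have "ptime ?E (\<lambda>z. g (fst (fst z, fst (snd z))) (snd (fst z, fst (snd z))))"
      by (rule ptime_comp[OF g]) auto
    then have "ptime ?E (\<lambda>z. g (fst z) (fst (snd z)))" by simp
    then show "ptime ?E (\<lambda>z. g (fst z) (fst (snd z)) # snd (snd z))" by (intro pt)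
    show "pbd D (\<lambda>x. length (ys x) * (S x + 1) + 1)"
      by (intro pbd_add pbd_mult pbd_const S ptime_length_pbd ys)
    fix x i assume x: "x \<in> D"
    have "fold (\<lambda>y a. g x y # a) (take i (ys x)) [] = rev (map (g x) (take i (ys x)))"
      by (simp add: fold_Cons_rev)
    then show "sz (fold (\<lambda>y a. g x y # a) (take i (ys x)) []) \<le> length (ys x) * (S x + 1) + 1"
      using S(2)[OF x] by (intro sz_list_le) (auto dest: in_set_takeD)
  qed (intro ys pt)+
  from ptime_rev[OF this] show ?thesis by (simp add: fold_Cons_rev)
qed

lemma ptime_concat [pt]:
  assumes "ptime D f" shows "ptime D (\<lambda>x. concat (f x))"
proof (rule ptime_comp[OF _ assms, of UNIV])
  have fold_append: "fold (\<lambda>y a. a @ y) xss a = a @ concat xss" for xss :: "'b list list" and a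
    by (induction xss arbitrary: a) auto
  have "sz (concat xss) \<le> sz xss" for xss :: "'b list list"
  proof (induction xss)
    case (Cons xs xss) then show ?case using sz_append[of xs "concat xss"] by simp
  qed simp
  then have "sz (concat (take i xss)) \<le> sz xss" for i and xss :: "'b list list"
    by (rule order_trans[OF _ sz_take_le])
  then have "ptime UNIV (\<lambda>xss :: 'b list list. fold (\<lambda>y a. a @ y) xss [])"
    by (intro ptime_fold[where S = sz] pt) (auto simp: fold_append)
  then show "ptime UNIV (concat :: 'b list list \<Rightarrow> 'b list)" by (simp add: fold_append)
qed auto

lemma ptime_filter:
  assumes P: "ptime {(x, y). x \<in> D \<and> y \<in> set (ys x)} (\<lambda>z. P (fst z) (snd z))"
    and ys: "ptime D ys"
  shows "ptime D (\<lambda>x. filter (P x) (ys x))"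
proof -
  have "ptime D (\<lambda>x. concat (map (\<lambda>y. if P x y then [y] else []) (ys x)))"
    by (intro ptime_concat ptime_map ptime_if P pt ys)
  moreover have "concat (map (\<lambda>y. if P x y then [y] else []) ys) = filter (P x) ys" for x ys
    by (induction ys) auto
  ultimately show ?thesis by simp
qed

lemma ptime_Ball:
  assumes P: "ptime {(x, y). x \<in> D \<and> y \<in> set (ys x)} (\<lambda>z. P (fst z) (snd z))"
    and ys: "ptime D ys"
  shows "ptime D (\<lambda>x. \<forall>y\<in>set (ys x). P x y)"
proof -
  have "ptime D (\<lambda>x. filter (\<lambda>y. \<not> P x y) (ys x) = [])"
    by (intro ptime_eq ptime_filter ptime_Not P pt ys)
  then show ?thesis by (rule ptime_cong) (auto simp: filter_empty_conv)
qed

lemma ptime_Bex: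
  assumes P: "ptime {(x, y). x \<in> D \<and> y \<in> set (ys x)} (\<lambda>z. P (fst z) (snd z))"
    and ys: "ptime D ys"
  shows "ptime D (\<lambda>x. \<exists>y\<in>set (ys x). P x y)"
  by (rule ptime_cong[OF ptime_Not[OF ptime_Ball[where P = "\<lambda>x y. \<not> P x y"]]])
    (use P ys in \<open>auto intro: ptime_Not\<close>)

lemma ptime_member [pt]:
  assumes "ptime D f" "ptime D g"
  shows "ptime D (\<lambda>x. f x \<in> set (g x))"
proof (rule ptime_comp2[OF _ assms, where F = "\<lambda>a b. a \<in> set b"])
  have "ptime UNIV (\<lambda>z :: 'b \<times> 'b list. \<exists>y\<in>set (snd z). fst z = y)"
    by (intro ptime_Bex pt)
  then show "ptime UNIV (\<lambda>z :: 'b \<times> 'b list. fst z \<in> set (snd z))"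
    by (rule ptime_cong) auto
qed

text \<open>Lengths serve as unary numbers: removing one cell of \<open>f x\<close> for each cell of
  \<open>g x\<close> compares them without arithmetic.\<close>

lemma ptime_length_le [pt]:
  assumes "ptime D f" "ptime D g"
  shows "ptime D (\<lambda>x. length (f x) \<le> length (g x))"
proof (rule ptime_comp2[OF _ assms, where F = "\<lambda>a b. length a \<le> length b"])
  have drop_eq: "fold (\<lambda>_. tl) ys a = drop (length ys) a" for ys :: "'c list" and a :: "'b list"
    by (induction ys arbitrary: a) (auto simp: drop_Suc)
  have "ptime UNIV (\<lambda>z :: 'b list \<times> 'c list. fold (\<lambda>_. tl) (snd z) (fst z))"
  proof (rule ptime_fold[where S = sz]; (intro pt)?)
    fix z :: "'b list \<times> 'c list" and i
    show "sz (fold (\<lambda>_. tl) (take i (snd z)) (fst z)) \<le> sz z"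
      using sz_append[of "take (min (length (snd z)) i) (fst z)" "drop (min (length (snd z)) i) (fst z)"]
        sz_pos[of "take (min (length (snd z)) i) (fst z)"]
      by (simp add: drop_eq code_prod_eq del: sz_pos)
  qed auto
  then have "ptime UNIV (\<lambda>z :: 'b list \<times> 'c list. drop (length (snd z)) (fst z) = [])"
    unfolding drop_eq by (intro pt)
  then show "ptime UNIV (\<lambda>z :: 'b list \<times> 'c list. length (fst z) \<le> length (snd z))"
    by (rule ptime_cong) auto
qed

section \<open>Components and rooted trees\<close>

lemma
  assumes "pair_graph G"
  shows pair_graph_finite: "finite (pverts G)"
    and pair_graph_wf: "pair_wf_digraph G"
    and pair_graph_arc_sym: "(u, v) \<in> parcs G \<Longrightarrow> (v, u) \<in> parcs G"
    and pair_graph_arc_verts: "(u, v) \<in> parcs G \<Longrightarrow> u \<in> pverts G \<and> v \<in> pverts G"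
proof -
  interpret pair_graph G by fact
  show "finite (pverts G)" by (rule pair_finite_verts)
  show "pair_wf_digraph G" by (rule pair_wf_digraph)
  show "(u, v) \<in> parcs G \<Longrightarrow> (v, u) \<in> parcs G" by (rule arcs_symmetric)
  show "(u, v) \<in> parcs G \<Longrightarrow> u \<in> pverts G \<and> v \<in> pverts G" using wellformed' by blast
qed

text \<open>Symmetrised, because it serves the rooted trees as well as the graph, and tree arcs have
  only one direction.\<close>

definition adj :: "'a pair_pre_digraph \<Rightarrow> 'a set \<Rightarrow> 'a rel" where
  "adj G X = {(u, v). u \<in> X \<and> v \<in> X \<and> ((u, v) \<in> parcs G \<or> (v, u) \<in> parcs G)}"

definition components :: "'a pair_pre_digraph \<Rightarrow> 'a set \<Rightarrow> 'a set set" where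
  "components G X = {(adj G X)\<^sup>* `` {v} |v. v \<in> X}"

text \<open>Reachability in the graph library is based on \<open>rtrancl_on\<close>; inside
  \<open>S\<close> it differs from the ordinary closure only in restricting the start point.\<close>

lemma rtrancl_on_iff:
  assumes "r \<subseteq> S \<times> S"
  shows "(u, v) \<in> rtrancl_on S r \<longleftrightarrow> u \<in> S \<and> (u, v) \<in> r\<^sup>*"
proof safe
  assume "(u, v) \<in> rtrancl_on S r"
  then show "u \<in> S" "(u, v) \<in> r\<^sup>*" by (auto intro: in_rtrancl_on_in_F(1) rtrancl_on_rtranclI)
next
  assume "(u, v) \<in> r\<^sup>*" "u \<in> S"
  then show "(u, v) \<in> rtrancl_on S r"
    by induction (use assms in \<open>auto intro: rtrancl_on_into_rtrancl_on\<close>)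
qed

lemma connected_induced_iff:
  "Digraph_Component.connected (with_proj G \<restriction> S) \<longleftrightarrow> S \<noteq> {} \<and> (\<forall>u\<in>S. \<forall>v\<in>S. (u, v) \<in> (adj G S)\<^sup>*)"
proof -
  have "parcs (mk_symmetric (with_proj G \<restriction> S)) = adj G S"
    by (auto simp: parcs_mk_symmetric adj_def)
  moreover have "adj G S \<subseteq> S \<times> S" by (auto simp: adj_def)
  ultimately show ?thesis
    by (auto simp: Digraph_Component.connected_def strongly_connected_def reachable_def rtrancl_on_iff)
qed

text \<open>For the root, where compactness speaks of the subgraph induced by all vertices.\<close>

lemma connected_iff:
  assumes "pair_wf_digraph G"
  shows "Digraph_Component.connected (with_proj G) \<longleftrightarrow> Digraph_Component.connected (with_proj G \<restriction> pverts G)"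
proof -
  interpret pair_wf_digraph G by fact
  have "with_proj G \<restriction> pverts G = with_proj G"
    by (auto simp: induce_subgraph_def with_proj_def dest: arc_fst_in_verts arc_snd_in_verts)
  then show ?thesis by simp
qed

lemma sym_adj: "(u, v) \<in> (adj G X)\<^sup>* \<Longrightarrow> (v, u) \<in> (adj G X)\<^sup>*"
proof -
  have "sym (adj G X)" by (auto simp: adj_def sym_def)
  then show "(u, v) \<in> (adj G X)\<^sup>* \<Longrightarrow> (v, u) \<in> (adj G X)\<^sup>*" by (meson symD sym_rtrancl)
qed

lemma adj_rtrancl_in: "(u, v) \<in> (adj G X)\<^sup>* \<Longrightarrow> u \<in> X \<Longrightarrow> v \<in> X"
  by (induction rule: rtrancl_induct) (auto simp: adj_def)

lemma components_subset: "A \<in> components G X \<Longrightarrow> A \<subseteq> X"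
  by (auto simp: components_def dest: adj_rtrancl_in)

lemma components_nonempty: "A \<in> components G X \<Longrightarrow> A \<noteq> {}"
  by (auto simp: components_def)

lemma component_eq: "A \<in> components G X \<Longrightarrow> v \<in> A \<Longrightarrow> A = (adj G X)\<^sup>* `` {v}"
  by (auto simp: components_def intro: rtrancl_trans dest: sym_adj)

lemma components_disjoint: "A \<in> components G X \<Longrightarrow> B \<in> components G X \<Longrightarrow> A \<noteq> B \<Longrightarrow> A \<inter> B = {}"
  by (metis component_eq disjoint_iff)

lemma Union_components: "\<Union>(components G X) = X"
proof
  show "\<Union>(components G X) \<subseteq> X" by (simp add: Union_least components_subset)
  show "X \<subseteq> \<Union>(components G X)" unfolding components_def by blast
qed

lemma component_closed:
  assumes "A \<in> components G X" "u \<in> A" "v \<in> X" "(u, v) \<in> parcs G \<or> (v, u) \<in> parcs G"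
  shows "v \<in> A"
proof -
  have "u \<in> X" using components_subset assms by blast
  then have "(u, v) \<in> adj G X" using assms by (auto simp: adj_def)
  then show ?thesis using component_eq[OF assms(1,2)] by auto
qed

text \<open>A path inside \<open>X\<close> that starts in the component never leaves it, so it is
  already a path inside \<open>A\<close>.\<close>

lemma component_connected:
  assumes "A \<in> components G X"
  shows "Digraph_Component.connected (with_proj G \<restriction> A)"
  unfolding connected_induced_iff
proof safe
  fix u v assume u: "u \<in> A" "v \<in> A"
  then have "(u, v) \<in> (adj G X)\<^sup>*" using component_eq[OF assms] by blast
  then have "v \<in> A \<and> (u, v) \<in> (adj G A)\<^sup>*"
  proof (induction rule: rtrancl_induct)
    case (step y z)
    then have "z \<in> A" using component_closed[OF assms, of y z] by (auto simp: adj_def)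
    with step have "(y, z) \<in> adj G A" by (auto simp: adj_def)
    with step \<open>z \<in> A\<close> show ?case by (auto intro: rtrancl_into_rtrancl)
  qed (use u in auto)
  then show "(u, v) \<in> (adj G A)\<^sup>*" by simp
qed (use components_nonempty[OF assms] in auto)

section \<open>Walks and rooted trees\<close>

lemma with_proj_awalk: "pre_digraph.awalk (with_proj T) u p v \<longleftrightarrow> u \<in> pverts T \<and> set p \<subseteq> parcs T \<and> pcas u p v"
  by (simp add: pre_digraph.awalk_def cas_with_proj_eq)

lemma pcas_append: "pcas u (p @ q) v \<longleftrightarrow> (\<exists>w. pcas u p w \<and> pcas w q v)"
  by (induction p arbitrary: u) auto

lemma pcas_rtrancl: "pcas u p v \<Longrightarrow> set p \<subseteq> E \<Longrightarrow> (u, v) \<in> E\<^sup>*"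
proof (induction p arbitrary: u)
  case (Cons e p)
  then have "(u, snd e) \<in> E" "(snd e, v) \<in> E\<^sup>*" by (cases e; auto)+
  then show ?case by simp
qed simp

lemma rtrancl_pcas: "(u, v) \<in> E\<^sup>* \<Longrightarrow> \<exists>p. pcas u p v \<and> set p \<subseteq> E"
proof (induction rule: converse_rtrancl_induct)
  case base
  then show ?case by (intro exI[of _ "[]"]) auto
next
  case (step y z)
  then obtain p where "pcas z p v" "set p \<subseteq> E" by blast
  with step show ?case by (intro exI[of _ "(y, z) # p"]) auto
qed

lemma with_proj_reachable:
  assumes "pair_wf_digraph T"
  shows "t \<rightarrow>\<^sup>*\<^bsub>with_proj T\<^esub> s \<longleftrightarrow> t \<in> pverts T \<and> (t, s) \<in> (parcs T)\<^sup>*"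
proof -
  interpret pair_wf_digraph T by fact
  have "parcs T \<subseteq> pverts T \<times> pverts T" by (auto dest: arc_fst_in_verts arc_snd_in_verts)
  then show ?thesis by (simp add: reachable_def rtrancl_on_iff)
qed

text \<open>Levels rise by one along arcs, so all walks from \<open>r\<close> to a node have the
  same length, and unique parents make two such walks agree arc by arc from the end. Climbing to
  parents lowers the level and hence ends in \<open>r\<close>, which gives existence.\<close>

lemma rooted_treeI:
  assumes "finite (pverts T)" "parcs T \<subseteq> pverts T \<times> pverts T" "r \<in> pverts T"
    and lev: "lev r = (0::nat)" "\<And>a b. (a, b) \<in> parcs T \<Longrightarrow> lev b = Suc (lev a)"
    and parent_unique: "\<And>a a' b. (a, b) \<in> parcs T \<Longrightarrow> (a', b) \<in> parcs T \<Longrightarrow> a = a'"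
    and parent_ex: "\<And>t. t \<in> pverts T \<Longrightarrow> t \<noteq> r \<Longrightarrow> \<exists>a. (a, t) \<in> parcs T"
  shows "rooted_tree T r" "pre_digraph.awalk (with_proj T) r p t \<Longrightarrow> length p = lev t"
proof -
  have len: "lev v = lev u + length p" if "pcas u p v" "set p \<subseteq> parcs T" for u p v
    using that
  proof (induction p arbitrary: u)
    case (Cons e p)
    then show ?case using lev(2)[of "fst e" "snd e"] by auto
  qed simp
  then show "length p = lev t" if "pre_digraph.awalk (with_proj T) r p t"
    using that lev(1) by (fastforce simp: with_proj_awalk)
  have ex: "\<exists>p. pcas r p t \<and> set p \<subseteq> parcs T" if "t \<in> pverts T" "lev t = n" for t n
    using that
  proof (induction n arbitrary: t)
    case 0
    then have "t = r" using parent_ex lev(2) by fastforce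
    then show ?case by (intro exI[of _ "[]"]) auto
  next
    case (Suc n)
    then have "t \<noteq> r" using lev(1) by auto
    then obtain a where a: "(a, t) \<in> parcs T" using Suc parent_ex by blast
    then have "lev a = n" "a \<in> pverts T" using lev(2) Suc assms(2) by auto
    then obtain p where "pcas r p a" "set p \<subseteq> parcs T" using Suc.IH by blast
    then show ?case using a by (intro exI[of _ "p @ [(a, t)]"]) (auto simp: pcas_append)
  qed
  have uniq: "p = q" if "pcas r p t" "set p \<subseteq> parcs T" "pcas r q t" "set q \<subseteq> parcs T" for p q t
    using that
  proof (induction p arbitrary: q t rule: rev_induct)
    case Nil
    then show ?case using len[of r q t] lev(1) by simp
  next
    case (snoc e p)
    have "length q = length (p @ [e])" using snoc.prems len by (metis add_left_cancel)
    then obtain q' e' where q: "q = q' @ [e']" by (cases q rule: rev_cases) auto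
    have e: "snd e = t" "snd e' = t" using snoc.prems q by (auto simp: pcas_append)
    then have "fst e = fst e'" using snoc.prems q parent_unique[of "fst e" t "fst e'"] by (cases e; cases e') auto
    then have "e = e'" using e by (auto simp: prod_eq_iff)
    moreover have "p = q'" using snoc.prems q \<open>e = e'\<close> by (intro snoc.IH[of "fst e"]) (auto simp: pcas_append)
    ultimately show ?case using q by simp
  qed
  have "parcs T \<subseteq> pverts T \<times> pverts T" "finite (parcs T)"
    using assms(1,2) by (auto intro: finite_subset)
  then have "pair_fin_digraph T" using assms(1) by unfold_locales auto
  then show "rooted_tree T r"
    unfolding rooted_tree_def with_proj_awalk using assms(3) ex uniq by (metis (no_types))
qed

locale out_tree =
  fixes T :: "'t pair_pre_digraph" and r :: 't
  assumes rooted: "rooted_tree T r"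
begin

lemma fin: "pair_fin_digraph T" and root: "r \<in> pverts T"
  using rooted by (auto simp: rooted_tree_def)

lemma ex1: "t \<in> pverts T \<Longrightarrow> \<exists>!p. set p \<subseteq> parcs T \<and> pcas r p t"
  using rooted root unfolding rooted_tree_def with_proj_awalk by simp

lemma walk_unique:
  assumes "set p \<subseteq> parcs T" "pcas r p t" "set q \<subseteq> parcs T" "pcas r q t" "t \<in> pverts T"
  shows "p = q"
  using ex1[OF assms(5)] assms(1-4) by (metis (no_types))

lemma wf: "pair_wf_digraph T"
  using fin by (simp add: pair_fin_digraph_def)

lemma arcs_in: "(a, b) \<in> parcs T \<Longrightarrow> a \<in> pverts T \<and> b \<in> pverts T"
  using pair_wf_digraph.arc_fst_in_verts[OF wf] pair_wf_digraph.arc_snd_in_verts[OF wf] by fastforce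

definition sub :: "'t \<Rightarrow> 't set" where "sub t = {s. (t, s) \<in> (parcs T)\<^sup>*}"

lemma sub_refl [simp]: "t \<in> sub t" by (simp add: sub_def)

lemma sub_verts:
  assumes t: "t \<in> pverts T" shows "sub t \<subseteq> pverts T"
proof
  fix s assume "s \<in> sub t"
  then have "(t, s) \<in> (parcs T)\<^sup>*" by (simp add: sub_def)
  then show "s \<in> pverts T" by (induction rule: rtrancl_induct) (use t arcs_in in auto)
qed

lemma sub_root: "sub r = pverts T"
proof
  show "pverts T \<subseteq> sub r" using ex1 unfolding sub_def by (auto dest: pcas_rtrancl)
qed (use sub_verts root in blast)

lemma parent_unique:
  assumes "(a, b) \<in> parcs T" "(a', b) \<in> parcs T"
  shows "a = a'"
proof -
  obtain p p' where p: "set p \<subseteq> parcs T" "pcas r p a" "set p' \<subseteq> parcs T" "pcas r p' a'"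
    using ex1 arcs_in assms by meson
  have "p @ [(a, b)] = p' @ [(a', b)]"
    by (rule walk_unique[of _ b]) (use p assms arcs_in in \<open>auto simp: pcas_append\<close>)
  then show ?thesis by simp
qed

text \<open>Going round the cycle would yield a second walk from the root to
  \<open>t\<close>.\<close>

lemma acyclic:
  assumes "(t, c) \<in> parcs T" shows "t \<notin> sub c"
proof
  assume "t \<in> sub c"
  then obtain q where q: "pcas c q t" "set q \<subseteq> parcs T" using rtrancl_pcas by (fastforce simp: sub_def)
  obtain p where p: "set p \<subseteq> parcs T" "pcas r p t" using ex1 arcs_in assms by meson
  have "pcas r (p @ (t, c) # q) t" "set (p @ (t, c) # q) \<subseteq> parcs T"
    using p q assms by (auto simp: pcas_append)
  then have "p @ (t, c) # q = p"
    using walk_unique p arcs_in[OF assms] by blast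
  then show False by simp
qed

text \<open>Any other node of the subtree has its unique parent inside the subtree.\<close>

lemma arc_into_sub:
  assumes "(a, b) \<in> parcs T" "b \<in> sub t" "a \<notin> sub t"
  shows "b = t"
proof (rule ccontr)
  assume "b \<noteq> t"
  then obtain a' where "(t, a') \<in> (parcs T)\<^sup>*" "(a', b) \<in> parcs T"
    using assms(2) unfolding sub_def by (auto elim: rtranclE)
  then show False using parent_unique assms by (auto simp: sub_def)
qed

lemma arc_from_sub: "(a, b) \<in> parcs T \<Longrightarrow> a \<in> sub t \<Longrightarrow> b \<in> sub t"
  unfolding sub_def by auto

end

section \<open>Balanced bags\<close>

lemma rtrancl_exit:
  "(s, s') \<in> R\<^sup>* \<Longrightarrow> s \<in> Q \<Longrightarrow> s' \<notin> Q \<Longrightarrow> \<exists>a b. (a, b) \<in> R \<and> a \<in> Q \<and> b \<notin> Q"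
  by (induction rule: rtrancl_induct) auto

text \<open>Phrased by components, neighbourhoods and cardinalities only, so that it can be tested
  for a single bag without looking at the tree.\<close>

definition good_bag :: "'a pair_pre_digraph \<Rightarrow> nat \<Rightarrow> 'a set \<Rightarrow> 'a set \<Rightarrow> bool" where
  "good_bag G K C B \<longleftrightarrow> (\<forall>A\<in>components G (C - B). card (neighbourhood G A) \<le> 4 * K \<and>
     (if card (neighbourhood G C) \<le> 3 * K then 2 * card A \<le> card C else card (neighbourhood G A) \<le> 3 * K))"

locale tree_decomposition = out_tree T r
  for T :: "'t pair_pre_digraph" and r +
  fixes G :: "'a pair_pre_digraph" and \<beta> :: "'t \<Rightarrow> 'a set"
  assumes graph: "pair_graph G" and dec: "rooted_tree_decomposition G T r \<beta>"
begin

lemma bag_subset: "t \<in> pverts T \<Longrightarrow> \<beta> t \<subseteq> pverts G"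
  and cover_vertex: "v \<in> pverts G \<Longrightarrow> \<exists>t\<in>pverts T. v \<in> \<beta> t"
  and cover_arc: "(u, v) \<in> parcs G \<Longrightarrow> \<exists>t\<in>pverts T. u \<in> \<beta> t \<and> v \<in> \<beta> t"
  and bags_connected: "v \<in> pverts G \<Longrightarrow> Digraph_Component.connected (with_proj T \<restriction> {t \<in> pverts T. v \<in> \<beta> t})"
  using dec by (auto simp: rooted_tree_decomposition_def)

lemmas fin_verts = pair_graph_finite[OF graph]
  and arc_sym = pair_graph_arc_sym[OF graph]
  and arc_verts = pair_graph_arc_verts[OF graph]

text \<open>The nodes whose bags contain \<open>v\<close> are connected, and a path among them that
  leaves the subtree of \<open>t\<close> has to use the arc between \<open>t\<close> and its
  parent.\<close>

lemma separate:
  assumes "s \<in> sub t" "s' \<notin> sub t" "s \<in> pverts T" "s' \<in> pverts T" "v \<in> \<beta> s" "v \<in> \<beta> s'"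
  obtains p where "(p, t) \<in> parcs T" "v \<in> \<beta> p" "v \<in> \<beta> t"
proof -
  let ?S = "{t \<in> pverts T. v \<in> \<beta> t}"
  have "v \<in> pverts G" using assms bag_subset by blast
  then have "(s, s') \<in> (adj T ?S)\<^sup>*"
    using bags_connected assms unfolding connected_induced_iff by blast
  then obtain a b where ab: "(a, b) \<in> adj T ?S" "a \<in> sub t" "b \<notin> sub t"
    using rtrancl_exit[of s s' _ "sub t"] assms by blast
  then have "(b, a) \<in> parcs T" using arc_from_sub by (auto simp: adj_def)
  moreover from this have "a = t" using arc_into_sub ab by blast
  ultimately show ?thesis using that ab by (auto simp: adj_def)
qed

text \<open>This is \<gamma>(t).\<close>

definition below :: "'t \<Rightarrow> 'a set" where "below t = (\<Union>s\<in>sub t. \<beta> s)"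

lemma below_subset: "t \<in> pverts T \<Longrightarrow> below t \<subseteq> pverts G"
  using sub_verts bag_subset unfolding below_def by blast

text \<open>
  The sides of a node \<open>t\<close>: the vertices outside \<open>\<beta> t\<close> below a child of \<open>t\<close>, or not below \<open>t\<close> at all.
\<close>

definition side :: "'t \<Rightarrow> 'a set \<Rightarrow> bool" where
  "side t Z \<longleftrightarrow> Z \<subseteq> pverts G - \<beta> t \<and> (\<forall>u\<in>Z. \<forall>v. (u, v) \<in> parcs G \<longrightarrow> v \<notin> \<beta> t \<longrightarrow> v \<in> Z) \<and>
     (\<exists>a b. (a, b) \<in> parcs T \<and> neighbourhood G Z \<subseteq> \<beta> b \<inter> \<beta> a)"

lemma side_below:
  assumes tc: "(t, c) \<in> parcs T"
  shows "side t (below c - \<beta> t)"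
proof -
  have tv: "t \<in> pverts T" "c \<in> pverts T" using arcs_in tc by blast+
  \<comment> \<open>If the edge were covered only outside the subtree of \<open>c\<close>, then
    \<open>u\<close> would occur on both sides of the arc from \<open>t\<close> to \<open>c\<close>
    and therefore in \<open>\<beta> t\<close>.\<close>
  have bag: "\<exists>s\<in>sub c. u \<in> \<beta> s \<and> v \<in> \<beta> s" if uv: "u \<in> below c" "u \<notin> \<beta> t" "(u, v) \<in> parcs G" for u v
  proof -
    obtain s0 where s0: "s0 \<in> pverts T" "u \<in> \<beta> s0" "v \<in> \<beta> s0" using cover_arc uv(3) by blast
    obtain s1 where s1: "s1 \<in> sub c" "u \<in> \<beta> s1" using uv(1) by (auto simp: below_def)
    have "s0 \<in> sub c"
    proof (rule ccontr)
      assume "s0 \<notin> sub c"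
      then obtain p where "(p, c) \<in> parcs T" "u \<in> \<beta> p"
        using separate[of s1 c s0 u] s0 s1 sub_verts[OF tv(2)] by blast
      then show False using parent_unique tc uv(2) by blast
    qed
    then show ?thesis using s0 by blast
  qed
  show ?thesis
    unfolding side_def
  proof (intro conjI ballI allI impI exI)
    show "below c - \<beta> t \<subseteq> pverts G - \<beta> t" using below_subset[OF tv(2)] by blast
    show "(t, c) \<in> parcs T" by fact
    show "v \<in> below c - \<beta> t" if "u \<in> below c - \<beta> t" "(u, v) \<in> parcs G" "v \<notin> \<beta> t" for u v
      using bag[of u v] that by (auto simp: below_def)
    show "neighbourhood G (below c - \<beta> t) \<subseteq> \<beta> c \<inter> \<beta> t"
    proof
      fix v assume "v \<in> neighbourhood G (below c - \<beta> t)"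
      then obtain u where u: "v \<notin> below c - \<beta> t" "u \<in> below c" "u \<notin> \<beta> t" "(u, v) \<in> parcs G"
        by (auto simp: neighbourhood_def)
      then obtain s where s: "s \<in> sub c" "v \<in> \<beta> s" using bag by blast
      then have vt: "v \<in> \<beta> t" using u by (auto simp: below_def)
      \<comment> \<open>By \<open>acyclic\<close> the node \<open>t\<close> is outside
        \<open>sub c\<close>, so \<open>v\<close> occurs on both sides of the arc from
        \<open>t\<close> to \<open>c\<close>.\<close>
      have "v \<in> \<beta> c"
        using separate[of s c t v] s vt tv sub_verts[OF tv(2)] acyclic[OF tc] by blast
      then show "v \<in> \<beta> c \<inter> \<beta> t" using vt by blast
    qed
  qed
qed

text \<open>The separating arc comes from the parent of \<open>t\<close>. There is a parent because
  at the root no vertex lies outside \<open>below t\<close>.\<close>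

lemma side_above:
  assumes t: "t \<in> pverts T" and "pverts G - below t \<noteq> {}"
  shows "side t (pverts G - below t)"
proof -
  have "below r = pverts G"
    using below_subset[OF root] cover_vertex unfolding below_def sub_root by blast
  then have "t \<noteq> r" using assms by auto
  moreover have "(r, t) \<in> (parcs T)\<^sup>*" using sub_root t by (auto simp: sub_def)
  ultimately obtain p where p: "(p, t) \<in> parcs T" by (auto elim: rtranclE)
  have cross: "v \<in> \<beta> t \<and> v \<in> \<beta> p" if uv: "u \<in> pverts G - below t" "(u, v) \<in> parcs G" "v \<in> below t" for u v
  proof -
    obtain s0 where s0: "s0 \<in> pverts T" "u \<in> \<beta> s0" "v \<in> \<beta> s0" using cover_arc uv(2) by blast
    obtain s1 where s1: "s1 \<in> sub t" "v \<in> \<beta> s1" using uv(3) by (auto simp: below_def)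
    have "s0 \<notin> sub t" using uv(1) s0(2) by (auto simp: below_def)
    then obtain p' where "(p', t) \<in> parcs T" "v \<in> \<beta> p'" "v \<in> \<beta> t"
      using separate[of s1 t s0 v] s0 s1 sub_verts[OF t] by blast
    then show ?thesis using parent_unique p by blast
  qed
  show ?thesis
    unfolding side_def
  proof (intro conjI ballI allI impI exI)
    show "(p, t) \<in> parcs T" by fact
    show "v \<in> pverts G - below t" if "u \<in> pverts G - below t" "(u, v) \<in> parcs G" "v \<notin> \<beta> t" for u v
      using cross[of u v] arc_verts that by blast
    show "neighbourhood G (pverts G - below t) \<subseteq> \<beta> t \<inter> \<beta> p"
      using cross by (auto simp: neighbourhood_def)
    show "pverts G - below t \<subseteq> pverts G - \<beta> t" using sub_refl unfolding below_def by blast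
  qed
qed

text \<open>A lowest node with at least half of \<open>W\<close> below it is balanced.\<close>

lemma balanced_bag:
  assumes W: "W \<subseteq> pverts G"
  obtains t where "t \<in> pverts T"
    "\<And>x. x \<in> pverts G - \<beta> t \<Longrightarrow> \<exists>Z. side t Z \<and> x \<in> Z \<and> 2 * card (W \<inter> Z) \<le> card W"
proof -
  have finW: "finite W" using W fin_verts finite_subset by blast
  have finT: "finite (pverts T)" using fin by (simp add: pair_fin_digraph.pair_finite_verts)
  let ?heavy = "\<lambda>t. t \<in> pverts T \<and> card W \<le> 2 * card (W \<inter> below t)"
  have "W \<inter> below r = W"
    using W cover_vertex unfolding below_def sub_root by blast
  then have "?heavy r" using root by simp
  then obtain t where t: "?heavy t" and min: "\<And>s. ?heavy s \<Longrightarrow> card (sub t) \<le> card (sub s)"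
    using ex_has_least_nat[of ?heavy r "\<lambda>t. card (sub t)"] by blast
  show ?thesis
  proof (rule that[of t])
    show "t \<in> pverts T" using t by simp
    fix x assume x: "x \<in> pverts G - \<beta> t"
    show "\<exists>Z. side t Z \<and> x \<in> Z \<and> 2 * card (W \<inter> Z) \<le> card W"
    proof (cases "x \<in> below t")
      case True
      then obtain s where s: "(t, s) \<in> (parcs T)\<^sup>*" "x \<in> \<beta> s" by (auto simp: below_def sub_def)
      moreover have "s \<noteq> t" using s x by auto
      ultimately obtain c where c: "(t, c) \<in> parcs T" "(c, s) \<in> (parcs T)\<^sup>*"
        by (metis converse_rtranclE)
      have cv: "c \<in> pverts T" using c arcs_in by blast
      \<comment> \<open>A child has strictly fewer descendants, so by the choice of \<open>t\<close>
        less than half of \<open>W\<close> lies below it.\<close>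
      have "sub c \<subset> sub t"
        using c(1) acyclic[OF c(1)] by (auto simp: sub_def intro: converse_rtrancl_into_rtrancl)
      then have "card (sub c) < card (sub t)"
        using finT sub_verts t by (meson finite_subset psubset_card_mono)
      then have "\<not> ?heavy c" using min leD by blast
      then have "2 * card (W \<inter> below c) < card W" using cv by simp
      moreover have "card (W \<inter> (below c - \<beta> t)) \<le> card (W \<inter> below c)"
        using finW by (intro card_mono) auto
      moreover have "x \<in> below c - \<beta> t" using x s c by (auto simp: below_def sub_def)
      ultimately show ?thesis using side_below[OF c(1)]
        by (intro exI[of _ "below c - \<beta> t"]) auto
    next
      case False
      \<comment> \<open>At least half of \<open>W\<close> is below \<open>t\<close>, which leaves at
        most half for the upper side.\<close>
      have "card W = card (W \<inter> below t) + card (W - below t)"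
        using card_Int_Diff[OF finW] by blast
      moreover have "W \<inter> (pverts G - below t) = W - below t" using W by blast
      ultimately have "2 * card (W \<inter> (pverts G - below t)) \<le> card W" using t by simp
      then show ?thesis using side_above[of t] t x False
        by (intro exI[of _ "pverts G - below t"]) auto
    qed
  qed
qed

text \<open>A side is closed under edges that avoid \<open>\<beta> t\<close>, so the component
  cannot leave it. A neighbour of \<open>A\<close> outside \<open>Z\<close> is a neighbour of
  \<open>Z\<close>; one inside \<open>Z\<close> avoids \<open>\<beta> t\<close> and would belong to
  \<open>A\<close> if it were in \<open>C\<close>, so it lies in the neighbourhood of
  \<open>C\<close>.\<close>

lemma component_in_side:
  assumes Z: "side t Z" "x \<in> Z" and A: "A \<in> components G (C - \<beta> t)" "x \<in> A" and C: "C \<subseteq> pverts G"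
  shows "A \<subseteq> C \<inter> Z" "neighbourhood G A \<subseteq> neighbourhood G Z \<union> (neighbourhood G C \<inter> Z)"
proof -
  have "y \<in> Z" if "(x, y) \<in> (adj G (C - \<beta> t))\<^sup>*" for y
    using that
  proof (induction rule: rtrancl_induct)
    case (step y z)
    then show ?case using Z(1) arc_sym by (auto simp: adj_def side_def)
  qed (use Z in simp)
  then have AZ: "A \<subseteq> Z" using component_eq[OF A] by blast
  then show "A \<subseteq> C \<inter> Z" using components_subset[OF A(1)] by blast
  show "neighbourhood G A \<subseteq> neighbourhood G Z \<union> (neighbourhood G C \<inter> Z)"
  proof
    fix v assume v: "v \<in> neighbourhood G A"
    then obtain u where u: "u \<in> A" "(u, v) \<in> parcs G" "v \<notin> A" "v \<in> pverts G"
      by (auto simp: neighbourhood_def)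
    show "v \<in> neighbourhood G Z \<union> (neighbourhood G C \<inter> Z)"
    proof (cases "v \<in> Z")
      case True
      then have "v \<notin> \<beta> t" using Z(1) by (auto simp: side_def)
      then have "v \<notin> C" using component_closed[OF A(1) u(1), of v] u by blast
      then show ?thesis using True u components_subset[OF A(1)] by (auto simp: neighbourhood_def)
    next
      case False
      then show ?thesis using u AZ by (auto simp: neighbourhood_def)
    qed
  qed
qed

text \<open>The neighbourhood of a side lies in an adhesion, which accounts for the summand
  \<open>K\<close>.\<close>

lemma side_component_bounds:
  assumes K: "adhesions_le T \<beta> K" and Z: "side t Z" "x \<in> Z"
    and A: "A \<in> components G (C - \<beta> t)" "x \<in> A" and C: "C \<subseteq> pverts G"
  shows "card A \<le> card (C \<inter> Z)"
    "card (neighbourhood G A) \<le> K + card (neighbourhood G C \<inter> Z)"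
proof -
  note sub = component_in_side[OF Z A C]
  show "card A \<le> card (C \<inter> Z)"
    using sub(1) C fin_verts by (meson card_mono finite_Int finite_subset)
  obtain a b where ab: "(a, b) \<in> parcs T" "neighbourhood G Z \<subseteq> \<beta> b \<inter> \<beta> a"
    using Z(1) unfolding side_def by blast
  have fin: "finite (\<beta> b \<inter> \<beta> a)"
    using bag_subset arcs_in ab(1) fin_verts by (meson finite_Int finite_subset)
  then have "card (neighbourhood G Z) \<le> K"
    using card_mono[OF fin ab(2)] K ab(1) by (fastforce simp: adhesions_le_def)
  moreover have "finite (neighbourhood G X)" for X
    using fin_verts by (auto simp: neighbourhood_def)
  then have "card (neighbourhood G A) \<le> card (neighbourhood G Z) + card (neighbourhood G C \<inter> Z)"
    by (meson card_Un_le card_mono finite_Int finite_Un order_trans sub(2))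
  ultimately show "card (neighbourhood G A) \<le> K + card (neighbourhood G C \<inter> Z)" by linarith
qed

lemma good_bag_exists:
  assumes K: "adhesions_le T \<beta> K" and C: "C \<subseteq> pverts G" "card (neighbourhood G C) \<le> 4 * K"
  shows "\<exists>t\<in>pverts T. good_bag G K C (\<beta> t)"
proof -
  define W where "W = (if card (neighbourhood G C) \<le> 3 * K then C else neighbourhood G C)"
  have "W \<subseteq> pverts G" using C by (auto simp: W_def neighbourhood_def)
  then obtain t where t: "t \<in> pverts T"
    "\<And>x. x \<in> pverts G - \<beta> t \<Longrightarrow> \<exists>Z. side t Z \<and> x \<in> Z \<and> 2 * card (W \<inter> Z) \<le> card W"
    using balanced_bag by metis
  have "good_bag G K C (\<beta> t)"
    unfolding good_bag_def
  proof
    fix A assume A: "A \<in> components G (C - \<beta> t)"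
    then obtain x where x: "x \<in> A" using components_nonempty by blast
    then have "x \<in> pverts G - \<beta> t" using components_subset[OF A] C by blast
    then obtain Z where Z: "side t Z" "x \<in> Z" "2 * card (W \<inter> Z) \<le> card W" using t by blast
    note b = side_component_bounds[OF K Z(1,2) A x C(1)]
    have "card (neighbourhood G C \<inter> Z) \<le> card (neighbourhood G C)"
      using fin_verts by (intro card_mono) (auto simp: neighbourhood_def)
    \<comment> \<open>If \<open>W = C\<close>, the neighbourhood may keep its \<open>3 * K\<close>
      vertices and gain \<open>K\<close>; otherwise at most half of \<open>4 * K\<close> remains
      besides the new \<open>K\<close>.\<close>
    then show "card (neighbourhood G A) \<le> 4 * K \<and>
     (if card (neighbourhood G C) \<le> 3 * K then 2 * card A \<le> card C else card (neighbourhood G A) \<le> 3 * K)"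
      using b Z(3) C(2) by (auto simp: W_def split: if_splits)
  qed
  then show ?thesis using t(1) by blast
qed

end

section \<open>The decomposition produced by a choice of bags\<close>

text \<open>All that is left of the input decomposition is the choice \<open>sel\<close> of good
  bags. The naming \<open>nm\<close> stays abstract until the algorithm supplies numbers.\<close>

locale bag_selection =
  fixes G :: "'a pair_pre_digraph" and K :: nat and sel :: "'a set \<Rightarrow> 'a set" and nm :: "nat \<Rightarrow> 'a set \<Rightarrow> 't"
  assumes graph: "pair_graph G"
    and sel_good: "C \<subseteq> pverts G \<Longrightarrow> card (neighbourhood G C) \<le> 4 * K \<Longrightarrow> good_bag G K C (sel C)"
begin

abbreviation "V \<equiv> pverts G"
abbreviation "N \<equiv> neighbourhood G"

definition kids :: "'a set \<Rightarrow> 'a set set" where "kids A = components G (A - sel A)"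

primrec level :: "nat \<Rightarrow> 'a set set" where
  "level 0 = {V}"
| "level (Suc d) = \<Union>(kids ` level d)"

lemmas fin_V = pair_graph_finite[OF graph]
  and wf_G = pair_graph_wf[OF graph]
  and arc_sym = pair_graph_arc_sym[OF graph]
  and arc_verts = pair_graph_arc_verts[OF graph]

lemma N_V [simp]: "N V = {}"
  by (auto simp: neighbourhood_def)

lemma N_disjoint: "A \<inter> N A = {}"
  by (auto simp: neighbourhood_def)

lemma N_subset: "N A \<subseteq> V"
  by (auto simp: neighbourhood_def)

lemma in_N: "u \<in> A \<Longrightarrow> (u, v) \<in> parcs G \<Longrightarrow> v \<notin> A \<Longrightarrow> v \<in> N A"
  using arc_verts by (auto simp: neighbourhood_def)

lemma kids_subset: "A \<in> kids B \<Longrightarrow> A \<subseteq> B - sel B"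
  unfolding kids_def by (rule components_subset)

lemma level_subset: "A \<in> level d \<Longrightarrow> A \<subseteq> V"
proof (induction d arbitrary: A)
  case (Suc d)
  then obtain B where "B \<in> level d" "A \<in> kids B" by auto
  then show ?case using Suc.IH kids_subset by blast
qed simp

text \<open>The bound on \<open>N A\<close> is the precondition for a good selected bag, and such a
  bag guarantees it for the children; it starts from \<open>N V = {}\<close>.\<close>

lemma level_good:
  assumes "A \<in> level d"
  shows "card (N A) \<le> 4 * K" "good_bag G K A (sel A)"
proof -
  show N: "card (N A) \<le> 4 * K"
    using assms
  proof (induction d arbitrary: A)
    case (Suc d)
    then obtain B where B: "B \<in> level d" "A \<in> kids B" by auto
    then have "good_bag G K B (sel B)" using sel_good Suc.IH level_subset by blast
    then show ?case using B(2) unfolding good_bag_def kids_def by blast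
  qed simp
  show "good_bag G K A (sel A)" using sel_good[OF level_subset[OF assms] N] .
qed

lemma kids_good:
  assumes "B \<in> level d" "A \<in> kids B"
  shows "if card (N B) \<le> 3 * K then 2 * card A \<le> card B else card (N A) \<le> 3 * K"
  using level_good(2)[OF assms(1)] assms(2) unfolding good_bag_def kids_def by blast

lemma level_disjoint: "A \<in> level d \<Longrightarrow> B \<in> level d \<Longrightarrow> v \<in> A \<Longrightarrow> v \<in> B \<Longrightarrow> A = B"
proof (induction d arbitrary: A B)
  case (Suc d)
  then obtain A' B' where AB: "A' \<in> level d" "A \<in> kids A'" "B' \<in> level d" "B \<in> kids B'" by auto
  then have "v \<in> A'" "v \<in> B'" using Suc.prems kids_subset by blast+
  then have "A' = B'" using Suc.IH AB by blast
  then show ?case using AB Suc.prems components_disjoint unfolding kids_def by blast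
qed simp

lemma kids_nonempty: "A \<in> kids B \<Longrightarrow> A \<noteq> {}"
  unfolding kids_def by (rule components_nonempty)

lemma level_connected: "A \<in> level (Suc d) \<Longrightarrow> Digraph_Component.connected (with_proj G \<restriction> A)"
  by (auto simp: kids_def intro: component_connected)

lemma finite_level: "finite (level d)"
  using finite_subset[of "level d" "Pow V"] level_subset fin_V by auto

text \<open>Here \<open>j\<close> counts the halvings on the way to \<open>A\<close>. A step without
  halving leaves a neighbourhood of at most \<open>3 * K\<close>, so the next one halves. A larger
  neighbourhood therefore shows that the last step was a halving, which has gained one unit of depth
  in advance.\<close>

lemma level_shrinks:
  "A \<in> level d \<Longrightarrow> \<exists>j. 2 ^ j * card A \<le> card V \<and> (if card (N A) \<le> 3 * K then d \<le> 2 * j else d + 1 \<le> 2 * j)"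
proof (induction d arbitrary: A)
  case 0
  then show ?case by (intro exI[of _ 0]) simp
next
  case (Suc d)
  then obtain B where B: "B \<in> level d" "A \<in> kids B" by auto
  obtain j where j: "2 ^ j * card B \<le> card V"
      "if card (N B) \<le> 3 * K then d \<le> 2 * j else d + 1 \<le> 2 * j" using Suc.IH[OF B(1)] by blast
  show ?case
  proof (cases "card (N B) \<le> 3 * K")
    case True
    then have "2 * card A \<le> card B" using kids_good[OF B] by simp
    then have "2 ^ j * (2 * card A) \<le> 2 ^ j * card B" by (rule mult_le_mono2)
    moreover have "2 ^ Suc j * card A = 2 ^ j * (2 * card A)" by simp
    ultimately have "2 ^ Suc j * card A \<le> card V" using j(1) by linarith
    then show ?thesis using True j(2) by (intro exI[of _ "Suc j"]) auto
  next
    case False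
    have "card A \<le> card B"
      using kids_subset[OF B(2)] finite_subset[OF level_subset[OF B(1)] fin_V] by (intro card_mono) auto
    then have "2 ^ j * card A \<le> 2 ^ j * card B" by (rule mult_le_mono2)
    then have "2 ^ j * card A \<le> card V" using j(1) by linarith
    then show ?thesis using False j(2) kids_good[OF B] by (intro exI[of _ j]) auto
  qed
qed

text \<open>Sets below the root are non-empty, so \<open>2 ^ j\<close> is at most
  \<open>card V\<close>. The second bound, free of logarithms, makes the tree finite and limits the
  depths that the algorithm enumerates.\<close>

lemma level_depth:
  assumes "A \<in> level d"
  shows "int d \<le> 2 * \<lceil>log 2 (real (card V))\<rceil>" "d \<le> 2 * card V"
proof -
  have "int d \<le> 2 * \<lceil>log 2 (real (card V))\<rceil> \<and> d \<le> 2 * card V"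
  proof (cases d)
    case 0
    \<comment> \<open>For the empty graph this relies on the convention
      \<open>log 2 0 = 0\<close>.\<close>
    have "0 \<le> log 2 (real (card V))" by (cases "card V = 0") (auto simp: log_def)
    then show ?thesis using 0 by simp
  next
    case (Suc d')
    then have "A \<noteq> {}" using assms kids_nonempty by auto
    then have A: "card A \<ge> 1" using level_subset[OF assms] fin_V
      by (metis One_nat_def Suc_leI card_gt_0_iff finite_subset)
    obtain j where j: "2 ^ j * card A \<le> card V" "d \<le> 2 * j"
      using level_shrinks[OF assms] by (auto split: if_splits)
    have "2 ^ j * 1 \<le> 2 ^ j * card A" using A by (rule mult_le_mono2)
    then have V: "2 ^ j \<le> card V" using j(1) by linarith
    then have "real j \<le> log 2 (real (card V))" using le_log2_of_power[of j "card V"] V by simp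
    then have "int j \<le> \<lceil>log 2 (real (card V))\<rceil>" by linarith
    moreover have "j \<le> card V" using V less_exp[of j] by linarith
    ultimately show ?thesis using j(2) by linarith
  qed
  then show "int d \<le> 2 * \<lceil>log 2 (real (card V))\<rceil>" "d \<le> 2 * card V" by blast+
qed

lemma ancestor: "A \<in> level (d + Suc e) \<Longrightarrow> \<exists>B\<in>level d. A \<subseteq> B - sel B"
proof (induction e arbitrary: A)
  case 0
  then obtain B where "B \<in> level d" "A \<in> kids B" by auto
  then show ?case using kids_subset[of A B] by blast
next
  case (Suc e)
  then obtain B where B: "B \<in> level (d + Suc e)" "A \<in> kids B" by auto
  obtain C where "C \<in> level d" "B \<subseteq> C - sel C" using Suc.IH[OF B(1)] by blast
  then show ?case using kids_subset[OF B(2)] by blast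
qed

text \<open>A neighbour in \<open>B - sel B\<close> would belong to the component \<open>A\<close>
  itself. Thus the parent's bag contains \<open>N A\<close>.\<close>

lemma N_kid:
  assumes "A \<in> kids B" shows "N A \<subseteq> (B \<inter> sel B) \<union> N B"
proof
  fix v assume "v \<in> N A"
  then obtain u where u: "u \<in> A" "(u, v) \<in> parcs G" "v \<notin> A" by (auto simp: neighbourhood_def)
  then have "v \<notin> B - sel B" using component_closed[of A G "B - sel B" u v] assms by (auto simp: kids_def)
  moreover have "v \<in> N B" if "v \<notin> B" using that in_N u kids_subset[OF assms] by blast
  ultimately show "v \<in> (B \<inter> sel B) \<union> N B" by blast
qed

text \<open>
  The home of a vertex \<open>v\<close> is the only node \<open>A\<close> with \<open>v \<in> A \<inter> sel A\<close>; every other node whose bag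
  contains \<open>v\<close> does so because \<open>v \<in> N A\<close>, and then the parent's bag contains \<open>v\<close> as well.
\<close>

lemma home_exists:
  assumes "v \<in> V" obtains d A where "A \<in> level d" "v \<in> A" "v \<in> sel A"
proof (rule ccontr)
  assume none: "\<not> thesis"
  \<comment> \<open>Without a home the vertex is handed on to a child at every depth, contrary to
    the depth bound.\<close>
  have "\<exists>A\<in>level d. v \<in> A" for d
  proof (induction d)
    case (Suc d)
    then obtain A where A: "A \<in> level d" "v \<in> A" by blast
    then have "v \<in> A - sel A" using none that by blast
    then have "v \<in> \<Union>(kids A)" unfolding kids_def Union_components .
    then show ?case using A(1) by auto
  qed (use assms in simp)
  from this[of "Suc (2 * card V)"] show False using level_depth(2) by fastforce
qed

text \<open>A deeper set avoids the selected bag of its ancestor at depth \<open>d\<close>, and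
  disjointness makes this ancestor \<open>A\<close>.\<close>

lemma home_deepest:
  assumes "A \<in> level d" "v \<in> A" "v \<in> sel A" "A' \<in> level d'" "v \<in> A'"
  shows "d' \<le> d"
proof (rule ccontr)
  assume "\<not> d' \<le> d"
  then obtain e where "d' = d + Suc e" using less_imp_Suc_add[of d d'] by auto
  then obtain B where "B \<in> level d" "A' \<subseteq> B - sel B" using ancestor assms(4) by blast
  then show False using level_disjoint[of B d A v] assms by blast
qed

lemma home_unique:
  assumes "A \<in> level d" "v \<in> A" "v \<in> sel A" "A' \<in> level d'" "v \<in> A'" "v \<in> sel A'"
  shows "d = d'" "A = A'"
proof -
  show "d = d'" using home_deepest assms by (meson le_antisym)
  then show "A = A'" using level_disjoint assms by blast
qed

definition bag :: "'a set \<Rightarrow> 'a set" where "bag A = (A \<inter> sel A) \<union> N A"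

lemma bag_subset: "A \<in> level d \<Longrightarrow> bag A \<subseteq> V"
  using level_subset N_subset unfolding bag_def by blast

text \<open>If the home set of one end misses the other end, the latter is a neighbour of that set
  and so in its bag. If each end lies in the home set of the other, both homes have the same depth
  and coincide.\<close>

lemma arc_covered:
  assumes uv: "(u, v) \<in> parcs G"
  shows "\<exists>d. \<exists>A\<in>level d. u \<in> bag A \<and> v \<in> bag A"
proof -
  obtain d A where A: "A \<in> level d" "u \<in> A" "u \<in> sel A" using home_exists arc_verts uv by metis
  obtain d' A' where A': "A' \<in> level d'" "v \<in> A'" "v \<in> sel A'" using home_exists arc_verts uv by metis
  consider "v \<notin> A" | "u \<notin> A'" | "v \<in> A" "u \<in> A'" by blast
  then show ?thesis
  proof cases
    case 1
    then have "v \<in> N A" using in_N A uv by blast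
    then show ?thesis using A unfolding bag_def by blast
  next
    case 2
    then have "u \<in> N A'" using in_N A' arc_sym uv by blast
    then show ?thesis using A' unfolding bag_def by blast
  next
    case 3
    then have "d = d'" using home_deepest A A' by (meson le_antisym)
    then have "A = A'" using level_disjoint A A' 3 by blast
    then show ?thesis using A A' unfolding bag_def by blast
  qed
qed

definition new_tree :: "'t pair_pre_digraph" where
  "new_tree = \<lparr>pverts = {nm d A |d A. A \<in> level d},
     parcs = {(nm d A, nm (Suc d) A') |d A A'. A \<in> level d \<and> A' \<in> kids A}\<rparr>"

text \<open>With injective names the union has a single member at every node; this form works
  without an inverse of \<open>nm\<close>.\<close>

definition new_bag :: "'t \<Rightarrow> 'a set" where
  "new_bag t = \<Union>{bag A |d A. A \<in> level d \<and> t = nm d A}"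

end

text \<open>Injectivity of names is a separate assumption because for the concrete names it is
  derived from the disjointness of the levels.\<close>

locale named_bag_selection = bag_selection G K sel nm
  for G :: "'a pair_pre_digraph" and K :: nat and sel and nm :: "nat \<Rightarrow> 'a set \<Rightarrow> 't" +
  assumes nm_inj: "A \<in> level d \<Longrightarrow> A' \<in> level d' \<Longrightarrow> nm d A = nm d' A' \<Longrightarrow> d = d' \<and> A = A'"
begin

lemma verts_new_tree: "t \<in> pverts new_tree \<longleftrightarrow> (\<exists>d A. t = nm d A \<and> A \<in> level d)"
  by (simp add: new_tree_def)

lemma arcs_new_tree: "(s, t) \<in> parcs new_tree \<longleftrightarrow>
    (\<exists>d A A'. s = nm d A \<and> t = nm (Suc d) A' \<and> A \<in> level d \<and> A' \<in> kids A)"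
  by (simp add: new_tree_def)

lemma level_Suc_kids: "A \<in> level d \<Longrightarrow> A' \<in> kids A \<Longrightarrow> A' \<in> level (Suc d)"
  by auto

lemma new_bag_nm: "A \<in> level d \<Longrightarrow> new_bag (nm d A) = bag A"
  unfolding new_bag_def using nm_inj by blast

definition lev :: "'t \<Rightarrow> nat" where "lev t = (THE d. \<exists>A\<in>level d. t = nm d A)"

lemma lev_nm: "A \<in> level d \<Longrightarrow> lev (nm d A) = d"
  unfolding lev_def using nm_inj by (intro the_equality) blast+

lemma new_tree_facts:
  shows new_rooted: "rooted_tree new_tree (nm 0 V)"
    and new_length: "pre_digraph.awalk (with_proj new_tree) (nm 0 V) p t \<Longrightarrow> length p = lev t"
proof -
  \<comment> \<open>All levels beyond \<open>2 * card V\<close> are empty, so a finite union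
    suffices.\<close>
  have "pverts new_tree = (\<Union>d\<in>{..2 * card V}. nm d ` level d)"
    using level_depth(2) by (auto simp: new_tree_def)
  then have 1: "finite (pverts new_tree)" using finite_level by simp
  have 2: "parcs new_tree \<subseteq> pverts new_tree \<times> pverts new_tree"
    using level_Suc_kids by (auto simp: new_tree_def simp del: level.simps) blast
  have 3: "nm 0 V \<in> pverts new_tree" unfolding verts_new_tree by (metis level.simps(1) singletonI)
  have 4: "lev (nm 0 V) = 0" by (simp add: lev_nm)
  have 5: "lev b = Suc (lev a)" if "(a, b) \<in> parcs new_tree" for a b
    using that level_Suc_kids lev_nm unfolding arcs_new_tree by metis
  have 6: "a = a'" if ab: "(a, b) \<in> parcs new_tree" "(a', b) \<in> parcs new_tree" for a a' b
  proof -
    obtain d A B where A: "a = nm d A" "b = nm (Suc d) B" "A \<in> level d" "B \<in> kids A"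
      using ab(1) unfolding arcs_new_tree by blast
    obtain d' A' B' where A': "a' = nm d' A'" "b = nm (Suc d') B'" "A' \<in> level d'" "B' \<in> kids A'"
      using ab(2) unfolding arcs_new_tree by blast
    have eq: "d = d'" "B = B'"
      using nm_inj[of B "Suc d" B' "Suc d'"] A A' level_Suc_kids by auto
    obtain v where "v \<in> B" using kids_nonempty A by blast
    then have "A = A'" using level_disjoint[of A d A' v] A A' eq kids_subset by blast
    then show ?thesis using A A' eq by blast
  qed
  have 7: "\<exists>a. (a, t) \<in> parcs new_tree" if t: "t \<in> pverts new_tree" "t \<noteq> nm 0 V" for t
  proof -
    obtain d A where A: "t = nm d A" "A \<in> level d" using t(1) verts_new_tree by blast
    then obtain d' where "d = Suc d'" using t(2) by (cases d) auto
    then obtain B where "B \<in> level d'" "A \<in> kids B" using A by auto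
    then show ?thesis using A \<open>d = Suc d'\<close> unfolding arcs_new_tree by blast
  qed
  show "rooted_tree new_tree (nm 0 V)" by (rule rooted_treeI(1)[where lev = lev, OF 1 2 3 4 5 6 7])
  show "length p = lev t" if "pre_digraph.awalk (with_proj new_tree) (nm 0 V) p t"
    by (rule rooted_treeI(2)[where lev = lev, OF 1 2 3 4 5 6 7 that])
qed

lemma wf_new: "pair_wf_digraph new_tree"
  using new_rooted by (simp add: rooted_tree_def pair_fin_digraph_def)

lemma new_connected:
  assumes "v \<in> V"
  shows "Digraph_Component.connected (with_proj new_tree \<restriction> {t \<in> pverts new_tree. v \<in> new_bag t})"
    (is "Digraph_Component.connected (_ \<restriction> ?S)")
proof -
  obtain h H where H: "H \<in> level h" "v \<in> H" "v \<in> sel H" using home_exists assms by blast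
  \<comment> \<open>Climbing to the parent keeps \<open>v\<close> in the bag until the home is met;
    at the root \<open>N V = {}\<close> leaves no other case than the home.\<close>
  have path: "(nm d A, nm h H) \<in> (adj new_tree ?S)\<^sup>*" if "A \<in> level d" "v \<in> bag A" for d A
    using that
  proof (induction d arbitrary: A)
    case 0
    then have "v \<in> A" "v \<in> sel A" by (auto simp: bag_def)
    then have "h = 0" "H = A" using home_unique[OF H 0(1)] by auto
    then show ?case by simp
  next
    case (Suc d)
    show ?case
    proof (cases "v \<in> A \<and> v \<in> sel A")
      case True
      then have "h = Suc d" "H = A" using home_unique[OF H Suc.prems(1)] by auto
      then show ?thesis by simp
    next
      case False
      then have "v \<in> N A" using Suc.prems(2) by (auto simp: bag_def)
      obtain B where B: "B \<in> level d" "A \<in> kids B" using Suc.prems(1) by auto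
      then have "v \<in> bag B" using N_kid[OF B(2)] \<open>v \<in> N A\<close> by (auto simp: bag_def)
      have "nm d B \<in> ?S" "nm (Suc d) A \<in> ?S"
        using B(1) Suc.prems \<open>v \<in> bag B\<close> new_bag_nm by (auto simp: verts_new_tree simp del: level.simps)
      moreover have "(nm d B, nm (Suc d) A) \<in> parcs new_tree" using B arcs_new_tree by blast
      ultimately have "(nm (Suc d) A, nm d B) \<in> adj new_tree ?S" unfolding adj_def by blast
      then show ?thesis using Suc.IH[OF B(1) \<open>v \<in> bag B\<close>] by (rule converse_rtrancl_into_rtrancl)
    qed
  qed
  have "v \<in> bag H" using H by (simp add: bag_def)
  then have "nm h H \<in> ?S" using H(1) new_bag_nm verts_new_tree by blast
  moreover have home: "(s, nm h H) \<in> (adj new_tree ?S)\<^sup>*" if s: "s \<in> ?S" for s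
  proof -
    obtain d A where A: "s = nm d A" "A \<in> level d" using s verts_new_tree by blast
    then show ?thesis using path[OF A(2)] s new_bag_nm[OF A(2)] by simp
  qed
  ultimately show ?thesis
    unfolding connected_induced_iff
  proof (intro conjI ballI)
    fix s s' assume "s \<in> ?S" "s' \<in> ?S"
    then show "(s, s') \<in> (adj new_tree ?S)\<^sup>*"
      using home[of s] sym_adj[OF home[of s']] by (rule_tac rtrancl_trans)
  qed blast
qed

lemma new_decomposition: "rooted_tree_decomposition G new_tree (nm 0 V) new_bag"
  unfolding rooted_tree_decomposition_def
proof (intro conjI ballI)
  show "rooted_tree new_tree (nm 0 V)" by (rule new_rooted)
  show "new_bag t \<subseteq> V" if "t \<in> pverts new_tree" for t
    using that bag_subset new_bag_nm verts_new_tree by metis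
  show "\<exists>t\<in>pverts new_tree. v \<in> new_bag t" if v: "v \<in> V" for v
  proof -
    obtain h H where H: "H \<in> level h" "v \<in> H" "v \<in> sel H" using home_exists v by blast
    then have "v \<in> new_bag (nm h H)" "nm h H \<in> pverts new_tree"
      using new_bag_nm[OF H(1)] verts_new_tree by (auto simp: bag_def)
    then show ?thesis by blast
  qed
  show "case e of (u, v) \<Rightarrow> \<exists>t\<in>pverts new_tree. u \<in> new_bag t \<and> v \<in> new_bag t" if e: "e \<in> parcs G" for e
  proof -
    obtain u v where uv: "e = (u, v)" by (cases e)
    then obtain d A where A: "A \<in> level d" "u \<in> bag A" "v \<in> bag A" using arc_covered e by blast
    then have "u \<in> new_bag (nm d A)" "v \<in> new_bag (nm d A)" "nm d A \<in> pverts new_tree"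
      using new_bag_nm[OF A(1)] verts_new_tree by auto
    then show ?thesis using uv by blast
  qed
  show "Digraph_Component.connected (with_proj new_tree \<restriction> {t \<in> pverts new_tree. v \<in> new_bag t})"
    if "v \<in> V" for v using new_connected that .
qed

text \<open>The part \<open>A \<inter> sel A\<close> misses the parent's bag, because
  \<open>A\<close> avoids both \<open>sel B\<close> and \<open>N B\<close>; the part
  \<open>N A\<close> lies in it by \<open>N_kid\<close>. At the root both sides are empty.\<close>

lemma adhesion_nm:
  assumes A: "A \<in> level d"
  shows "adhesion new_tree new_bag (nm d A) = N A"
proof (cases d)
  case 0
  have "(p, nm d A) \<notin> parcs new_tree" for p
    using nm_inj[OF A] level_Suc_kids 0 unfolding arcs_new_tree by blast
  then show ?thesis using 0 A by (auto simp: adhesion_def)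
next
  case (Suc d')
  then obtain B where B: "B \<in> level d'" "A \<in> kids B" using A by auto
  have "{p. (p, nm d A) \<in> parcs new_tree} = {nm d' B}"
  proof safe
    fix p assume "(p, nm d A) \<in> parcs new_tree"
    then obtain e A' B' where p: "p = nm e B'" "nm d A = nm (Suc e) A'" "B' \<in> level e" "A' \<in> kids B'"
      unfolding arcs_new_tree by blast
    then have e: "d = Suc e" "A = A'" using nm_inj[OF A] level_Suc_kids by blast+
    obtain v where "v \<in> A" using kids_nonempty[OF B(2)] by blast
    then have "v \<in> B" "v \<in> B'" using kids_subset B p e by blast+
    then have "B = B'" using level_disjoint B(1) p(3) e(1) Suc by blast
    then show "p = nm d' B" using p e Suc by blast
  next
    show "(nm d' B, nm d A) \<in> parcs new_tree" using B Suc unfolding arcs_new_tree by blast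
  qed
  moreover have "bag A \<inter> bag B = N A"
    using N_kid[OF B(2)] kids_subset[OF B(2)] N_disjoint[of B] unfolding bag_def by blast
  ultimately show ?thesis using new_bag_nm[OF A] new_bag_nm[OF B(1)] by (simp add: adhesion_def)
qed

text \<open>The invariant confines all bags below the node to \<open>A \<union> N A\<close>.\<close>

lemma reachable_nm:
  assumes "(nm d A, s) \<in> (parcs new_tree)\<^sup>*" "A \<in> level d"
  shows "\<exists>d' A'. s = nm d' A' \<and> A' \<in> level d' \<and> A' \<subseteq> A \<and> N A' \<subseteq> A \<union> N A"
  using assms
proof (induction rule: rtrancl_induct)
  case base
  then show ?case by blast
next
  case (step y z)
  then obtain d1 A1 where y: "y = nm d1 A1" "A1 \<in> level d1" "A1 \<subseteq> A" "N A1 \<subseteq> A \<union> N A" by blast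
  obtain d2 A2 A3 where z: "y = nm d2 A2" "z = nm (Suc d2) A3" "A2 \<in> level d2" "A3 \<in> kids A2"
    using step(2) unfolding arcs_new_tree by blast
  have "A1 = A2" using nm_inj y z by blast
  then have "A3 \<subseteq> A" "N A3 \<subseteq> A \<union> N A"
    using y kids_subset[OF z(4)] N_kid[OF z(4)] by blast+
  then show ?case using z level_Suc_kids by blast
qed

text \<open>Every ancestor set of \<open>H\<close> contains \<open>v\<close>, and by disjointness
  the one at depth \<open>d\<close> is \<open>A\<close>.\<close>

lemma descendant_reachable:
  "H \<in> level (d + e) \<Longrightarrow> v \<in> H \<Longrightarrow> A \<in> level d \<Longrightarrow> v \<in> A \<Longrightarrow> (nm d A, nm (d + e) H) \<in> (parcs new_tree)\<^sup>*"
proof (induction e arbitrary: H)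
  case 0
  then have "H = A" using level_disjoint by fastforce
  then show ?case by simp
next
  case (Suc e)
  then obtain B where B: "B \<in> level (d + e)" "H \<in> kids B" by auto
  then have "v \<in> B" using kids_subset Suc.prems by blast
  then have "(nm d A, nm (d + e) B) \<in> (parcs new_tree)\<^sup>*" using Suc B by blast
  moreover have "(nm (d + e) B, nm (d + Suc e) H) \<in> parcs new_tree"
    using B unfolding arcs_new_tree by auto
  ultimately show ?case by (rule rtrancl_into_rtrancl)
qed

text \<open>Bags below the node stay in \<open>A \<union> N A\<close>, and removing the adhesion
  removes \<open>N A\<close>. Conversely, a vertex of \<open>A\<close> has its home at depth at
  least \<open>d\<close> and hence below the node.\<close>

lemma proper_verts_nm:
  assumes A: "A \<in> level d"
  shows "proper_verts new_tree new_bag (nm d A) = A"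
proof -
  have nV: "nm d A \<in> pverts new_tree" using A verts_new_tree by blast
  have "subtree_verts new_tree new_bag (nm d A) \<subseteq> A \<union> N A"
  proof
    fix v assume "v \<in> subtree_verts new_tree new_bag (nm d A)"
    then obtain s where s: "(nm d A, s) \<in> (parcs new_tree)\<^sup>*" "v \<in> new_bag s"
      unfolding subtree_verts_def with_proj_reachable[OF wf_new] by blast
    obtain d' A' where "s = nm d' A'" "A' \<in> level d'" "A' \<subseteq> A" "N A' \<subseteq> A \<union> N A"
      using reachable_nm[OF s(1) A] by blast
    then show "v \<in> A \<union> N A" using s(2) new_bag_nm unfolding bag_def by blast
  qed
  moreover have "A \<subseteq> subtree_verts new_tree new_bag (nm d A)"
  proof
    fix v assume v: "v \<in> A"
    then obtain h H where H: "H \<in> level h" "v \<in> H" "v \<in> sel H"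
      using home_exists level_subset[OF A] by blast
    then have "d \<le> h" using home_deepest A v by blast
    then have "(nm d A, nm h H) \<in> (parcs new_tree)\<^sup>*"
      using descendant_reachable[of H d "h - d" v A] H A v by simp
    moreover have "v \<in> new_bag (nm h H)" using new_bag_nm[OF H(1)] H by (simp add: bag_def)
    ultimately show "v \<in> subtree_verts new_tree new_bag (nm d A)"
      unfolding subtree_verts_def with_proj_reachable[OF wf_new] using nV by blast
  qed
  ultimately show ?thesis
    unfolding proper_verts_def adhesion_nm[OF A] using N_disjoint[of A] by blast
qed

text \<open>Once \<alpha> and \<sigma> are rewritten, the condition on neighbourhoods is an
  identity. Below the root the sets are components, so only the root needs connectedness of the
  graph.\<close>

lemma compact_nm:
  assumes "A \<in> level d" "d = 0 \<Longrightarrow> Digraph_Component.connected (with_proj G)"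
  shows "compact_at G new_tree new_bag (nm d A)"
  unfolding compact_at_def proper_verts_nm[OF assms(1)] adhesion_nm[OF assms(1)]
proof (intro impI conjI refl)
  show "Digraph_Component.connected (with_proj G \<restriction> A)"
  proof (cases d)
    case 0
    then show ?thesis using assms connected_iff[OF wf_G] by simp
  next
    case (Suc d')
    then show ?thesis using assms level_connected by blast
  qed
qed

lemma new_compact:
  assumes "Digraph_Component.connected (with_proj G)"
  shows "compact_decomposition G new_tree new_bag"
  unfolding compact_decomposition_def
proof
  fix t assume "t \<in> pverts new_tree"
  then obtain d A where "t = nm d A" "A \<in> level d" using verts_new_tree by blast
  then show "compact_at G new_tree new_bag t" using compact_nm assms by blast
qed

lemma new_compact_below: "compact_below_root G new_tree (nm 0 V) new_bag"
  unfolding compact_below_root_def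
proof
  fix t assume t: "t \<in> pverts new_tree - {nm 0 V}"
  then obtain d A where A: "t = nm d A" "A \<in> level d" using verts_new_tree by blast
  then have "d \<noteq> 0" using t by (cases d) auto
  then show "compact_at G new_tree new_bag t" using A compact_nm by blast
qed

lemma new_adhesions: "adhesions_le new_tree new_bag (4 * K)"
  unfolding adhesions_le_def
proof
  fix e assume "e \<in> parcs new_tree"
  then obtain d A A' where e: "e = (nm d A, nm (Suc d) A')" "A \<in> level d" "A' \<in> kids A"
    by (cases e) (auto simp: arcs_new_tree)
  then have A': "A' \<in> level (Suc d)" using level_Suc_kids by blast
  have "bag A' \<inter> bag A \<subseteq> N A'"
    using kids_subset[OF e(3)] N_disjoint[of A] unfolding bag_def by blast
  then have "card (bag A' \<inter> bag A) \<le> card (N A')"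
    using fin_V N_subset by (meson card_mono finite_subset)
  then show "case e of (p, t) \<Rightarrow> card (new_bag t \<inter> new_bag p) \<le> 4 * K"
    using level_good(1)[OF A'] e new_bag_nm[OF A'] new_bag_nm[OF e(2)] by simp
qed

text \<open>Intersecting a bag with a side of the cut adds at most the vertices of
  \<open>N A\<close> to what the selected bag contributes.\<close>

lemma new_unbreakable:
  assumes sel: "\<And>A. A \<subseteq> V \<Longrightarrow> card (N A) \<le> 4 * K \<Longrightarrow> edge_unbreakable G q s (sel A)"
    and t: "t \<in> pverts new_tree"
  shows "edge_unbreakable G (q + 4 * K) s (new_bag t)"
proof -
  obtain d A where A: "t = nm d A" "A \<in> level d" using t verts_new_tree by blast
  have N: "card (N A) \<le> 4 * K" using level_good A by blast
  have A_sel: "edge_unbreakable G q s (sel A)" using sel level_subset A N by blast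
  have card_bag: "card (X \<inter> bag A) \<le> q + 4 * K" if X: "card (X \<inter> sel A) \<le> q" "X \<subseteq> V" for X
  proof -
    have "card (X \<inter> bag A) \<le> card ((X \<inter> sel A) \<union> N A)"
      using fin_V X(2) N_subset by (intro card_mono) (auto simp: bag_def intro: finite_subset)
    also have "\<dots> \<le> card (X \<inter> sel A) + card (N A)" by (rule card_Un_le)
    finally show ?thesis using X(1) N by linarith
  qed
  show ?thesis
    unfolding edge_unbreakable_def A(1) new_bag_nm[OF A(2)]
  proof (intro allI impI)
    fix X Y assume XY: "edge_cut G X Y \<and> cut_order G X Y \<le> s"
    then have "X \<subseteq> V" "Y \<subseteq> V" by (auto simp: edge_cut_def)
    moreover have "card (X \<inter> sel A) \<le> q \<or> card (Y \<inter> sel A) \<le> q"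
      using A_sel XY unfolding edge_unbreakable_def by blast
    ultimately show "card (X \<inter> bag A) \<le> q + 4 * K \<or> card (Y \<inter> bag A) \<le> q + 4 * K"
      using card_bag by blast
  qed
qed

lemma new_depth: "int (tree_depth new_tree (nm 0 V)) \<le> 2 * \<lceil>log 2 (real (card V))\<rceil>"
proof -
  let ?S = "{length p |p l. l \<in> leaves new_tree \<and> pre_digraph.awalk (with_proj new_tree) (nm 0 V) p l}"
  have bound: "int n \<le> 2 * \<lceil>log 2 (real (card V))\<rceil>" if n: "n \<in> ?S" for n
  proof -
    obtain l where l: "l \<in> leaves new_tree" "n = lev l" using n new_length by blast
    then obtain d A where A: "l = nm d A" "A \<in> level d" using verts_new_tree by (auto simp: leaves_def)
    then show ?thesis using level_depth(1) l lev_nm by metis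
  qed
  have "?S \<subseteq> {..nat (2 * \<lceil>log 2 (real (card V))\<rceil>)}" using bound by fastforce
  then have fin: "finite ?S" by (rule finite_subset) simp
  \<comment> \<open>The maximum over leaves is meaningful only if a leaf is reached; a node of the
    deepest non-empty level is one.\<close>
  define m where "m = (GREATEST d. level d \<noteq> {})"
  have "level m \<noteq> {}" "\<And>d. level d \<noteq> {} \<Longrightarrow> d \<le> m"
    unfolding m_def using GreatestI_nat[of "\<lambda>d. level d \<noteq> {}" 0 "2 * card V"]
      Greatest_le_nat[of "\<lambda>d. level d \<noteq> {}" _ "2 * card V"] level_depth(2) by auto
  then obtain A where A: "A \<in> level m" "level (Suc m) = {}" by (metis Suc_n_not_le_n ex_in_conv)
  have "(nm m A, c) \<notin> parcs new_tree" for c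
    using nm_inj[OF A(1)] level_Suc_kids A(2) unfolding arcs_new_tree by blast
  then have "nm m A \<in> leaves new_tree" using A(1) verts_new_tree by (auto simp: leaves_def)
  moreover have "\<exists>p. pre_digraph.awalk (with_proj new_tree) (nm 0 V) p (nm m A)"
    using new_rooted A(1) verts_new_tree unfolding rooted_tree_def by blast
  ultimately have "?S \<noteq> {}" by blast
  then have "tree_depth new_tree (nm 0 V) \<in> ?S" unfolding tree_depth_def using Max_in[OF fin] by blast
  then show ?thesis by (rule bound)
qed

end

section \<open>The algorithm\<close>

text \<open>The list \<open>X\<close> that is folded over merely counts rounds. Filtering
  \<open>X\<close> afresh in each round, instead of extending a list, keeps the accumulator
  small.\<close>

definition reach :: "(nat \<times> nat) list \<Rightarrow> nat list \<Rightarrow> nat \<Rightarrow> nat list" where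
  "reach E X v = fold (\<lambda>_ S. filter (\<lambda>y. y \<in> set S \<or> (\<exists>u\<in>set S. (u, y) \<in> set E)) X) X (filter (\<lambda>y. y = v) X)"

text \<open>
  \<^const>\<open>reach\<close> keeps the order of \<open>X\<close>, so the list of a component does not depend on \<open>v\<close> and its head
  serves as representative.
\<close>

definition comps :: "(nat \<times> nat) list \<Rightarrow> nat list \<Rightarrow> nat list list" where
  "comps E X = map (reach E X) (filter (\<lambda>v. hd_or 0 (reach E X v) = v) X)"

text \<open>
  Vertices, arcs, a list whose length is the number \<open>K\<close> of \<^const>\<open>good_bag\<close>, and the input bags.  Numbers
  that are only compared are kept in unary, as lengths of lists.
\<close>

type_synonym context_lists = "nat list \<times> (nat \<times> nat) list \<times> nat list \<times> nat list list"

abbreviation ctx_verts :: "context_lists \<Rightarrow> nat list" where "ctx_verts P \<equiv> fst P"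
abbreviation ctx_arcs :: "context_lists \<Rightarrow> (nat \<times> nat) list" where "ctx_arcs P \<equiv> fst (snd P)"
abbreviation ctx_adh :: "context_lists \<Rightarrow> nat list" where "ctx_adh P \<equiv> fst (snd (snd P))"
abbreviation ctx_bags :: "context_lists \<Rightarrow> nat list list" where "ctx_bags P \<equiv> snd (snd (snd P))"

definition nbrs :: "context_lists \<Rightarrow> nat list \<Rightarrow> nat list" where
  "nbrs P C = filter (\<lambda>v. v \<notin> set C \<and> (\<exists>u\<in>set C. (u, v) \<in> set (ctx_arcs P))) (ctx_verts P)"

definition good_list :: "context_lists \<Rightarrow> nat list \<Rightarrow> nat list \<Rightarrow> bool" where
  "good_list P C B \<longleftrightarrow> (\<forall>A\<in>set (comps (ctx_arcs P) (filter (\<lambda>v. v \<notin> set B) C)).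
     length (nbrs P A) \<le> length (ctx_adh P @ ctx_adh P @ ctx_adh P @ ctx_adh P) \<and>
     (if length (nbrs P C) \<le> length (ctx_adh P @ ctx_adh P @ ctx_adh P)
      then length (A @ A) \<le> length C
      else length (nbrs P A) \<le> length (ctx_adh P @ ctx_adh P @ ctx_adh P)))"

text \<open>On promised inputs some bag is good for every set that the algorithm visits, so the
  default does not arise there.\<close>

definition sel_list :: "context_lists \<Rightarrow> nat list \<Rightarrow> nat list" where
  "sel_list P C = hd_or [] (filter (good_list P C) (ctx_bags P))"

definition kids_list :: "context_lists \<Rightarrow> nat list \<Rightarrow> nat list list" where
  "kids_list P C = comps (ctx_arcs P) (filter (\<lambda>v. v \<notin> set (sel_list P C)) C)"

text \<open>The list \<open>t\<close> stands for a depth in unary.\<close>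

definition level_list :: "context_lists \<Rightarrow> nat list \<Rightarrow> nat list list" where
  "level_list P t = fold (\<lambda>_ cur. concat (map (kids_list P) cur)) t [ctx_verts P]"

text \<open>Used only for their lengths, which are the depths \<open>0, \<dots>, length W\<close>.\<close>

definition suffixes_of :: "nat list \<Rightarrow> nat list list" where
  "suffixes_of W = fold (\<lambda>y ts. (y # hd_or [] ts) # ts) W [[]]"

text \<open>
  A node is named \<open>2\<^sup>d (2 v + 1)\<close>, where \<open>d\<close> is its depth and \<open>v\<close> the first vertex of its set; the
  sets at the same depth are disjoint.  Doubling and \<open>v \<mapsto> 2 v + 1\<close> prepend a bit to the code of a number,
  so no binary arithmetic is needed.
\<close>

definition name_of :: "nat list \<Rightarrow> nat list \<Rightarrow> nat" where
  "name_of t C = fold (\<lambda>_ m. 2 * m) t (2 * hd_or 0 C + 1)"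

text \<open>The doubled vertex list supplies the depths up to twice the number of vertices, which
  are enough by \<open>level_depth\<close>.\<close>

definition node_list :: "context_lists \<Rightarrow> (nat list \<times> nat list) list" where
  "node_list P = concat (map (\<lambda>t. map (\<lambda>C. (t, C)) (level_list P t)) (suffixes_of (ctx_verts P @ ctx_verts P)))"

text \<open>Prepending an arbitrary entry, here 0, is the successor on unary depths.\<close>

definition arcs_of :: "context_lists \<Rightarrow> nat list \<times> nat list \<Rightarrow> (nat \<times> nat) list" where
  "arcs_of P z = map (\<lambda>A. (name_of (fst z) (snd z), name_of (0 # fst z) A)) (kids_list P (snd z))"

definition bag_of :: "context_lists \<Rightarrow> nat list \<times> nat list \<Rightarrow> nat list" where
  "bag_of P z = filter (\<lambda>v. v \<in> set (sel_list P (snd z))) (snd z) @ nbrs P (snd z)"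

text \<open>Nested exactly as in \<open>decomposition_codes\<close>, so that \<open>code\<close> of
  such a value is already a code of the decomposition.\<close>

type_synonym tree_lists = "(nat list \<times> (nat \<times> nat) list) \<times> nat \<times> (nat \<times> nat list) list"

definition output_of :: "context_lists \<Rightarrow> tree_lists" where
  "output_of P = ((map (\<lambda>z. name_of (fst z) (snd z)) (node_list P), concat (map (arcs_of P) (node_list P))),
     name_of [] (ctx_verts P), map (\<lambda>z. (name_of (fst z) (snd z), bag_of P z)) (node_list P))"

text \<open>Node names are distinct in a valid list, so the concatenation has one member at a listed
  node.\<close>

definition lookup_bag :: "(nat \<times> nat list) list \<Rightarrow> nat \<Rightarrow> nat list" where
  "lookup_bag bs t = concat (map snd (filter (\<lambda>b. fst b = t) bs))"

definition adhesion_lists :: "tree_lists \<Rightarrow> nat list list" where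
  "adhesion_lists D = map (\<lambda>e. filter (\<lambda>v. v \<in> set (lookup_bag (snd (snd D)) (fst e)))
     (lookup_bag (snd (snd D)) (snd e))) (snd (fst D))"

text \<open>Applied to the adhesions, the result is \<open>K\<close> in unary; the default covers a
  tree without arcs.\<close>

definition longest :: "nat list list \<Rightarrow> nat list" where
  "longest xss = hd_or [] (filter (\<lambda>xs. \<forall>ys\<in>set xss. length ys \<le> length xs) xss)"

type_synonym input_lists = "(nat list \<times> (nat \<times> nat) list) \<times> nat \<times> nat \<times> tree_lists"

definition context_of :: "input_lists \<Rightarrow> context_lists" where
  "context_of I = (fst (fst I), snd (fst I), longest (adhesion_lists (snd (snd (snd I)))),
     map snd (snd (snd (snd (snd (snd I))))))"

section \<open>Running time of the algorithm\<close>

lemmas ptime_lists = pt ptime_map ptime_filter ptime_Ball ptime_Bex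

text \<open>Every iterate is a sublist of \<open>X\<close> in the order of \<open>X\<close>: this
  bounds its size and determines the list by its set.\<close>

lemma reach_iterate: "\<exists>Q. fold (\<lambda>_ S. filter (R S) X) t (filter Q0 X) = filter Q X"
proof (induction t rule: rev_induct)
  case (snoc y t)
  then show ?case by auto
qed auto

lemma ptime_reach [pt]:
  assumes "ptime D E" "ptime D X" "ptime D v"
  shows "ptime D (\<lambda>x. reach (E x) (X x) (v x))"
proof (rule ptime_comp3[OF _ assms, where F = reach])
  show "ptime UNIV (\<lambda>z. reach (fst z) (fst (snd z)) (snd (snd z)))"
    unfolding reach_def
  proof (rule ptime_fold[where S = "\<lambda>z. sz (fst (snd z))"])
    fix z :: "(nat \<times> nat) list \<times> nat list \<times> nat" and i
    let ?f = "fold (\<lambda>_ S. filter (\<lambda>y. y \<in> set S \<or> (\<exists>u\<in>set S. (u, y) \<in> set (fst z))) (fst (snd z)))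
      (take i (fst (snd z))) (filter (\<lambda>y. y = snd (snd z)) (fst (snd z)))"
    obtain Q where "?f = filter Q (fst (snd z))"
      using reach_iterate[of "\<lambda>S y. y \<in> set S \<or> (\<exists>u\<in>set S. (u, y) \<in> set (fst z))"] by metis
    then show "sz ?f \<le> sz (fst (snd z))" by (simp add: sz_filter_le)
  next
    show "pbd UNIV (\<lambda>z :: (nat \<times> nat) list \<times> nat list \<times> nat. sz (fst (snd z)))"
      by (intro ptime_sz pt)
  qed (intro ptime_lists)+
qed

lemma ptime_comps [pt]: "ptime D E \<Longrightarrow> ptime D X \<Longrightarrow> ptime D (\<lambda>x. comps (E x) (X x))"
  by (rule ptime_comp2[where F = comps]) (unfold comps_def, (intro ptime_lists ptime_reach)+)

lemma ptime_nbrs [pt]: "ptime D P \<Longrightarrow> ptime D C \<Longrightarrow> ptime D (\<lambda>x. nbrs (P x) (C x))"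
  by (rule ptime_comp2[where F = nbrs]) (unfold nbrs_def, (intro ptime_lists)+)

lemma ptime_good_list [pt]:
  "ptime D P \<Longrightarrow> ptime D C \<Longrightarrow> ptime D B \<Longrightarrow> ptime D (\<lambda>x. good_list (P x) (C x) (B x))"
  by (rule ptime_comp3[where F = good_list])
    (unfold good_list_def, (intro ptime_lists ptime_comps ptime_nbrs)+)

lemma ptime_sel_list [pt]: "ptime D P \<Longrightarrow> ptime D C \<Longrightarrow> ptime D (\<lambda>x. sel_list (P x) (C x))"
  by (rule ptime_comp2[where F = sel_list]) (unfold sel_list_def, (intro ptime_lists ptime_good_list)+)

lemma ptime_kids_list [pt]: "ptime D P \<Longrightarrow> ptime D C \<Longrightarrow> ptime D (\<lambda>x. kids_list (P x) (C x))"
  by (rule ptime_comp2[where F = kids_list])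
    (unfold kids_list_def, (intro ptime_lists ptime_comps ptime_sel_list)+)

lemma level_list_snoc: "level_list P (t @ [y]) = concat (map (kids_list P) (level_list P t))"
  by (simp add: level_list_def)

text \<open>The size bound remains a hypothesis because it rests on the disjointness of the sets in
  a level; \<open>sz_level_list\<close> supplies it on promised inputs.\<close>

lemma ptime_level_list:
  assumes B: "\<And>P t. P \<in> D \<Longrightarrow> sz (level_list P t) \<le> B P" "pbd D B"
  shows "ptime {(P, t). P \<in> D} (\<lambda>z. level_list (fst z) (snd z))"
  unfolding level_list_def
proof (rule ptime_fold[where S = "\<lambda>z. B (fst z)"])
  show "pbd {(P, t :: nat list). P \<in> D} (\<lambda>z. B (fst z))"
  proof (rule pbd_comp[OF B(2)])
    show "pbd {(P, t). P \<in> D} (\<lambda>z. sz (fst z))" by (intro ptime_sz pt)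
  qed auto
  fix z :: "context_lists \<times> nat list" and i
  assume "z \<in> {(P, t). P \<in> D}"
  then show "sz (fold (\<lambda>_ cur. concat (map (kids_list (fst z)) cur)) (take i (snd z)) [ctx_verts (fst z)]) \<le> B (fst z)"
    using B(1)[of "fst z" "take i (snd z)"] by (auto simp: level_list_def)
qed (intro ptime_lists ptime_kids_list)+

lemma suffixes_of_eq: "suffixes_of W = map (\<lambda>i. rev (take i W)) (rev [0..<Suc (length W)])"
proof (induction W rule: rev_induct)
  case (snoc y W)
  have "suffixes_of (W @ [y]) = (y # hd_or [] (suffixes_of W)) # suffixes_of W"
    by (simp add: suffixes_of_def)
  also have "hd_or [] (suffixes_of W) = rev W" unfolding snoc by simp
  finally show ?case unfolding snoc by simp
qed (simp add: suffixes_of_def)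

lemma ptime_suffixes_of [pt]:
  assumes "ptime D W" shows "ptime D (\<lambda>x. suffixes_of (W x))"
proof (rule ptime_comp[OF _ assms, of UNIV])
  have "ptime UNIV (\<lambda>W :: nat list. fold (\<lambda>y ts. (y # hd_or [] ts) # ts) W [[]])"
  proof (rule ptime_fold[where S = "\<lambda>W. (length W + 1) * (sz W + 1) + 1"])
    show "pbd UNIV (\<lambda>W :: nat list. (length W + 1) * (sz W + 1) + 1)"
      by (intro pbd_add pbd_mult pbd_const pbd_sz ptime_length_pbd pt)
    fix W :: "nat list" and i assume i: "i \<le> length W"
    have "fold (\<lambda>y ts. (y # hd_or [] ts) # ts) (take i W) [[]] = suffixes_of (take i W)"
      by (simp add: suffixes_of_def)
    moreover have "sz (suffixes_of (take i W)) \<le> (length W + 1) * (sz W + 1) + 1"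
    proof (rule sz_list_le)
      fix y assume "y \<in> set (suffixes_of (take i W))"
      then obtain j where "y = rev (take j W)" using suffixes_of_eq by (auto simp: take_take)
      then show "sz y \<le> sz W" by (simp add: sz_take_le)
    qed (use i in \<open>simp add: suffixes_of_eq\<close>)
    ultimately show "sz (fold (\<lambda>y ts. (y # hd_or [] ts) # ts) (take i W) [[]]) \<le> (length W + 1) * (sz W + 1) + 1"
      by simp
  qed (intro pt)+
  then show "ptime UNIV suffixes_of" by (simp add: suffixes_of_def[abs_def])
qed auto

lemma fold_double: "fold (\<lambda>_ m. 2 * m) t m = 2 ^ length t * (m :: nat)"
  by (induction t arbitrary: m) auto

text \<open>Although the number grows exponentially in \<open>i\<close>, each doubling adds just one
  bit to its code.\<close>

lemma sz_double_power: "sz (2 ^ i * m :: nat) \<le> sz m + 2 * i"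
proof (induction i)
  case (Suc i)
  then show ?case using sz_double[of "2 ^ i * m"] by (simp add: mult.assoc)
qed simp

lemma ptime_name_of [pt]:
  assumes "ptime D t" "ptime D C"
  shows "ptime D (\<lambda>x. name_of (t x) (C x))"
proof (rule ptime_comp2[OF _ assms, where F = name_of])
  have m: "ptime UNIV (\<lambda>z :: nat list \<times> nat list. 2 * hd_or 0 (snd z) + 1)" by (intro pt)
  show "ptime UNIV (\<lambda>z. name_of (fst z) (snd z))"
    unfolding name_of_def
  proof (rule ptime_fold[where S = "\<lambda>z. sz (2 * hd_or 0 (snd z) + 1) + 2 * length (fst z)"])
    show "pbd UNIV (\<lambda>z :: nat list \<times> nat list. sz (2 * hd_or 0 (snd z) + 1) + 2 * length (fst z))"
      using ptime_sz[OF m] by (intro pbd_add pbd_mult pbd_const ptime_length_pbd pt)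
    fix z :: "nat list \<times> nat list" and i assume "i \<le> length (fst z)"
    then show "sz (fold (\<lambda>_ m. 2 * m) (take i (fst z)) (2 * hd_or 0 (snd z) + 1))
        \<le> sz (2 * hd_or 0 (snd z) + 1) + 2 * length (fst z)"
      unfolding fold_double using sz_double_power[of i "2 * hd_or 0 (snd z) + 1"] by simp
  qed (intro pt)+
qed

lemma ptime_node_list:
  assumes B: "\<And>P t. P \<in> D \<Longrightarrow> sz (level_list P t) \<le> B P" "pbd D B"
  shows "ptime D node_list"
proof -
  have lev: "ptime {(P, t). P \<in> D \<and> t \<in> set (suffixes_of (ctx_verts P @ ctx_verts P))} (\<lambda>z. level_list (fst z) (snd z))"
    by (rule ptime_subset[OF ptime_level_list[OF B]]) auto
  have "ptime D (\<lambda>P. node_list P)"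
    unfolding node_list_def by (intro ptime_lists ptime_suffixes_of lev)
  then show ?thesis by simp
qed

lemma ptime_output_of:
  assumes B: "\<And>P t. P \<in> D \<Longrightarrow> sz (level_list P t) \<le> B P" "pbd D B"
  shows "ptime D output_of"
proof -
  note nodes = ptime_node_list[OF B]
  have "ptime D (\<lambda>P. output_of P)"
    unfolding output_of_def arcs_of_def bag_of_def
    by (intro ptime_lists ptime_name_of ptime_kids_list ptime_sel_list ptime_nbrs nodes)
  then show ?thesis by simp
qed

lemma ptime_context_of: "ptime UNIV context_of"
proof -
  have l: "ptime UNIV (\<lambda>z. lookup_bag (fst z) (snd z))"
    unfolding lookup_bag_def by (intro ptime_lists)
  have a: "ptime UNIV (\<lambda>z. adhesion_lists z)"
    unfolding adhesion_lists_def by (intro ptime_lists ptime_comp2[OF l])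
  have m: "ptime UNIV (\<lambda>z. longest z)"
    unfolding longest_def by (intro ptime_lists)
  have "ptime UNIV (\<lambda>I. context_of I)"
    unfolding context_of_def by (intro ptime_lists ptime_comp[OF m] ptime_comp[OF a] subset_UNIV)
  then show ?thesis by simp
qed

section \<open>Correctness on lists\<close>

lemma fold_const_funpow: "fold (\<lambda>_. f) xs a = (f ^^ length xs) a"
  by (induction xs arbitrary: a) (auto simp: funpow_swap1)

lemma set_reach:
  assumes E: "set E = parcs G" "\<And>u v. (u, v) \<in> parcs G \<Longrightarrow> (v, u) \<in> parcs G" and v: "v \<in> set X"
  shows "set (reach E X v) = (adj G (set X))\<^sup>* `` {v}"
proof -
  define f where "f = (\<lambda>S. filter (\<lambda>y. y \<in> set S \<or> (\<exists>u\<in>set S. (u, y) \<in> set E)) X)"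
  define it where "it i = (f ^^ i) (filter (\<lambda>y. y = v) X)" for i
  let ?R = "(adj G (set X))\<^sup>* `` {v}"
  have reach: "reach E X v = it (length X)"
    by (simp add: reach_def f_def it_def fold_const_funpow)
  have it_Suc: "it (Suc i) = f (it i)" for i by (simp add: it_def)
  have sound: "set (it i) \<subseteq> ?R \<inter> set X" for i
  proof (induction i)
    case (Suc i)
    show ?case
    proof
      fix y assume "y \<in> set (it (Suc i))"
      then have y: "y \<in> set X" "y \<in> set (it i) \<or> (\<exists>u\<in>set (it i). (u, y) \<in> set E)"
        unfolding it_Suc by (auto simp: f_def)
      then show "y \<in> ?R \<inter> set X"
      proof (elim disjE bexE)
        fix u assume u: "u \<in> set (it i)" "(u, y) \<in> set E"
        then have "(u, y) \<in> adj G (set X)" using Suc y E by (auto simp: adj_def)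
        moreover have "(v, u) \<in> (adj G (set X))\<^sup>*" using u Suc by blast
        ultimately show ?thesis using y by (auto intro: rtrancl_into_rtrancl)
      qed (use Suc in blast)
    qed
  qed (use v in \<open>auto simp: it_def\<close>)
  have mono: "set (it i) \<subseteq> set (it (Suc i))" for i
    using sound[of i] unfolding it_Suc by (auto simp: f_def)
  have v_in: "v \<in> set (it i)" for i
  proof (induction i)
    case (Suc i) then show ?case using mono by blast
  qed (use v in \<open>simp add: it_def\<close>)
  \<comment> \<open>each round that is not the last one adds a vertex, so \<open>length X\<close> rounds suffice\<close>
  have grow: "set (it (Suc i)) = set (it i) \<or> Suc i \<le> card (set (it i))" for i
  proof (induction i)
    case 0
    have "card (set (it 0)) \<noteq> 0" using v_in[of 0] by auto
    then show ?case by linarith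
  next
    case (Suc i)
    show ?case
    proof (cases "set (it (Suc i)) = set (it i)")
      case True
      \<comment> \<open>The round \<open>f\<close> uses only the set of its argument, so a set that
        has become stable stays so.\<close>
      then have "f (it (Suc i)) = f (it i)" unfolding f_def by simp
      then show ?thesis using True by (simp add: it_Suc)
    next
      case False
      then have "card (set (it i)) < card (set (it (Suc i)))"
        using mono[of i] by (intro psubset_card_mono) auto
      then show ?thesis using Suc False by linarith
    qed
  qed
  let ?S = "it (length X)"
  have "card (set ?S) \<le> card (set X)" using sound by (intro card_mono) auto
  then have "card (set ?S) \<le> length X" using card_length order_trans by blast
  \<comment> \<open>The other alternative in \<open>grow\<close> would require more than
    \<open>length X\<close> vertices.\<close>
  then have closed: "set (f ?S) = set ?S" using grow[of "length X"] it_Suc by simp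
  have "y \<in> set ?S" if "(v, y) \<in> (adj G (set X))\<^sup>*" for y
    using that
  proof (induction rule: rtrancl_induct)
    case (step y z)
    then have "z \<in> set X" "(y, z) \<in> set E" using E by (auto simp: adj_def)
    then have "z \<in> set (f ?S)" using step.IH unfolding f_def by auto
    then show ?case using closed by simp
  qed (rule v_in)
  then show ?thesis unfolding reach using sound[of "length X"] by blast
qed

lemma reach_eq_filter:
  assumes "set E = parcs G" "\<And>u v. (u, v) \<in> parcs G \<Longrightarrow> (v, u) \<in> parcs G" "v \<in> set X"
  shows "reach E X v = filter (\<lambda>y. y \<in> (adj G (set X))\<^sup>* `` {v}) X"
proof -
  obtain Q where Q: "reach E X v = filter Q X"
    using reach_iterate[of "\<lambda>S y. y \<in> set S \<or> (\<exists>u\<in>set S. (u, y) \<in> set E)"] unfolding reach_def by metis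
  have "Q y \<longleftrightarrow> y \<in> (adj G (set X))\<^sup>* `` {v}" if "y \<in> set X" for y
    using set_reach[OF assms] that unfolding Q by auto
  then show ?thesis unfolding Q by (rule filter_cong[OF refl])
qed

lemma hd_or_in: "xs \<noteq> [] \<Longrightarrow> hd_or d xs \<in> set xs"
  by (simp add: hd_or_def)

lemma
  assumes E: "set E = parcs G" "\<And>u v. (u, v) \<in> parcs G \<Longrightarrow> (v, u) \<in> parcs G"
  shows set_comps: "set (comps E X) = (\<lambda>A. filter (\<lambda>y. y \<in> A) X) ` components G (set X)"
    and distinct_comps: "distinct X \<Longrightarrow> distinct (comps E X)"
proof -
  show "set (comps E X) = (\<lambda>A. filter (\<lambda>y. y \<in> A) X) ` components G (set X)"
  proof (intro equalityI subsetI)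
    fix c assume "c \<in> set (comps E X)"
    then obtain v where v: "v \<in> set X" "c = reach E X v" by (auto simp: comps_def)
    then have "c = filter (\<lambda>y. y \<in> (adj G (set X))\<^sup>* `` {v}) X" using reach_eq_filter[OF E v(1)] by simp
    moreover have "(adj G (set X))\<^sup>* `` {v} \<in> components G (set X)" using v(1) by (auto simp: components_def)
    ultimately show "c \<in> (\<lambda>A. filter (\<lambda>y. y \<in> A) X) ` components G (set X)" by (rule image_eqI)
  next
    fix c assume "c \<in> (\<lambda>A. filter (\<lambda>y. y \<in> A) X) ` components G (set X)"
    then obtain A where A: "A \<in> components G (set X)" "c = filter (\<lambda>y. y \<in> A) X" by blast
    have "set c = A" using A components_subset[OF A(1)] by auto
    then have "c \<noteq> []" using components_nonempty[OF A(1)] by auto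
    define w where "w = hd_or 0 c"
    have w: "w \<in> set X" "w \<in> A"
      using hd_or_in[OF \<open>c \<noteq> []\<close>, of 0] \<open>set c = A\<close> A(2) unfolding w_def by auto
    have "reach E X w = c"
      using reach_eq_filter[OF E w(1)] component_eq[OF A(1) w(2)] A(2) by simp
    moreover from this have "w \<in> set (filter (\<lambda>v. hd_or 0 (reach E X v) = v) X)" using w(1) by (simp add: w_def)
    ultimately show "c \<in> set (comps E X)" unfolding comps_def by force
  qed
  show "distinct (comps E X)" if "distinct X"
    unfolding comps_def distinct_map
  proof (intro conjI inj_onI)
    show "distinct (filter (\<lambda>v. hd_or 0 (reach E X v) = v) X)" using that by simp
    fix v w assume "v \<in> set (filter (\<lambda>v. hd_or 0 (reach E X v) = v) X)"
      "w \<in> set (filter (\<lambda>v. hd_or 0 (reach E X v) = v) X)"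
    then have "hd_or 0 (reach E X v) = v" "hd_or 0 (reach E X w) = w" by auto
    moreover assume "reach E X v = reach E X w"
    ultimately show "v = w" by metis
  qed
qed

lemma distinct_concat_map:
  assumes "distinct xs" "\<And>x. x \<in> set xs \<Longrightarrow> distinct (f x)"
    "\<And>x y z. x \<in> set xs \<Longrightarrow> y \<in> set xs \<Longrightarrow> z \<in> set (f x) \<Longrightarrow> z \<in> set (f y) \<Longrightarrow> x = y"
  shows "distinct (concat (map f xs))"
  using assms
proof (induction xs)
  case (Cons x xs)
  have "distinct (concat (map f xs))"
    by (rule Cons.IH) (use Cons.prems(1) in simp, rule Cons.prems(2), simp, rule Cons.prems(3), auto)
  moreover have "set (f x) \<inter> set (concat (map f xs)) = {}"
    using Cons.prems(1,3) by fastforce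
  ultimately show ?case using Cons.prems(1,2) by simp
qed simp

lemma odd_part_unique:
  "2 ^ a * (2 * x + 1) = 2 ^ b * (2 * y + (1::nat)) \<Longrightarrow> a = b \<and> x = y"
proof (induction a arbitrary: b)
  case 0
  then have "odd (2 ^ b * (2 * y + 1))" by (metis dvd_triv_left even_add mult_1 odd_one power_0)
  then have "b = 0" by (cases b) auto
  then show ?case using 0 by simp
next
  case (Suc a)
  then have "even (2 ^ b * (2 * y + 1))" by (metis dvd_mult2 dvd_triv_left power_Suc)
  then obtain b' where b': "b = Suc b'" by (cases b) auto
  then have "2 ^ a * (2 * x + 1) = 2 ^ b' * (2 * y + 1)" using Suc.prems by (simp add: mult.assoc)
  then show ?case using Suc.IH[of b'] b' by simp
qed

text \<open>The tree decomposition enters only through the existence of good bags; its arcs and its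
  root do not appear any more.\<close>

locale algorithm_input =
  fixes G :: "nat pair_pre_digraph" and P :: context_lists
  assumes graph: "pair_graph G"
    and verts: "distinct (ctx_verts P)" "set (ctx_verts P) = pverts G"
    and arcs: "set (ctx_arcs P) = parcs G"
    and bags: "C \<subseteq> pverts G \<Longrightarrow> card (neighbourhood G C) \<le> 4 * length (ctx_adh P) \<Longrightarrow>
      \<exists>B\<in>set (ctx_bags P). good_bag G (length (ctx_adh P)) C (set B)"
begin

text \<open>The canonical list of a vertex set. The sets at all nodes are represented this way, so
  equality of their lists is equality of sets.\<close>

definition cl :: "nat set \<Rightarrow> nat list" where "cl A = filter (\<lambda>v. v \<in> A) (ctx_verts P)"

lemma set_cl [simp]: "A \<subseteq> pverts G \<Longrightarrow> set (cl A) = A"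
  using verts(2) by (auto simp: cl_def)

lemma distinct_cl [simp]: "distinct (cl A)"
  using verts(1) by (simp add: cl_def)

lemma length_cl: "A \<subseteq> pverts G \<Longrightarrow> length (cl A) = card A"
  by (metis distinct_card distinct_cl set_cl)

lemma cl_verts: "cl (pverts G) = ctx_verts P"
  using verts(2) by (auto simp: cl_def filter_id_conv)

lemma filter_cl: "filter Q (cl A) = cl {v \<in> A. Q v}"
  by (auto simp: cl_def intro: filter_cong)

lemmas arc_sym = pair_graph_arc_sym[OF graph]

lemma set_comps_cl:
  assumes "X \<subseteq> pverts G"
  shows "set (comps (ctx_arcs P) (cl X)) = cl ` components G X"
proof -
  have eq: "filter (\<lambda>y. y \<in> A) (cl X) = cl A" if "A \<in> components G X" for A
  proof -
    have "{v \<in> X. v \<in> A} = A" using components_subset[OF that] by blast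
    then show ?thesis by (simp add: filter_cl)
  qed
  have "set (comps (ctx_arcs P) (cl X)) = (\<lambda>A. filter (\<lambda>y. y \<in> A) (cl X)) ` components G (set (cl X))"
    by (rule set_comps[OF arcs arc_sym])
  also have "\<dots> = cl ` components G X"
    unfolding set_cl[OF assms] by (rule image_cong[OF refl]) (rule eq)
  finally show ?thesis .
qed

lemma distinct_comps_cl: "distinct (comps (ctx_arcs P) (cl X))"
  by (rule distinct_comps[OF arcs arc_sym distinct_cl])

lemma set_nbrs: "A \<subseteq> pverts G \<Longrightarrow> set (nbrs P (cl A)) = neighbourhood G A"
  using verts(2) arcs by (auto simp: nbrs_def neighbourhood_def)

lemma distinct_nbrs: "distinct (nbrs P C)"
  using verts(1) by (simp add: nbrs_def)

lemma length_nbrs: "A \<subseteq> pverts G \<Longrightarrow> length (nbrs P (cl A)) = card (neighbourhood G A)"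
  using set_nbrs distinct_nbrs by (metis distinct_card)

lemma good_list_iff:
  assumes C: "C \<subseteq> pverts G"
  shows "good_list P (cl C) B \<longleftrightarrow> good_bag G (length (ctx_adh P)) C (set B)"
proof -
  have "filter (\<lambda>v. v \<notin> set B) (cl C) = cl (C - set B)"
    unfolding filter_cl by (rule arg_cong[of _ _ cl]) blast
  moreover have "set (comps (ctx_arcs P) (cl (C - set B))) = cl ` components G (C - set B)"
    using C by (intro set_comps_cl) auto
  moreover have "A \<subseteq> pverts G" if "A \<in> components G (C - set B)" for A
    using components_subset[OF that] C by blast
  ultimately show ?thesis
    unfolding good_list_def good_bag_def
    by (auto simp: length_nbrs[OF C] length_cl[OF C] length_nbrs length_cl)
qed

definition sel :: "nat set \<Rightarrow> nat set" where "sel A = set (sel_list P (cl A))"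

definition nm :: "nat \<Rightarrow> nat set \<Rightarrow> nat" where "nm d A = 2 ^ d * (2 * hd_or 0 (cl A) + 1)"

lemma name_of_cl: "name_of t (cl A) = nm (length t) A"
  by (simp only: name_of_def nm_def fold_double)

lemma sel_list_good:
  assumes C: "C \<subseteq> pverts G" "card (neighbourhood G C) \<le> 4 * length (ctx_adh P)"
  shows "sel_list P (cl C) \<in> set (ctx_bags P)" "good_bag G (length (ctx_adh P)) C (sel C)"
proof -
  have "filter (good_list P (cl C)) (ctx_bags P) \<noteq> []"
    using bags[OF C] good_list_iff[OF C(1)] by (auto simp: filter_empty_conv)
  from hd_or_in[OF this, of "[]"]
  have "sel_list P (cl C) \<in> set (filter (good_list P (cl C)) (ctx_bags P))"
    unfolding sel_list_def .
  then show "sel_list P (cl C) \<in> set (ctx_bags P)" "good_bag G (length (ctx_adh P)) C (sel C)"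
    using good_list_iff[OF C(1)] unfolding sel_def by auto
qed

sublocale bag_selection G "length (ctx_adh P)" sel nm
  by (rule bag_selection.intro[OF graph sel_list_good(2)])

text \<open>Stated for positive depths, where sets are non-empty; the root set is empty for the
  empty graph.\<close>

lemma hd_cl:
  assumes "A \<in> level (Suc d)" shows "hd_or 0 (cl A) \<in> A"
proof -
  have "A \<noteq> {}" using assms kids_nonempty by auto
  then have "cl A \<noteq> []" using set_cl[OF level_subset[OF assms]] by auto
  then show ?thesis using hd_or_in[of "cl A" 0] set_cl[OF level_subset[OF assms]] by auto
qed

sublocale named_bag_selection G "length (ctx_adh P)" sel nm
proof
  fix A A' d d' assume A: "A \<in> level d" "A' \<in> level d'" and "nm d A = nm d' A'"
  then have eq: "d = d'" "hd_or 0 (cl A) = hd_or 0 (cl A')"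
    unfolding nm_def using odd_part_unique by blast+
  moreover have "A = A'"
  proof (cases d)
    case 0
    then show ?thesis using A eq by simp
  next
    case (Suc e)
    then show ?thesis using level_disjoint A eq hd_cl by metis
  qed
  ultimately show "d = d' \<and> A = A'" by blast
qed

lemma cl_inj: "A \<subseteq> pverts G \<Longrightarrow> B \<subseteq> pverts G \<Longrightarrow> cl A = cl B \<Longrightarrow> A = B"
  by (metis set_cl)

lemma
  assumes "A \<subseteq> pverts G"
  shows set_kids_list: "set (kids_list P (cl A)) = cl ` kids A"
    and distinct_kids_list: "distinct (kids_list P (cl A))"
proof -
  have "filter (\<lambda>v. v \<notin> set (sel_list P (cl A))) (cl A) = cl (A - sel A)"
    unfolding filter_cl sel_def by (rule arg_cong[of _ _ cl]) blast
  then have "kids_list P (cl A) = comps (ctx_arcs P) (cl (A - sel A))" by (simp add: kids_list_def)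
  then show "set (kids_list P (cl A)) = cl ` kids A" "distinct (kids_list P (cl A))"
    using set_comps_cl[of "A - sel A"] distinct_comps_cl assms by (auto simp: kids_def)
qed

lemma level_list_correct: "set (level_list P t) = cl ` level (length t) \<and> distinct (level_list P t)"
proof (induction t rule: rev_induct)
  case Nil
  then show ?case by (simp add: level_list_def cl_verts)
next
  case (snoc y t)
  have 1: "set (level_list P (t @ [y])) = cl ` level (length (t @ [y]))"
    using snoc set_kids_list[OF level_subset] unfolding level_list_snoc by (auto simp: image_UN)
  have "distinct (concat (map (kids_list P) (level_list P t)))"
  proof (rule distinct_concat_map)
    show "distinct (level_list P t)" using snoc by blast
    show "distinct (kids_list P x)" if "x \<in> set (level_list P t)" for x
      using that snoc distinct_kids_list[OF level_subset] by auto
    fix x y z assume *: "x \<in> set (level_list P t)" "y \<in> set (level_list P t)"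
      "z \<in> set (kids_list P x)" "z \<in> set (kids_list P y)"
    obtain A B where A: "x = cl A" "y = cl B" "A \<in> level (length t)" "B \<in> level (length t)"
      using *(1,2) snoc by auto
    obtain Z where "z = cl Z" "Z \<in> kids A"
      using *(3) A(1) set_kids_list[OF level_subset[OF A(3)]] by auto
    moreover obtain Z' where "z = cl Z'" "Z' \<in> kids B"
      using *(4) A(2) set_kids_list[OF level_subset[OF A(4)]] by auto
    ultimately have Z: "z = cl Z" "Z \<in> kids A" "z = cl Z'" "Z' \<in> kids B" by blast+
    have sub: "Z \<subseteq> A" "Z' \<subseteq> B" using kids_subset Z by blast+
    then have "Z = Z'" using Z A level_subset cl_inj by (metis order_trans)
    \<comment> \<open>A child list shared by two parents would put one of its vertices into both
      parent sets, which are disjoint unless equal.\<close>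
    moreover obtain v where "v \<in> Z" using kids_nonempty Z(2) by blast
    ultimately have "A = B" using sub level_disjoint A by blast
    then show "x = y" using A by simp
  qed
  then show ?case using 1 unfolding level_list_snoc by blast
qed

text \<open>Disjoint non-empty sets have different first vertices. The added 1 covers depth 0 of the
  empty graph.\<close>

lemma card_level: "card (level d) \<le> card (pverts G) + 1"
proof (cases d)
  case (Suc e)
  let ?h = "\<lambda>A. hd_or 0 (cl A)"
  have "inj_on ?h (level d)"
    using level_disjoint hd_cl unfolding Suc inj_on_def by metis
  moreover have "?h ` level d \<subseteq> pverts G"
    using hd_cl level_subset unfolding Suc by blast
  ultimately have "card (level d) \<le> card (pverts G)" using card_inj_on_le fin_V by blast
  then show ?thesis by simp
qed simp

text \<open>Disjointness keeps a level from multiplying, so one bound in terms of the vertex list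
  holds for all depths, as \<open>ptime_level_list\<close> demands.\<close>

lemma sz_level_list: "sz (level_list P t) \<le> (length (ctx_verts P) + 1) * (sz (ctx_verts P) + 1) + 1"
proof (rule sz_list_le)
  fix c assume "c \<in> set (level_list P t)"
  then obtain A where "c = cl A" using level_list_correct by auto
  then show "sz c \<le> sz (ctx_verts P)" unfolding cl_def by (simp add: sz_filter_le)
next
  have "length (level_list P t) = card (cl ` level (length t))"
    using level_list_correct by (metis distinct_card)
  also have "\<dots> \<le> card (level (length t))" by (rule card_image_le[OF finite_level])
  also have "\<dots> \<le> card (pverts G) + 1" by (rule card_level)
  also have "card (pverts G) = length (ctx_verts P)" using verts distinct_card by metis
  finally show "length (level_list P t) \<le> length (ctx_verts P) + 1" .
qed

end

section \<open>Input and output codes\<close>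

context algorithm_input
begin

text \<open>The entry of \<open>suffixes_of\<close> that represents depth \<open>d\<close>. Its
  length is \<open>d\<close> as long as \<open>d \<le> 2 * card (pverts G)\<close>, which holds at
  every node.\<close>

definition tag :: "nat \<Rightarrow> nat list" where "tag d = rev (take d (ctx_verts P @ ctx_verts P))"

lemma length_verts: "length (ctx_verts P) = card (pverts G)"
  using verts distinct_card by metis

lemma length_tag: "A \<in> level d \<Longrightarrow> length (tag d) = d"
  using level_depth(2)[of A d] by (simp add: tag_def length_verts)

lemma name_of_tag: "A \<in> level d \<Longrightarrow> name_of (tag d) (cl A) = nm d A"
  by (simp add: name_of_cl length_tag)

lemma node_list_eq: "node_list P = concat (map (\<lambda>d. map (\<lambda>C. (tag d, C)) (level_list P (tag d)))
    (rev [0..<Suc (2 * card (pverts G))]))"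
  unfolding node_list_def suffixes_of_eq tag_def
  by (simp add: o_def length_verts mult_2 del: upt_Suc)

lemma length_tag': "d \<le> 2 * card (pverts G) \<Longrightarrow> length (tag d) = d"
  by (simp add: tag_def length_verts)

lemma node_list_iff: "z \<in> set (node_list P) \<longleftrightarrow> (\<exists>d A. A \<in> level d \<and> z = (tag d, cl A))"
proof -
  have "z \<in> set (node_list P) \<longleftrightarrow>
      (\<exists>d\<le>2 * card (pverts G). \<exists>C\<in>set (level_list P (tag d)). z = (tag d, C))"
    unfolding node_list_eq by (auto simp: less_Suc_eq_le simp del: upt_Suc)
  also have "\<dots> \<longleftrightarrow> (\<exists>d\<le>2 * card (pverts G). \<exists>A\<in>level d. z = (tag d, cl A))"
  proof -
    have "(\<exists>C\<in>set (level_list P (tag d)). z = (tag d, C)) \<longleftrightarrow> (\<exists>A\<in>level d. z = (tag d, cl A))"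
      if "d \<le> 2 * card (pverts G)" for d
      using level_list_correct[of "tag d"] length_tag'[OF that] by simp
    then show ?thesis by blast
  qed
  also have "\<dots> \<longleftrightarrow> (\<exists>d A. A \<in> level d \<and> z = (tag d, cl A))"
    using level_depth(2) by blast
  finally show ?thesis .
qed

lemma distinct_node_list: "distinct (node_list P)"
  unfolding node_list_eq
proof (rule distinct_concat_map)
  show "distinct (map (\<lambda>C. (tag d, C)) (level_list P (tag d)))" for d
    using level_list_correct by (auto simp: distinct_map inj_on_def)
  fix d e z
  assume "d \<in> set (rev [0..<Suc (2 * card (pverts G))])" "e \<in> set (rev [0..<Suc (2 * card (pverts G))])"
    "z \<in> set (map (\<lambda>C. (tag d, C)) (level_list P (tag d)))" "z \<in> set (map (\<lambda>C. (tag e, C)) (level_list P (tag e)))"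
  then have "tag d = tag e" "d \<le> 2 * card (pverts G)" "e \<le> 2 * card (pverts G)"
    by (auto simp del: upt_Suc)
  then show "d = e" using length_tag' by metis
qed simp

lemma distinct_names: "distinct (map (\<lambda>z. name_of (fst z) (snd z)) (node_list P))"
  unfolding distinct_map
proof (intro conjI distinct_node_list inj_onI)
  fix z z' assume z: "z \<in> set (node_list P)" "z' \<in> set (node_list P)"
    "name_of (fst z) (snd z) = name_of (fst z') (snd z')"
  obtain d A where A: "A \<in> level d" "z = (tag d, cl A)" using z(1) node_list_iff by blast
  obtain d' A' where A': "A' \<in> level d'" "z' = (tag d', cl A')" using z(2) node_list_iff by blast
  have "nm d A = nm d' A'" using z(3) A A' name_of_tag by simp
  then show "z = z'" using nm_inj A A' by blast
qed

lemma set_names: "set (map (\<lambda>z. name_of (fst z) (snd z)) (node_list P)) = pverts new_tree"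
proof (intro equalityI subsetI)
  fix t assume "t \<in> set (map (\<lambda>z. name_of (fst z) (snd z)) (node_list P))"
  then obtain d A where "A \<in> level d" "t = name_of (tag d) (cl A)" using node_list_iff by auto
  then show "t \<in> pverts new_tree" using name_of_tag verts_new_tree by auto
next
  fix t assume "t \<in> pverts new_tree"
  then obtain d A where A: "A \<in> level d" "t = nm d A" using verts_new_tree by blast
  then have "(tag d, cl A) \<in> set (node_list P)" using node_list_iff by blast
  then show "t \<in> set (map (\<lambda>z. name_of (fst z) (snd z)) (node_list P))"
    using A name_of_tag by force
qed

lemma set_arcs_of:
  assumes A: "A \<in> level d"
  shows "set (arcs_of P (tag d, cl A)) = (\<lambda>A'. (nm d A, nm (Suc d) A')) ` kids A"
  unfolding arcs_of_def using set_kids_list[OF level_subset[OF A]]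
  by (simp add: image_image name_of_cl length_tag[OF A])

lemma set_arc_list: "set (concat (map (arcs_of P) (node_list P))) = parcs new_tree"
proof (intro equalityI subsetI)
  fix e assume "e \<in> set (concat (map (arcs_of P) (node_list P)))"
  then obtain d A where A: "A \<in> level d" "e \<in> set (arcs_of P (tag d, cl A))" using node_list_iff by auto
  then show "e \<in> parcs new_tree" unfolding set_arcs_of[OF A(1)] by (auto simp: new_tree_def)
next
  fix e assume "e \<in> parcs new_tree"
  then obtain d A where A: "A \<in> level d" "e \<in> (\<lambda>A'. (nm d A, nm (Suc d) A')) ` kids A"
    by (auto simp: new_tree_def)
  then have "(tag d, cl A) \<in> set (node_list P)" using node_list_iff by blast
  then show "e \<in> set (concat (map (arcs_of P) (node_list P)))"
    using A(2) unfolding set_arcs_of[OF A(1), symmetric] by auto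
qed

lemma distinct_arc_list: "distinct (concat (map (arcs_of P) (node_list P)))"
proof (rule distinct_concat_map[OF distinct_node_list])
  fix z assume "z \<in> set (node_list P)"
  then obtain d A where A: "A \<in> level d" "z = (tag d, cl A)" using node_list_iff by blast
  show "distinct (arcs_of P z)"
    unfolding arcs_of_def distinct_map
  proof (intro conjI inj_onI)
    show "distinct (kids_list P (snd z))" using distinct_kids_list[OF level_subset[OF A(1)]] A(2) by simp
    fix C C' assume C: "C \<in> set (kids_list P (snd z))" "C' \<in> set (kids_list P (snd z))"
      "(name_of (fst z) (snd z), name_of (0 # fst z) C) = (name_of (fst z) (snd z), name_of (0 # fst z) C')"
    obtain B where B: "C = cl B" "B \<in> kids A"
      using C(1) A(2) set_kids_list[OF level_subset[OF A(1)]] by auto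
    obtain B' where B': "C' = cl B'" "B' \<in> kids A"
      using C(2) A(2) set_kids_list[OF level_subset[OF A(1)]] by auto
    have "nm (Suc d) B = nm (Suc d) B'"
      using C(3) A B B' by (simp add: name_of_cl length_tag[OF A(1)])
    then show "C = C'" using nm_inj level_Suc_kids[OF A(1)] B B' by blast
  qed
next
  fix z z' e assume z: "z \<in> set (node_list P)" "z' \<in> set (node_list P)"
    and "e \<in> set (arcs_of P z)" "e \<in> set (arcs_of P z')"
  then have "name_of (fst z) (snd z) = name_of (fst z') (snd z')" by (auto simp: arcs_of_def)
  then show "z = z'" using distinct_names z unfolding distinct_map inj_on_def by blast
qed

lemma bag_of_correct:
  assumes A: "A \<in> level d"
  shows "set (bag_of P (tag d, cl A)) = new_bag (nm d A)" "distinct (bag_of P (tag d, cl A))"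
proof -
  note sub = level_subset[OF A]
  show "set (bag_of P (tag d, cl A)) = new_bag (nm d A)"
    using set_nbrs[OF sub] set_cl[OF sub] unfolding new_bag_nm[OF A] bag_def bag_of_def sel_def by auto
  show "distinct (bag_of P (tag d, cl A))"
    using set_nbrs[OF sub] set_cl[OF sub] N_disjoint[of A] distinct_nbrs
    unfolding bag_of_def by auto
qed

end

section \<open>Codes of graphs and decompositions as codes of lists\<close>

lemma enc_nat_code: "enc_nat = code"
  by (simp add: fun_eq_iff code_nat_eq)

lemma enc_arc_code: "enc_arc = code"
  by (simp add: fun_eq_iff enc_arc_def code_prod_eq enc_nat_code)

lemma set_codes_iff: "d \<in> set_codes code A \<longleftrightarrow> (\<exists>xs. d = code xs \<and> distinct xs \<and> set xs = A)"
  by (auto simp: set_codes_def code_list_eq)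

lemma graph_codes_iff: "d \<in> graph_codes H \<longleftrightarrow>
    (\<exists>vs es. d = code (vs, es) \<and> distinct vs \<and> set vs = pverts H \<and> distinct es \<and> set es = parcs H)"
  unfolding graph_codes_def enc_nat_code enc_arc_code by (auto simp: set_codes_iff)

definition bag_lists :: "nat pair_pre_digraph \<Rightarrow> (nat \<Rightarrow> nat set) \<Rightarrow> (nat \<times> nat list) list \<Rightarrow> bool" where
  "bag_lists T \<beta> bs \<longleftrightarrow> distinct (map fst bs) \<and> set (map fst bs) = pverts T \<and>
     (\<forall>b\<in>set bs. distinct (snd b) \<and> set (snd b) = \<beta> (fst b))"

lemma enc_list_map: "enc_list f (map g xs) = enc_list (\<lambda>x. f (g x)) xs"
  by (induction xs) auto

lemma enc_list_cong: "(\<And>x. x \<in> set xs \<Longrightarrow> f x = g x) \<Longrightarrow> enc_list f xs = enc_list g xs"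
  by (induction xs) auto

lemma bag_codes_iff: "d \<in> bag_codes T \<beta> \<longleftrightarrow> (\<exists>bs. d = code bs \<and> bag_lists T \<beta> bs)"
proof
  assume "d \<in> bag_codes T \<beta>"
  then obtain b ts where d: "d = enc_list (\<lambda>t. Branch (code t) (b t)) ts" "distinct ts" "set ts = pverts T"
    "\<forall>t\<in>pverts T. b t \<in> set_codes code (\<beta> t)"
    unfolding bag_codes_def enc_nat_code by blast
  then have "\<forall>t\<in>pverts T. \<exists>xs. b t = code xs \<and> distinct xs \<and> set xs = \<beta> t"
    unfolding set_codes_iff by blast
  then obtain xs where xs: "\<forall>t\<in>pverts T. b t = code (xs t) \<and> distinct (xs t) \<and> set (xs t) = \<beta> t"
    by metis
  let ?bs = "map (\<lambda>t. (t, xs t)) ts"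
  have "d = code ?bs"
    unfolding d(1) code_list_eq[of ?bs] enc_list_map by (rule enc_list_cong) (use xs d(3) in auto)
  moreover have "bag_lists T \<beta> ?bs" using d xs by (auto simp: bag_lists_def o_def)
  ultimately show "\<exists>bs. d = code bs \<and> bag_lists T \<beta> bs" by blast
next
  assume "\<exists>bs. d = code bs \<and> bag_lists T \<beta> bs"
  then obtain bs where bs: "d = code bs" "bag_lists T \<beta> bs" by blast
  \<comment> \<open>A code of the bag function asks for a function on nodes, which is recovered from
    the association list.\<close>
  define b where "b t = code (the (map_of bs t))" for t
  have map_of: "map_of bs (fst x) = Some (snd x)" if "x \<in> set bs" for x
    using bs(2) that by (simp add: bag_lists_def)
  have "d = enc_list (\<lambda>t. Branch (enc_nat t) (b t)) (map fst bs)"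
    unfolding bs(1) code_list_eq[of bs] enc_list_map enc_nat_code
    by (rule enc_list_cong) (simp add: b_def map_of code_prod_eq)
  moreover have "b t \<in> set_codes enc_nat (\<beta> t)" if t: "t \<in> pverts T" for t
  proof -
    have "t \<in> set (map fst bs)" using bs(2) t by (simp add: bag_lists_def)
    then obtain x where x: "x \<in> set bs" "t = fst x" by auto
    have "b t = code (snd x)" by (simp add: b_def x(2) map_of[OF x(1)])
    moreover have "distinct (snd x)" "set (snd x) = \<beta> t" using bs(2) x by (auto simp: bag_lists_def)
    ultimately show ?thesis unfolding enc_nat_code set_codes_iff by blast
  qed
  moreover have "distinct (map fst bs)" "set (map fst bs) = pverts T"
    using bs(2) unfolding bag_lists_def by blast+
  ultimately show "d \<in> bag_codes T \<beta>" unfolding bag_codes_def by blast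
qed

definition decomposition_lists :: "decomposition \<Rightarrow> tree_lists \<Rightarrow> bool" where
  "decomposition_lists D L \<longleftrightarrow> (case D of (T, r, \<beta>) \<Rightarrow>
     distinct (fst (fst L)) \<and> set (fst (fst L)) = pverts T \<and>
     distinct (snd (fst L)) \<and> set (snd (fst L)) = parcs T \<and>
     fst (snd L) = r \<and> bag_lists T \<beta> (snd (snd L)))"

lemma decomposition_codes_iff:
  "d \<in> decomposition_codes D \<longleftrightarrow> (\<exists>L. d = code L \<and> decomposition_lists D L)"
proof (cases D)
  case (fields T r \<beta>)
  have "d \<in> decomposition_codes D \<longleftrightarrow> (\<exists>dT db. d = Branch dT (Branch (code r) db) \<and>
      dT \<in> graph_codes T \<and> db \<in> bag_codes T \<beta>)"
    unfolding fields by (simp add: enc_nat_code)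
  also have "\<dots> \<longleftrightarrow> (\<exists>L. d = code L \<and> decomposition_lists D L)"
    unfolding graph_codes_iff bag_codes_iff decomposition_lists_def fields
    by (auto simp: code_prod_eq)
  finally show ?thesis .
qed

definition instance_lists :: "nat pair_pre_digraph \<Rightarrow> decomposition \<Rightarrow> input_lists \<Rightarrow> bool" where
  "instance_lists G D I \<longleftrightarrow> distinct (fst (fst I)) \<and> set (fst (fst I)) = pverts G \<and>
     set (snd (fst I)) = parcs G \<and> decomposition_lists D (snd (snd (snd I)))"

lemma instance_codesE:
  assumes "d \<in> instance_codes (G, k, q, D)"
  obtains I where "d = code I" "instance_lists G D I"
proof -
  obtain dG dD where d: "d = Branch dG (Branch (code k) (Branch (code q) dD))"
    "dG \<in> graph_codes G" "dD \<in> decomposition_codes D"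
    using assms by (auto simp: enc_nat_code)
  obtain vs es where G: "dG = code (vs, es)" "distinct vs" "set vs = pverts G" "set es = parcs G"
    using d(2) unfolding graph_codes_iff by blast
  obtain L where L: "dD = code L" "decomposition_lists D L" using d(3) unfolding decomposition_codes_iff by blast
  show ?thesis
    by (rule that[of "((vs, es), k, q, L)"]) (use d G L in \<open>auto simp: instance_lists_def\<close>)
qed

lemma longest_ge: "ys \<in> set xss \<Longrightarrow> length ys \<le> length (longest xss)"
  and longest_in: "longest xss \<in> set xss \<or> longest xss = []"
proof -
  have *: "longest xss \<in> set xss \<and> (\<forall>ys\<in>set xss. length ys \<le> length (longest xss))" if "xss \<noteq> []"
  proof -
    have "\<exists>xs. xs \<in> set xss \<and> (\<forall>ys. ys \<in> set xss \<longrightarrow> length ys \<le> length xs)"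
      using ex_has_greatest_nat[of "\<lambda>xs. xs \<in> set xss" "hd xss" length "Max (length ` set xss) + 1"] that
      by (auto simp: less_Suc_eq_le)
    then have "filter (\<lambda>xs. \<forall>ys\<in>set xss. length ys \<le> length xs) xss \<noteq> []"
      by (auto simp: filter_empty_conv)
    from hd_or_in[OF this, of "[]"] show ?thesis unfolding longest_def by auto
  qed
  show "ys \<in> set xss \<Longrightarrow> length ys \<le> length (longest xss)" using * by (cases xss) auto
  show "longest xss \<in> set xss \<or> longest xss = []" using * by (cases xss) (auto simp: longest_def)
qed

lemma lookup_bag_eq:
  "distinct (map fst bs) \<Longrightarrow> b \<in> set bs \<Longrightarrow> lookup_bag bs (fst b) = snd b"
proof (induction bs)
  case (Cons a bs)
  have "fst a \<notin> fst ` set bs" using Cons.prems(1) by simp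
  then have none: "filter (\<lambda>c. fst c = fst a) bs = []" unfolding filter_empty_conv by (metis image_eqI)
  show ?case
  proof (cases "b = a")
    case True
    then show ?thesis using none by (simp add: lookup_bag_def)
  next
    case False
    then have "b \<in> set bs" using Cons.prems by simp
    moreover from this have "fst a \<noteq> fst b" using Cons.prems(1) by force
    ultimately show ?thesis using Cons by (simp add: lookup_bag_def)
  qed
qed simp

lemma bag_lists_lookup:
  assumes "bag_lists T \<beta> bs" "t \<in> pverts T"
  shows "set (lookup_bag bs t) = \<beta> t" "distinct (lookup_bag bs t)" "lookup_bag bs t \<in> snd ` set bs"
proof -
  have "t \<in> fst ` set bs" using assms by (simp add: bag_lists_def)
  then obtain b where "b \<in> set bs" "t = fst b" by blast
  then show "set (lookup_bag bs t) = \<beta> t" "distinct (lookup_bag bs t)" "lookup_bag bs t \<in> snd ` set bs"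
    using assms(1) lookup_bag_eq[of bs b] by (auto simp: bag_lists_def)
qed

lemma adhesion_lists_correct:
  assumes L: "decomposition_lists (T, r, \<beta>) L" and T: "rooted_tree T r"
  shows "length ` set (adhesion_lists L) = (\<lambda>(p, t). card (\<beta> t \<inter> \<beta> p)) ` parcs T"
proof -
  interpret out_tree T r by standard (rule T)
  have bl: "bag_lists T \<beta> (snd (snd L))" and arcs: "set (snd (fst L)) = parcs T"
    using L by (simp_all add: decomposition_lists_def)
  have "length (filter (\<lambda>v. v \<in> set (lookup_bag (snd (snd L)) (fst e))) (lookup_bag (snd (snd L)) (snd e)))
      = (\<lambda>(p, t). card (\<beta> t \<inter> \<beta> p)) e" if e: "e \<in> parcs T" for e
  proof -
    obtain p t where pt: "e = (p, t)" "p \<in> pverts T" "t \<in> pverts T" using arcs_in e by (cases e) blast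
    note p = bag_lists_lookup[OF bl pt(2)] and t = bag_lists_lookup[OF bl pt(3)]
    have "set (filter (\<lambda>v. v \<in> set (lookup_bag (snd (snd L)) p)) (lookup_bag (snd (snd L)) t)) = \<beta> t \<inter> \<beta> p"
      using p(1) t(1) by auto
    moreover have "distinct (filter (\<lambda>v. v \<in> set (lookup_bag (snd (snd L)) p)) (lookup_bag (snd (snd L)) t))"
      using t(2) by simp
    ultimately show ?thesis using pt(1) distinct_card by fastforce
  qed
  then show ?thesis
    unfolding adhesion_lists_def set_map arcs image_image by (rule image_cong[OF refl])
qed

text \<open>Taking \<open>K\<close> as the maximum of the adhesion sizes serves both ends: it bounds
  all adhesions, as the existence of good bags requires, and it is at most \<open>k\<close>.\<close>

lemma context_of_correct:
  assumes I: "instance_lists G (T, r, \<beta>) I" and G: "pair_graph G"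
    and dec: "rooted_tree_decomposition G T r \<beta>" and k: "adhesions_le T \<beta> k"
  shows "algorithm_input G (context_of I)" "length (ctx_adh (context_of I)) \<le> k"
    "set ` set (ctx_bags (context_of I)) = \<beta> ` pverts T"
proof -
  let ?L = "snd (snd (snd I))"
  have L: "decomposition_lists (T, r, \<beta>) ?L" using I by (simp add: instance_lists_def)
  have T: "rooted_tree T r" using dec by (simp add: rooted_tree_decomposition_def)
  interpret tree_decomposition T r G \<beta>
    by (intro tree_decomposition.intro out_tree.intro tree_decomposition_axioms.intro T G dec)
  have adh: "ctx_adh (context_of I) = longest (adhesion_lists ?L)" by (simp add: context_of_def)
  note lens = adhesion_lists_correct[OF L T]
  have K: "adhesions_le T \<beta> (length (ctx_adh (context_of I)))"
    unfolding adhesions_le_def adh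
  proof
    fix e assume "e \<in> parcs T"
    then have "(\<lambda>(p, t). card (\<beta> t \<inter> \<beta> p)) e \<in> length ` set (adhesion_lists ?L)" unfolding lens by (rule imageI)
    then show "case e of (p, t) \<Rightarrow> card (\<beta> t \<inter> \<beta> p) \<le> length (longest (adhesion_lists ?L))"
      using longest_ge by (cases e) auto
  qed
  show "length (ctx_adh (context_of I)) \<le> k"
  proof (cases "longest (adhesion_lists ?L) = []")
    case False
    then have "length (longest (adhesion_lists ?L)) \<in> length ` set (adhesion_lists ?L)" using longest_in by blast
    then show ?thesis using k unfolding lens adh adhesions_le_def by auto
  qed (simp add: adh)
  have bl: "bag_lists T \<beta> (snd (snd ?L))" using L by (simp add: decomposition_lists_def)
  have bags: "ctx_bags (context_of I) = map snd (snd (snd ?L))" by (simp add: context_of_def)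
  have "set ` set (ctx_bags (context_of I)) = (\<lambda>b. \<beta> (fst b)) ` set (snd (snd ?L))"
    using bl unfolding bags set_map image_image bag_lists_def by (intro image_cong) auto
  also have "\<dots> = \<beta> ` pverts T"
    using bl unfolding bag_lists_def by (metis image_image list.set_map)
  finally show sets: "set ` set (ctx_bags (context_of I)) = \<beta> ` pverts T" .
  show "algorithm_input G (context_of I)"
  proof (rule algorithm_input.intro[OF G])
    show "distinct (ctx_verts (context_of I))" "set (ctx_verts (context_of I)) = pverts G"
      "set (ctx_arcs (context_of I)) = parcs G"
      using I by (simp_all add: instance_lists_def context_of_def)
    fix C assume C: "C \<subseteq> pverts G" "card (neighbourhood G C) \<le> 4 * length (ctx_adh (context_of I))"
    then obtain t where t: "t \<in> pverts T" "good_bag G (length (ctx_adh (context_of I))) C (\<beta> t)"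
      using good_bag_exists[OF K C] by blast
    then have "\<beta> t \<in> set ` set (ctx_bags (context_of I))" unfolding sets by blast
    then show "\<exists>B\<in>set (ctx_bags (context_of I)). good_bag G (length (ctx_adh (context_of I))) C (set B)"
      using t(2) by auto
  qed
qed

lemma (in algorithm_input) output_correct:
  "decomposition_lists (new_tree, nm 0 (pverts G), new_bag) (output_of P)"
proof -
  let ?bs = "map (\<lambda>z. (name_of (fst z) (snd z), bag_of P z)) (node_list P)"
  have fst_bs: "map fst ?bs = map (\<lambda>z. name_of (fst z) (snd z)) (node_list P)" by simp
  have "distinct (snd b) \<and> set (snd b) = new_bag (fst b)" if b: "b \<in> set ?bs" for b
  proof -
    obtain d A where A: "A \<in> level d" "b = (name_of (tag d) (cl A), bag_of P (tag d, cl A))"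
      using b node_list_iff by auto
    then show ?thesis using bag_of_correct[OF A(1)] name_of_tag by simp
  qed
  then have "bag_lists new_tree new_bag ?bs"
    unfolding bag_lists_def fst_bs using distinct_names set_names by blast
  moreover have "name_of [] (ctx_verts P) = nm 0 (pverts G)"
    using name_of_cl[of "[]" "pverts G"] by (simp add: cl_verts)
  ultimately show ?thesis
    unfolding decomposition_lists_def output_of_def
    using distinct_names set_names distinct_arc_list set_arc_list by simp
qed

text \<open>The promise enters the running time here, through the bound on the size of the level
  lists.\<close>

lemma ptime_algorithm:
  "ptime {I. \<exists>G. algorithm_input G (context_of I)} (\<lambda>I. output_of (context_of I))"
proof (rule ptime_comp[of "{P. \<exists>G. algorithm_input G P}"])
  show "ptime {P. \<exists>G. algorithm_input G P} output_of"
  proof (rule ptime_output_of)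
    fix P t assume "P \<in> {P. \<exists>G. algorithm_input G P}"
    then show "sz (level_list P t) \<le> (length (ctx_verts P) + 1) * (sz (ctx_verts P) + 1) + 1"
      using algorithm_input.sz_level_list by blast
  next
    show "pbd {P. \<exists>G. algorithm_input G P} (\<lambda>P. (length (ctx_verts P) + 1) * (sz (ctx_verts P) + 1) + 1)"
      by (intro pbd_add pbd_mult pbd_const ptime_length_pbd ptime_sz ptime_fst ptime_id)
  qed
  show "ptime {I. \<exists>G. algorithm_input G (context_of I)} context_of"
    by (rule ptime_subset[OF ptime_context_of]) simp
qed auto

lemma edge_unbreakable_mono: "edge_unbreakable G q s X \<Longrightarrow> q \<le> q' \<Longrightarrow> edge_unbreakable G q' s X"
  unfolding edge_unbreakable_def by (meson order_trans)

lemma adhesions_le_mono: "adhesions_le T \<beta> k \<Longrightarrow> k \<le> k' \<Longrightarrow> adhesions_le T \<beta> k'"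
  unfolding adhesions_le_def by fastforce

theorem theorem3p7:
  shows "\<exists>algorithm :: com.
    poly_time_solves algorithm instance_codes decomposition_codes
      (\<lambda>(G, k, q, T, r, \<beta>).
         pair_graph G \<and> k > 0 \<and> q > 0 \<and>
         rooted_tree_decomposition G T r \<beta> \<and>
         adhesions_le T \<beta> k \<and>
         (\<forall>t\<in>pverts T. edge_unbreakable G q k (\<beta> t)))
      (\<lambda>(G, k, q, T, r, \<beta>) (T', r', \<beta>').
         rooted_tree_decomposition G T' r' \<beta>' \<and>
         (Digraph_Component.connected (with_proj G) \<longrightarrow> compact_decomposition G T' \<beta>') \<and>
         compact_below_root G T' r' \<beta>' \<and>
         adhesions_le T' \<beta>' (8 * k) \<and>
         (\<forall>t\<in>pverts T'. edge_unbreakable G (q + 8 * k) k (\<beta>' t)) \<and>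
         int (tree_depth T' r') \<le> 2 * \<lceil>log 2 (real (card (pverts G)))\<rceil>)"
proof -
  let ?D = "{I. \<exists>G. algorithm_input G (context_of I)}"
  obtain c n B where c: "runs c n ?D (\<lambda>I. output_of (context_of I)) B" and B: "pbd ?D B"
    using ptime_algorithm by (rule ptimeE)
  obtain e where e: "\<And>I. I \<in> ?D \<Longrightarrow> B I \<le> (sz I + 1) ^ e" using B unfolding pbd_def by blast
  show ?thesis
    unfolding poly_time_solves_def
  \<comment> \<open>The polynomial \<open>[:1, 1:]\<close> takes the value \<open>x + 1\<close> at
    \<open>x\<close>, so its power is the bound in \<open>pbd\<close>.\<close>
  proof (rule exI[of _ c], rule exI[of _ "[:1, 1:] ^ e"], intro allI impI, elim conjE)
    fix x :: "nat pair_pre_digraph \<times> nat \<times> nat \<times> decomposition" and d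
    assume d: "d \<in> instance_codes x"
    obtain G k q T r \<beta> where x: "x = (G, k, q, T, r, \<beta>)" by (cases x) auto
    assume "case x of (G, k, q, T, r, \<beta>) \<Rightarrow>
         pair_graph G \<and> k > 0 \<and> q > 0 \<and>
         rooted_tree_decomposition G T r \<beta> \<and>
         adhesions_le T \<beta> k \<and>
         (\<forall>t\<in>pverts T. edge_unbreakable G q k (\<beta> t))"
    then have pre: "pair_graph G" "rooted_tree_decomposition G T r \<beta>" "adhesions_le T \<beta> k"
      and unbr: "\<And>t. t \<in> pverts T \<Longrightarrow> edge_unbreakable G q k (\<beta> t)"
      unfolding x by auto
    obtain I where I: "d = code I" "instance_lists G (T, r, \<beta>) I"
      using instance_codesE d unfolding x by blast
    define P where "P = context_of I"
    note ctx = context_of_correct[OF I(2) pre, folded P_def]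
    interpret algorithm_input G P by (rule ctx(1))
    have ID: "I \<in> ?D" using ctx(1) unfolding P_def by blast
    have "((\<lambda>_. Leaf)(0 := d)) 0 = code I" using I(1) by simp
    then obtain s where s: "exec_within c ((\<lambda>_. Leaf)(0 := d)) (B I) s" "s 0 = code (output_of P)"
      using runsE[OF c ID, of "(\<lambda>_. Leaf)(0 := d)"] unfolding P_def by blast
    then obtain t where t: "exec c ((\<lambda>_. Leaf)(0 := d)) t s" "t \<le> B I" unfolding exec_within_def by blast
    have "t \<le> poly ([:1, 1:] ^ e) (dsize d)" using t(2) e[OF ID] I(1) by simp
    moreover have "s 0 \<in> decomposition_codes (new_tree, nm 0 V, new_bag)"
      unfolding decomposition_codes_iff using s(2) output_correct by blast
    \<comment> \<open>The new adhesions have size at most \<open>4 * K\<close>, and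
      \<open>K \<le> k\<close>.\<close>
    moreover have "adhesions_le new_tree new_bag (8 * k)"
      by (rule adhesions_le_mono[OF new_adhesions]) (use ctx(2) in simp)
    moreover have "edge_unbreakable G (q + 8 * k) k (new_bag t)" if "t \<in> pverts new_tree" for t
    proof (rule edge_unbreakable_mono[OF new_unbreakable[OF _ that]])
      fix A assume "A \<subseteq> V" "card (N A) \<le> 4 * length (ctx_adh P)"
      \<comment> \<open>A selected bag is one of the input bags and so inherits their
        unbreakability.\<close>
      then have "sel A \<in> set ` set (ctx_bags P)" unfolding sel_def using sel_list_good(1) by blast
      then obtain t where "t \<in> pverts T" "sel A = \<beta> t" unfolding ctx(3) by blast
      then show "edge_unbreakable G q k (sel A)" using unbr by simp
    qed (use ctx(2) in simp)
    ultimately show "\<exists>t s y. exec c ((\<lambda>_. Leaf)(0 := d)) t s \<and> t \<le> poly ([:1, 1:] ^ e) (dsize d) \<and>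
       s 0 \<in> decomposition_codes y \<and>
       (case x of (G, k, q, T, r, \<beta>) \<Rightarrow> \<lambda>(T', r', \<beta>').
         rooted_tree_decomposition G T' r' \<beta>' \<and>
         (Digraph_Component.connected (with_proj G) \<longrightarrow> compact_decomposition G T' \<beta>') \<and>
         compact_below_root G T' r' \<beta>' \<and>
         adhesions_le T' \<beta>' (8 * k) \<and>
         (\<forall>t\<in>pverts T'. edge_unbreakable G (q + 8 * k) k (\<beta>' t)) \<and>
         int (tree_depth T' r') \<le> 2 * \<lceil>log 2 (real (card (pverts G)))\<rceil>) y"
      using t(1) new_decomposition new_compact new_compact_below new_depth
      by (intro exI[of _ t] exI[of _ s] exI[of _ "(new_tree, nm 0 V, new_bag)"]) (simp add: x)
  qed
qed

end
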